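(* Let $G=(V,E)$ be a connected locally finite weighted graph with measure $\mu$, and let $\Omega\subset V$ be a bounded domain with $\Omega^{\circ}\neq\emptyset$ and $\partial\Omega\neq\emptyset$. Let $p,q,r>1$, $\lambda_1,\lambda_2,\alpha,\beta>0$, $k\ge0$ with $r<\min\{p,q\}\le (k+1)\max\{p,q\}<\alpha+\beta$; let $M_i(s)=a_i+b_is^k$ with $a_i,b_i>0$, $i=1,2$; let $h_1,h_2,h_3:\Omega\to(0,\infty)$ and $g_1,g_2:\Omega\to\mathbb{R}$. Consider the system $$\begin{cases}-M_1(\|\nabla u\|_p^p)\Delta_pu=\lambda_1 h_1(x)|u|^{r-2}u+\frac{\alpha}{\alpha+\beta}h_2(x)|u|^{\alpha-2}u|v|^{\beta}+g_1(x), & x\in\Omega,\\ -M_2(\|\nabla v\|_q^q)\Delta_qv=\lambda_2 h_3(x)|v|^{r-2}v+\frac{\beta}{\alpha+\beta}h_2(x)|u|^{\alpha}|v|^{\beta-2}v+g_2(x), & x\in\Omega,\\ u(x)=v(x)=0, & x\in\partial\Omega.\end{cases}$$ (1) If $g_1\not\equiv0$ and $g_2\equiv0$ on $\Omega$, then the system admits at least one semi-trivial solution of the form $(u_0,0)$. (2) If $g_2\not\equiv0$ and $g_1\equiv0$ on $\Omega$, then the system admits at least one semi-trivial solution of the form $(0,v_0)$. (3) If $g_1\equiv0$ and $g_2\equiv0$ on $\Omega$, then for every $\lambda_1>0$ the system has $\#\Omega$ distinct semi-trivial solutions $(u_{0,j},0)$, $j=1,\dots,\#\Omega$, and for every $\lambda_2>0$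 it has $\#\Omega$ distinct semi-trivial solutions $(0,v_{0,j})$, $j=1,\dots,\#\Omega$, where $\#\Omega$ denotes the number of elements of $\Omega$.
   Context: Graph setting. $G=(V,E)$ is a connected graph in which every vertex has finitely many edges; each edge $xy\in E$ has a weight $\omega_{xy}=\omega_{yx}>0$; $y\sim x$ means $xy\in E$. $\mu:V\to(0,\infty)$ is a (finite) vertex measure with $\mu(x)\ge\mu_0>0$ for all $x$. The distance $d(x,y)$ is the minimal number of edges in a path linking $x$ to $y$. $\Omega\subset V$ is a bounded domain if $d(x,y)$ is uniformly bounded for $x,y\in\Omega$ (so $\Omega$ is finite). $\partial\Omega=\{y\in V\setminus\Omega:\exists x\in\Omega,\ xy\in E\}$ and $\Omega^\circ=\Omega\setminus\partial\Omega$. For $A\subset V$, $\int_A\psi\,d\mu=\sum_{x\in A}\mu(x)\psi(x)$. Operators. $\Gamma(\psi_1,\psi_2)(x)=\frac{1}{2\mu(x)}\sum_{y\sim x}\omega_{xy}(\psi_1(y)-\psi_1(x))(\psi_2(y)-\psi_2(x))$, $|\nabla\psi|(x)=\sqrt{\Gamma(\psi,\psi)(x)}$, and for $l>1$ $$\Delta_l\psi(x)=\frac{1}{2\mu(x)}\sum_{y\sim x}\left(|\nabla\psi|^{l-2}(y)+|\nabla\psi|^{l-2}(x)\right)\omega_{xy}(\psi(y)-\psi(x)).$$ Convention: a product of a possibly negative power of $0$ with a vanishing factor is read as $0$ (for instance $|\nabla\psi|^{l-2}(x)(\psi(y)-\psi(x))=0$ if $|\nabla\psi|(x)=0$, and $|t|^{s-2}t=0$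 at $t=0$). Spaces. $C_c(\Omega)$ is the set of $\psi:V\to\mathbb{R}$ with $\psi=0$ on $V\setminus\Omega$. $W_0^{1,l}(\Omega)$ is the completion of $C_c(\Omega)$ (hence, $\Omega$ being finite, $C_c(\Omega)$ itself) under $\|u\|_{W_0^{1,l}(\Omega)}=\left(\int_{\Omega\cup\partial\Omega}|\nabla u|^l d\mu\right)^{1/l}$. Here $\|\nabla u\|_l^l$ means $\|u\|_{W_0^{1,l}(\Omega)}^l$. Solutions. A solution is a pair $(u,v)\in W_0^{1,p}(\Omega)\times W_0^{1,q}(\Omega)$ satisfying the system pointwise. A semi-trivial solution is a solution $(u,v)\neq(0,0)$ such that one of $u$ and $v$ is identically zero. *)

theory Defs
  imports "HOL-Analysis.Analysis"
begin

(* The vertex set is the whole type 'v, so that functions V -> R are exactly the functions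
   of type 'v => real.  The values of weight on non-adjacent pairs are never used. *)
record 'v measured_graph =
  adj :: "'v \<Rightarrow> 'v \<Rightarrow> bool"
  weight :: "'v \<Rightarrow> 'v \<Rightarrow> real"
  vmeas :: "'v \<Rightarrow> real"

(* Loops are not excluded: they contribute 0 to every difference operator below and never
   produce boundary points. *)
locale connected_measured_graph =
  fixes G :: "'v measured_graph" (structure)
  assumes adj_sym: "adj G x y \<Longrightarrow> adj G y x"
    and locally_finite: "finite {y. adj G x y}"
    and connected: "(adj G)\<^sup>*\<^sup>* x y"
    and weight_pos: "adj G x y \<Longrightarrow> weight G x y > 0"
    and weight_sym: "adj G x y \<Longrightarrow> weight G x y = weight G y x"
    and vmeas_lower_bound: "\<exists>\<mu>0>0. \<forall>x. vmeas G x \<ge> \<mu>0"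

definition graph_dist :: "'v measured_graph \<Rightarrow> 'v \<Rightarrow> 'v \<Rightarrow> nat" where
  "graph_dist G x y = (LEAST n. (adj G ^^ n) x y)"

definition bounded_domain :: "'v measured_graph \<Rightarrow> 'v set \<Rightarrow> bool" where
  "bounded_domain G \<Omega> \<longleftrightarrow> (\<exists>D. \<forall>x\<in>\<Omega>. \<forall>y\<in>\<Omega>. graph_dist G x y \<le> D)"

definition vboundary :: "'v measured_graph \<Rightarrow> 'v set \<Rightarrow> 'v set" where
  "vboundary G \<Omega> = {y. y \<notin> \<Omega> \<and> (\<exists>x\<in>\<Omega>. adj G x y)}"

definition vinterior :: "'v measured_graph \<Rightarrow> 'v set \<Rightarrow> 'v set" where
  "vinterior G \<Omega> = \<Omega> - vboundary G \<Omega>"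

definition vintegral :: "'v measured_graph \<Rightarrow> 'v set \<Rightarrow> ('v \<Rightarrow> real) \<Rightarrow> real" where
  "vintegral G A \<psi> = (\<Sum>x\<in>A. vmeas G x * \<psi> x)"

definition grad_form :: "'v measured_graph \<Rightarrow> ('v \<Rightarrow> real) \<Rightarrow> ('v \<Rightarrow> real) \<Rightarrow> 'v \<Rightarrow> real" where
  "grad_form G \<psi>1 \<psi>2 x =
     1 / (2 * vmeas G x) *
     (\<Sum>y | adj G x y. weight G x y * (\<psi>1 y - \<psi>1 x) * (\<psi>2 y - \<psi>2 x))"

definition grad_norm :: "'v measured_graph \<Rightarrow> ('v \<Rightarrow> real) \<Rightarrow> 'v \<Rightarrow> real" where
  "grad_norm G \<psi> x = sqrt (grad_form G \<psi> \<psi> x)"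

(* 0 powr a = 0 for every real a.  This agrees with reading a (possibly non-positive) power of 0
   times a vanishing factor as 0: if the gradient vanishes at x or at a neighbour y of x, then
   \<psi> y - \<psi> x = 0.  In particular the case l = 2 is the usual Laplacian. *)
definition graph_laplacian :: "'v measured_graph \<Rightarrow> real \<Rightarrow> ('v \<Rightarrow> real) \<Rightarrow> 'v \<Rightarrow> real" where
  "graph_laplacian G l \<psi> x =
     1 / (2 * vmeas G x) *
     (\<Sum>y | adj G x y. (grad_norm G \<psi> y powr (l - 2) + grad_norm G \<psi> x powr (l - 2)) *
                       weight G x y * (\<psi> y - \<psi> x))"

definition C_c :: "'v set \<Rightarrow> ('v \<Rightarrow> real) set" where
  "C_c \<Omega> = {\<psi>. \<forall>x. x \<notin> \<Omega> \<longrightarrow> \<psi> x = 0}"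

definition W0_norm :: "'v measured_graph \<Rightarrow> real \<Rightarrow> 'v set \<Rightarrow> ('v \<Rightarrow> real) \<Rightarrow> real" where
  "W0_norm G l \<Omega> u =
     vintegral G (\<Omega> \<union> vboundary G \<Omega>) (\<lambda>x. grad_norm G u x powr l) powr (1 / l)"

(* The completion of C_c \<Omega> under W0_norm G l \<Omega>.  For the finite sets \<Omega> considered here
   C_c \<Omega> is finite-dimensional, hence already complete, for every G and l. *)
definition W0 :: "'v measured_graph \<Rightarrow> real \<Rightarrow> 'v set \<Rightarrow> ('v \<Rightarrow> real) set" where
  "W0 G l \<Omega> = C_c \<Omega>"

(* M(s) = a + b s^k for real k >= 0 and s >= 0; the case k = 0 is separated because
   s^0 = 1 also at s = 0, whereas 0 powr 0 = 0. *)
definition kirchhoff :: "real \<Rightarrow> real \<Rightarrow> real \<Rightarrow> real \<Rightarrow> real" where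
  "kirchhoff a b k s = a + b * (if k = 0 then 1 else s powr k)"

(* signed_power s t = |t|^(s-2) t, which is 0 at t = 0 for every real s. *)
definition signed_power :: "real \<Rightarrow> real \<Rightarrow> real" where
  "signed_power s t = \<bar>t\<bar> powr (s - 2) * t"

definition solutions ::
  "'v measured_graph \<Rightarrow> 'v set \<Rightarrow> real \<Rightarrow> real \<Rightarrow> real \<Rightarrow> real \<Rightarrow> real \<Rightarrow>
   (real \<Rightarrow> real) \<Rightarrow> (real \<Rightarrow> real) \<Rightarrow>
   ('v \<Rightarrow> real) \<Rightarrow> ('v \<Rightarrow> real) \<Rightarrow> ('v \<Rightarrow> real) \<Rightarrow> ('v \<Rightarrow> real) \<Rightarrow> ('v \<Rightarrow> real) \<Rightarrow>
   real \<Rightarrow> real \<Rightarrow> (('v \<Rightarrow> real) \<times> ('v \<Rightarrow> real)) set" where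
  "solutions G \<Omega> p q r \<alpha> \<beta> M1 M2 h1 h2 h3 g1 g2 lam1 lam2 =
     {(u, v). u \<in> W0 G p \<Omega> \<and> v \<in> W0 G q \<Omega> \<and>
       (\<forall>x\<in>\<Omega>.
          - M1 (W0_norm G p \<Omega> u powr p) * graph_laplacian G p u x =
            lam1 * h1 x * signed_power r (u x)
            + \<alpha> / (\<alpha> + \<beta>) * h2 x * signed_power \<alpha> (u x) * \<bar>v x\<bar> powr \<beta> + g1 x) \<and>
       (\<forall>x\<in>\<Omega>.
          - M2 (W0_norm G q \<Omega> v powr q) * graph_laplacian G q v x =
            lam2 * h3 x * signed_power r (v x)
            + \<beta> / (\<alpha> + \<beta>) * h2 x * \<bar>u x\<bar> powr \<alpha> * signed_power \<beta> (v x) + g2 x) \<and>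
       (\<forall>x\<in>vboundary G \<Omega>. u x = 0 \<and> v x = 0)}"

definition semi_trivial ::
  "(('v \<Rightarrow> real) \<times> ('v \<Rightarrow> real)) set \<Rightarrow> (('v \<Rightarrow> real) \<times> ('v \<Rightarrow> real)) set" where
  "semi_trivial S =
     {(u, v) \<in> S. (u, v) \<noteq> (\<lambda>_. 0, \<lambda>_. 0) \<and> (u = (\<lambda>_. 0) \<or> v = (\<lambda>_. 0))}"

end

(* A semi-trivial solution (u, 0) is a critical point of an energy J on the finite-dimensional space
   C_c(Omega).  Since r < p, the Kirchhoff term, which grows at least like the p-th power of u,
   makes J coercive, so J has a minimiser; it is nonzero when the inhomogeneity is nonzero.

   If the inhomogeneity vanishes, then J is even and, again because r < p, negative on a small sphere
   of dimension N - 1, where N = card Omega.  Suppose that J had fewer than N nonzero critical points.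
   A discrete gradient descent S, continuous and odd, moves every point of the sphere close to one of
   them, and, because J drops by a definite amount between visits, no orbit comes close to both u
   and -u.  Recording a visited critical point labels the sphere by an odd labelling without
   antipodal labels at nearby points.  Ky Fan's combinatorial lemma, applied to the Kuhn
   triangulation of a cube that is wrapped around the sphere by spherical coordinates, then yields a
   simplex with N distinct labels, a contradiction. *)

theory Submission
  imports Defs
begin

section \<open>Ky Fan's lemma on the Kuhn grid\<close>

text \<open>The exponents \<open>p\<close> and \<open>r\<close> may lie in (1,2), where the gradient
  of J is continuous but not Lipschitz and a gradient flow need not be unique; hence a discrete
  descent, whose step is cut off where the gradient is small. An orbit has to satisfy two demands at
  once: it must approach some critical point within a number of steps that is uniform on the sphere,
  and it must never link \<open>u\<close> with \<open>-u\<close>. The second rests on J(u) = J(-u),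
  on the cost in J of crossing an annulus around a critical point, and on the positive distance
  between the finitely many critical points. The cube covers only a closed hemisphere, and oddness
  enters through its boundary; this is why Fan's lemma is stated with antipodality on a nested
  family of faces and with equal labels along the grid lines that spherical coordinates collapse.
  The alternating signs of the labels drive the induction on the dimension; afterwards only their
  distinctness is used.\<close>

inductive alternating :: "bool \<Rightarrow> int set \<Rightarrow> bool" where
  alternating_empty: "alternating b {}"
| alternating_insert: "x \<noteq> 0 \<Longrightarrow> (0 < x) = b \<Longrightarrow> \<forall>y\<in>S. \<bar>x\<bar> < \<bar>y\<bar> \<Longrightarrow> alternating (\<not> b) S
    \<Longrightarrow> alternating b (insert x S)"

text \<open>The introduction rule can be inverted because the element of least absolute value is
  determined by the set.\<close>

lemma alternating_insert_iff:
  assumes min: "\<forall>y\<in>S. \<bar>x\<bar> < \<bar>y\<bar>" and "x \<noteq> 0"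
  shows "alternating b (insert x S) \<longleftrightarrow> (0 < x) = b \<and> alternating (\<not> b) S"
proof
  assume "alternating b (insert x S)"
  then show "(0 < x) = b \<and> alternating (\<not> b) S"
  proof cases
    case (alternating_insert x' S')
    have "x' = x"
      using alternating_insert min by (metis insert_iff less_asym')
    then have "S' = S"
      using alternating_insert(1,4) min by (metis insert_ident less_irrefl)
    with \<open>x' = x\<close> alternating_insert show ?thesis by simp
  qed auto
qed (use assms in \<open>auto intro: alternating.intros\<close>)

lemma alternating_uminus: "alternating b S \<Longrightarrow> alternating (\<not> b) (uminus ` S)"
  by (induction rule: alternating.induct) (auto intro!: alternating.intros)

lemma alternating_uminus_iff: "alternating b (uminus ` S) \<longleftrightarrow> alternating (\<not> b) S"
  using alternating_uminus[of b "uminus ` S"] alternating_uminus[of "\<not> b" S]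
  by (auto simp: image_image)

lemma not_alternating_both:
  assumes "alternating b S" "S \<noteq> {}" shows "\<not> alternating (\<not> b) S"
  using assms by (cases rule: alternating.cases) (auto simp: alternating_insert_iff)

text \<open>A door count on label sets. Split off the element \<open>x\<close> of least absolute
  value: deleting \<open>x\<close> leaves \<open>S'\<close>, deleting any other element keeps
  \<open>x\<close> in front, so \<open>nd b S\<close> is the indicator of
  \<open>alternating b S'\<close> plus, if \<open>x\<close> has sign \<open>b\<close>, the count
  \<open>nd (\<not> b) S'\<close>. In an alternating set exactly one end can go: the last element if
  the set starts with sign \<open>b\<close>, the first one otherwise.\<close>

lemma card_alternating_deletions:
  assumes "finite S" "S \<noteq> {}" "0 \<notin> S" "inj_on abs S"
  defines "nd \<equiv> \<lambda>b S. card {x \<in> S. alternating b (S - {x})}"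
  shows "(alternating b S \<or> alternating (\<not> b) S \<longrightarrow> nd b S = 1) \<and>
    (\<not> (alternating b S \<or> alternating (\<not> b) S) \<longrightarrow> nd b S = 0 \<or> nd b S = 2)"
  using assms(1-4)
proof (induction "card S" arbitrary: S b)
  case 0
  then show ?case by simp
next
  case (Suc n)
  obtain x where x: "x \<in> S" "\<And>y. y \<in> S \<Longrightarrow> \<bar>x\<bar> \<le> \<bar>y\<bar>"
    using Suc.prems arg_min_if_finite(1)[of S abs] arg_min_least[of S _ abs] by blast
  define S' where "S' = S - {x}"
  have S: "S = insert x S'" "x \<notin> S'" "finite S'" "card S' = n" "0 \<notin> S'" "inj_on abs S'"
    using x Suc by (auto simp: S'_def inj_on_diff)
  have min: "\<forall>y\<in>S'. \<bar>x\<bar> < \<bar>y\<bar>"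
    using x Suc.prems(4) S by (metis inj_on_contraD insertCI order_le_imp_less_or_eq)
  have "x \<noteq> 0" using x Suc by auto
  have alt: "alternating c (insert x T) \<longleftrightarrow> (0 < x) = c \<and> alternating (\<not> c) T" if "T \<subseteq> S'" for c T
    using min that \<open>x \<noteq> 0\<close> by (intro alternating_insert_iff) auto
  have "{y \<in> S. alternating b (S - {y})} =
      (if alternating b S' then {x} else {}) \<union>
      (if (0 < x) = b then {y \<in> S'. alternating (\<not> b) (S' - {y})} else {})"
    (is "_ = ?A \<union> ?B")
  proof -
    have "S - {y} = insert x (S' - {y})" if "y \<in> S'" for y
      using S that by auto
    moreover have "S - {x} = S'"
      using S by auto
    ultimately show ?thesis
      using S(1,2) by (auto simp: alt split: if_splits)
  qed
  moreover have "card (?A \<union> ?B) = card ?A + card ?B"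
    using S by (intro card_Un_disjoint) auto
  ultimately have nd: "nd b S = (if alternating b S' then 1 else 0) +
      (if (0 < x) = b then nd (\<not> b) S' else 0)"
    by (simp add: nd_def)
  show ?case
  \<comment> \<open>A singleton is treated apart: the empty set alternates for both signs, while the
    other case relies on the two signs excluding each other on \<open>S'\<close>.\<close>
  proof (cases "S' = {}")
    case True
    then show ?thesis using nd by (auto simp: S(1) alt nd_def intro: alternating.intros)
  next
    case False
    note IH = Suc.hyps(1)[OF S(4)[symmetric] S(3) False S(5,6), of "\<not> b"]
    have *: "alternating b S' \<Longrightarrow> \<not> alternating (\<not> b) S'"
      using not_alternating_both False by blast
    have altS: "alternating c S \<longleftrightarrow> (0 < x) = c \<and> alternating (\<not> c) S'" for c
      using alt[of S' c] S(1) by simp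
    show ?thesis
      unfolding nd altS using IH *
      by (cases "(0 < x) = b"; cases "alternating b S'"; cases "alternating (\<not> b) S'") simp_all
  qed
qed

text \<open>Passing to a facet deletes one label or one of two vertices that carry the same label.\<close>

lemma card_alternating_facets:
  fixes L :: "'a \<Rightarrow> int" and b :: bool
  assumes "finite s" "s \<noteq> {}" and nz: "\<And>x. x \<in> s \<Longrightarrow> L x \<noteq> 0"
    and nc: "\<And>x y. x \<in> s \<Longrightarrow> y \<in> s \<Longrightarrow> L x \<noteq> - L y"
  defines "nf \<equiv> card {a \<in> s. inj_on L (s - {a}) \<and> alternating b (L ` (s - {a}))}"
  shows "(inj_on L s \<and> (alternating b (L ` s) \<or> alternating (\<not> b) (L ` s)) \<longrightarrow> nf = 1) \<and>
    (\<not> (inj_on L s \<and> (alternating b (L ` s) \<or> alternating (\<not> b) (L ` s))) \<longrightarrow> nf = 0 \<or> nf = 2)"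
proof (cases "inj_on L s")
  case True
  have im: "L ` (s - {a}) = L ` s - {L a}" if "a \<in> s" for a
    using True that by (auto simp: inj_on_def)
  have "L ` {a \<in> s. inj_on L (s - {a}) \<and> alternating b (L ` (s - {a}))} =
      {x \<in> L ` s. alternating b (L ` s - {x})}"
    using im True by (auto simp: inj_on_diff)
  moreover have "inj_on L {a \<in> s. inj_on L (s - {a}) \<and> alternating b (L ` (s - {a}))}"
    using True by (rule inj_on_subset) auto
  ultimately have nf: "nf = card {x \<in> L ` s. alternating b (L ` s - {x})}"
    unfolding nf_def using card_image by fastforce
  have "inj_on abs (L ` s)"
    using nc by (auto simp: inj_on_def abs_eq_iff)
  then show ?thesis
    using card_alternating_deletions[of "L ` s" b] assms(1,2) nz True
    unfolding nf by fastforce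
next
  case False
  then obtain x y where xy: "x \<in> s" "y \<in> s" "x \<noteq> y" "L x = L y"
    by (auto simp: inj_on_def)
  \<comment> \<open>An injectively labelled facet must omit \<open>x\<close> or \<open>y\<close>.
    Both omissions leave the same label set and are injective simultaneously, so the count is 0 or
    2.\<close>
  have "{a \<in> s. inj_on L (s - {a}) \<and> alternating b (L ` (s - {a}))} \<subseteq> {x, y}"
    using xy by (auto simp: inj_on_def)
  moreover have "L ` (s - {x}) = L ` (s - {y})"
  proof -
    have "L ` (s - {c}) = L ` s" if "c \<in> s" "d \<in> s" "c \<noteq> d" "L c = L d" for c d
    proof (intro equalityI subsetI)
      fix l assume "l \<in> L ` s"
      then obtain e where "e \<in> s" "l = L e" by blast
      then show "l \<in> L ` (s - {c})"
        using that by (cases "e = c") auto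
    qed auto
    then show ?thesis using xy by metis
  qed
  moreover have "inj_on L (s - {x}) \<longleftrightarrow> inj_on L (s - {y})"
  proof -
    have *: "inj_on L (s - {v})" if u: "inj_on L (s - {u})" "u \<in> s" "v \<in> s" "u \<noteq> v" "L u = L v" for u v
    proof (rule inj_onI)
      fix c d assume cd: "c \<in> s - {v}" "d \<in> s - {v}" "L c = L d"
      have eq_v: "e = u" if "e \<in> s - {v}" "L e = L v" for e
        using inj_onD[OF u(1), of e v] that u(3,4) by blast
      show "c = d"
      proof (cases "c = u \<or> d = u")
        case True
        then show ?thesis using eq_v[of c] eq_v[of d] cd u(5) by metis
      next
        case False
        then show ?thesis using inj_onD[OF u(1) cd(3)] cd(1,2) by blast
      qed
    qed
    show ?thesis using *[of x y] *[of y x] xy by auto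
  qed
  ultimately have "{a \<in> s. inj_on L (s - {a}) \<and> alternating b (L ` (s - {a}))} \<in> {{}, {x, y}}"
    using xy by auto
  then have "nf \<in> card ` {{}, {x, y}}"
    unfolding nf_def by (rule imageI)
  then have "nf = 0 \<or> nf = 2"
    using xy(3) by auto
  then show ?thesis using False by blast
qed

section \<open>Reflection and side facets of Kuhn simplices\<close>

definition grid_reflect :: "nat \<Rightarrow> nat \<Rightarrow> (nat \<Rightarrow> nat) \<Rightarrow> nat \<Rightarrow> nat" where
  "grid_reflect p n x = (\<lambda>j. if j < n then p - x j else p)"

lemma ksimplex_coords:
  assumes "ksimplex p n s" "x \<in> s"
  shows "x j \<le> p" "n \<le> j \<Longrightarrow> x j = p"
proof -
  obtain b u where "kuhn_simplex p n b u s"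
    using assms by (auto elim: ksimplex.cases)
  then interpret kuhn_simplex p n b u s .
  show "x j \<le> p" "n \<le> j \<Longrightarrow> x j = p"
    using assms s_le_p out_eq_p by auto
qed

lemma ksimplex_adjacent:
  assumes "ksimplex p n s" "x \<in> s" "y \<in> s"
  shows "x j \<le> Suc (y j)"
proof -
  obtain b u where "kuhn_simplex p n b u s"
    using assms by (auto elim: ksimplex.cases)
  then interpret kuhn_simplex p n b u s .
  show ?thesis
    using le_Suc_base[OF assms(2), of j] base_le[OF assms(3), of j] by simp
qed

lemma grid_reflect_reflect:
  assumes "ksimplex p n s" "x \<in> s"
  shows "grid_reflect p n (grid_reflect p n x) = x"
  using ksimplex_coords[OF assms] by (auto simp: grid_reflect_def)

lemma inj_on_grid_reflect: "ksimplex p n s \<Longrightarrow> inj_on (grid_reflect p n) s"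
  by (metis grid_reflect_reflect inj_onI)

text \<open>Reflection reverses the order in each coordinate and hence the monotone chain of
  vertices. The image of the last vertex, which is the base raised by 1 in every coordinate, becomes
  the new base \<open>base'\<close>, and the coordinates are raised in the opposite order
  \<open>upd'\<close>.\<close>

lemma ksimplex_reflect:
  assumes "ksimplex p n s"
  shows "ksimplex p n (grid_reflect p n ` s)"
proof -
  obtain base upd where "kuhn_simplex p n base upd s"
    using assms by (auto elim: ksimplex.cases)
  then interpret kuhn_simplex p n base upd s .
  define base' where "base' = (\<lambda>j. if j < n then p - Suc (base j) else p)"
  define upd' where "upd' = upd \<circ> (\<lambda>i. n - Suc i)"
  have bij: "bij_betw (\<lambda>i. n - Suc i) {..<n} {..<n}"
    by (rule bij_betw_byWitness[where f' = "\<lambda>i. n - Suc i"]) auto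
  have upd': "bij_betw upd' {..<n} {..<n}"
    unfolding upd'_def using bij upd by (rule bij_betw_trans)
  have lt: "base j < p" if "j < n" for j
    using base that by auto
  have step: "grid_reflect p n (enum (n - i)) =
      (\<lambda>j. if j \<in> upd' ` {..<i} then Suc (base' j) else base' j)" if "i \<le> n" for i
  proof
    fix j
    have sub: "(\<lambda>k. n - Suc k) ` {..<i} = {n - i..<n}"
    proof (safe)
      fix k assume k: "k \<in> {n - i..<n}"
      then have "k = n - Suc (n - Suc k)" "n - Suc k < i" using that by auto
      then show "k \<in> (\<lambda>k. n - Suc k) ` {..<i}" by blast
    qed (use that in auto)
    have "upd ` {n - i..<n} = {..<n} - upd ` {..<n - i}"
    proof -
      have "upd ` ({..<n} - {..<n - i}) = upd ` {..<n} - upd ` {..<n - i}"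
        using inj_upd by (intro inj_on_image_set_diff) auto
      moreover have "{..<n} - {..<n - i} = {n - i..<n}" by auto
      ultimately show ?thesis using upd_surj by simp
    qed
    then have im: "upd' ` {..<i} = {..<n} - upd ` {..<n - i}"
      unfolding upd'_def image_comp[symmetric] sub .
    show "grid_reflect p n (enum (n - i)) j =
      (if j \<in> upd' ` {..<i} then Suc (base' j) else base' j)"
      unfolding im using lt[of j] by (auto simp: grid_reflect_def enum_def base'_def)
  qed
  have "grid_reflect p n ` s =
      (\<lambda>i j. if j \<in> upd' ` {..<i} then Suc (base' j) else base' j) ` {..n}"
  proof -
    have "(\<lambda>i. n - i) ` {..n} = {..n}"
      by (force simp: image_iff intro: diff_diff_cancel[symmetric])
    then have "grid_reflect p n ` s = grid_reflect p n ` enum ` (\<lambda>i. n - i) ` {..n}"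
      using s_eq by simp
    also have "\<dots> = (\<lambda>i. grid_reflect p n (enum (n - i))) ` {..n}"
      by (simp only: image_image)
    also have "\<dots> = (\<lambda>i j. if j \<in> upd' ` {..<i} then Suc (base' j) else base' j) ` {..n}"
      by (intro image_cong refl step) auto
    finally show ?thesis .
  qed
  then have "kuhn_simplex p n base' upd' (grid_reflect p n ` s)"
  proof unfold_locales
    show "base' \<in> {..<n} \<rightarrow> {..<p}"
    proof
      fix j assume "j \<in> {..<n}"
      with lt[of j] show "base' j \<in> {..<p}" by (simp add: base'_def)
    qed
  qed (use upd' in \<open>auto simp: base'_def\<close>)
  then show ?thesis by (rule ksimplex.intros)
qed

text \<open>In Ky Fan's induction such an edge joins two vertices with the same label, so that only the
  facets in the last coordinate direction contribute to the boundary count.\<close>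

lemma ksimplex_side_facet_edge:
  assumes s: "ksimplex p (Suc n) s" "a \<in> s" and j: "j < n" "\<forall>x\<in>s - {a}. x j = v"
  obtains x y where "x \<in> s - {a}" "y \<in> s - {a}" "x \<noteq> y" "\<forall>i. i \<noteq> n \<longrightarrow> x i = y i"
proof -
  obtain base upd where "kuhn_simplex p (Suc n) base upd s"
    using s by (auto elim: ksimplex.cases)
  then interpret kuhn_simplex p "Suc n" base upd s .
  obtain i where i: "i < Suc n" "upd i = n"
    using upd_surj by (metis imageE lessI lessThan_iff)
  obtain m where m: "m < Suc n" "upd m = j"
    using upd_surj j by (metis imageE less_SucI lessThan_iff)
  have "m \<noteq> i" using i m j by auto
  have val: "enum l j = (if m < l then Suc (base j) else base j)" if "l \<le> Suc n" for l
    using that m upd_inj unfolding enum_def by fastforce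
  have Sn: "enum (Suc i) = (enum i)(n := Suc (enum i n))"
    using enum_Suc[OF i(1)] i by simp
  \<comment> \<open>Coordinate \<open>j\<close> changes only between vertices \<open>m\<close> and
    \<open>Suc m\<close> of the chain. It is constant on the facet, so the omitted vertex is an end
    of this edge.\<close>
  have a: "a = enum m \<or> a = enum (Suc m)"
  proof (rule ccontr)
    assume "\<not> ?thesis"
    then have "enum m j = v" "enum (Suc m) j = v"
      using j(2) m enum_in by auto
    then show False using val m by simp
  qed
  have vv: "enum l j = v" if "l \<le> Suc n" "enum l \<noteq> a" for l
    using that j(2) enum_in by auto
  \<comment> \<open>The edge in direction \<open>n\<close> survives: if \<open>a\<close> were one of
    its ends, it would be a common end with the edge in direction \<open>j\<close>, and the facet
    would keep vertices on both sides of the jump of coordinate \<open>j\<close>.\<close>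
  have ne: "enum i \<noteq> a"
  proof
    assume e: "enum i = a"
    then have "i = Suc m" using a i m \<open>m \<noteq> i\<close> enum_inj by auto
    moreover have "enum m \<noteq> a" "enum (Suc i) \<noteq> a"
      using e i m \<open>i = Suc m\<close> by (auto simp flip: e simp: enum_inj)
    ultimately show False
      using vv[of m] vv[of "Suc i"] val[of m] val[of "Suc i"] i m by simp
  qed
  have ne': "enum (Suc i) \<noteq> a"
  proof
    assume e: "enum (Suc i) = a"
    then have "m = Suc i" using a i m \<open>m \<noteq> i\<close> enum_inj by auto
    moreover have "enum i \<noteq> a" "enum (Suc m) \<noteq> a"
      using e i m \<open>m = Suc i\<close> by (auto simp flip: e simp: enum_inj)
    ultimately show False
      using vv[of i] vv[of "Suc m"] val[of i] val[of "Suc m"] i m by simp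
  qed
  show ?thesis
  proof (rule that[of "enum i" "enum (Suc i)"])
    show "enum i \<noteq> enum (Suc i)" using i enum_inj by simp
    show "enum i \<in> s - {a}" "enum (Suc i) \<in> s - {a}"
      using ne ne' i enum_in[of i] enum_in[of "Suc i"] by simp_all
    show "\<forall>l. l \<noteq> n \<longrightarrow> enum i l = enum (Suc i) l"
      unfolding Sn by simp
  qed
qed

definition alternating_simplex :: "((nat \<Rightarrow> nat) \<Rightarrow> int) \<Rightarrow> bool \<Rightarrow> (nat \<Rightarrow> nat) set \<Rightarrow> bool" where
  "alternating_simplex L b s \<longleftrightarrow> inj_on L s \<and> alternating b (L ` s)"

text \<open>The value \<open>p\<close> from coordinate \<open>n\<close> on is the convention of
  \<open>ksimplex\<close>; with it \<open>grid p n\<close> is the top face of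
  \<open>grid p (Suc n)\<close>, to which the induction on the dimension descends.\<close>

definition grid :: "nat \<Rightarrow> nat \<Rightarrow> (nat \<Rightarrow> nat) set" where
  "grid p n = {x. (\<forall>j. x j \<le> p) \<and> (\<forall>j\<ge>n. x j = p)}"

lemma ksimplex_subset_grid: "ksimplex p m s \<Longrightarrow> m \<le> n \<Longrightarrow> s \<subseteq> grid p n"
  using ksimplex_coords(1)[of p m s] ksimplex_coords(2)[of p m s] by (force simp: grid_def)

text \<open>Doors are facets with alternating labels of which the one least in absolute value is
  positive. An alternating simplex has one door, any other none or two; interior doors belong to two
  simplices, so only the parity of the boundary doors matters. \<open>side\<close> excludes doors on
  side faces. Those on \<open>x n = 0\<close> are carried by the antipodal map to simplices of the
  face \<open>x n = p\<close> with the opposite leading sign, so that together the boundary doors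
  count all alternating simplices of the top face.\<close>

theorem ky_fan_grid:
  fixes L :: "(nat \<Rightarrow> nat) \<Rightarrow> int"
  assumes "p > 0"
    and nz: "\<And>x. x \<in> grid p n \<Longrightarrow> L x \<noteq> 0"
    and nc: "\<And>x y. x \<in> grid p n \<Longrightarrow> y \<in> grid p n \<Longrightarrow> (\<forall>j. x j \<le> Suc (y j)) \<Longrightarrow>
      (\<forall>j. y j \<le> Suc (x j)) \<Longrightarrow> L x \<noteq> - L y"
    and side: "\<And>x y i j. x \<in> grid p n \<Longrightarrow> y \<in> grid p n \<Longrightarrow> i < j \<Longrightarrow> x i = 0 \<or> x i = p \<Longrightarrow>
      \<forall>l. l \<noteq> j \<longrightarrow> x l = y l \<Longrightarrow> L x = L y"
    and antipodal: "\<And>m x. m < n \<Longrightarrow> x \<in> grid p (Suc m) \<Longrightarrow> x m = 0 \<Longrightarrow>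
      L (grid_reflect p (Suc m) x) = - L x"
  shows "odd (card {s. ksimplex p n s \<and> (alternating_simplex L True s \<or> alternating_simplex L False s)})"
  using nz nc side antipodal
proof (induction n)
  case 0
  have "alternating_simplex L True {\<lambda>_. p} \<or> alternating_simplex L False {\<lambda>_. p}"
    using 0(1)[of "\<lambda>_. p"] by (auto simp: grid_def alternating_simplex_def alternating_insert_iff intro: alternating.intros)
  then have "{s. ksimplex p 0 s \<and> (alternating_simplex L True s \<or> alternating_simplex L False s)} = {{\<lambda>_. p}}"
    by (auto simp: ksimplex_0)
  then show ?case by simp
next
  case (Suc n)
  let ?S = "{s. ksimplex p (Suc n) s}"
  let ?F = "{f. \<exists>s\<in>?S. \<exists>a\<in>s. f = s - {a}}"
  let ?face = "\<lambda>f s. \<exists>a\<in>s. f = s - {a}"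
  let ?bnd = "\<lambda>f. (\<exists>j\<le>n. \<forall>x\<in>f. x j = 0) \<or> (\<exists>j\<le>n. \<forall>x\<in>f. x j = p)"
  have fin: "finite s" and ne: "s \<noteq> {}" and card_s: "card s = Suc (Suc n)" if "s \<in> ?S" for s
    using that ksimplex_card[of p "Suc n" s] by (auto intro: card_ge_0_finite)
  have fne: "f \<noteq> {}" if "f \<in> ?F" for f
    using that card_s fin by (auto simp: card_Diff_singleton dest!: arg_cong[where f = card])
  let ?T = "{f. ksimplex p n f \<and> alternating_simplex L True f}"
  let ?B = "{f \<in> ?F. (\<forall>x\<in>f. x n = 0) \<and> alternating_simplex L True f}"
  let ?R = "{f. ksimplex p n f \<and> alternating_simplex L False f}"
  have top: "f \<in> ?F \<and> (\<forall>x\<in>f. x n = p) \<longleftrightarrow> ksimplex p n f" for f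
    using simplex_top_face[OF \<open>p > 0\<close>, of f n] ksimplex_coords(2)[of p n f _ n] by blast
  have bnd: "{f \<in> ?F. alternating_simplex L True f \<and> ?bnd f} = ?T \<union> ?B"
  proof (intro equalityI subsetI)
    fix f assume "f \<in> {f \<in> ?F. alternating_simplex L True f \<and> ?bnd f}"
    then have f: "f \<in> ?F" "alternating_simplex L True f" "?bnd f" by auto
    then obtain s a where s: "ksimplex p (Suc n) s" "a \<in> s" "f = s - {a}" by auto
    obtain j v where j: "j \<le> n" "\<forall>x\<in>f. x j = v" "v = 0 \<or> v = p"
      using f(3) by auto
    \<comment> \<open>On a face with \<open>j < n\<close> the facet contains an edge in direction
      \<open>n\<close>, whose ends get equal labels by the hypothesis on side faces; this
      contradicts injectivity.\<close>
    have "j = n"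
    proof (rule ccontr)
      assume "j \<noteq> n"
      with j have "j < n" by simp
      then obtain x y where xy: "x \<in> f" "y \<in> f" "x \<noteq> y" "\<forall>i. i \<noteq> n \<longrightarrow> x i = y i"
        using ksimplex_side_facet_edge[OF s(1,2)] j(2) s(3) by blast
      have "x \<in> grid p (Suc n)" "y \<in> grid p (Suc n)"
        using xy(1,2) s ksimplex_subset_grid[OF s(1) order_refl] by auto
      then have "L x = L y"
        using Suc.prems(3)[OF _ _ \<open>j < n\<close> _ xy(4)] j xy(1) by blast
      then show False
        using xy f(2) by (auto simp: alternating_simplex_def dest: inj_onD)
    qed
    then show "f \<in> ?T \<union> ?B"
      using top[of f] f j by blast
  next
    fix f assume f: "f \<in> ?T \<union> ?B"
    have "f \<in> ?F \<and> ((\<forall>x\<in>f. x n = 0) \<or> (\<forall>x\<in>f. x n = p))"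
    proof (cases "f \<in> ?T")
      case True
      then have "ksimplex p n f" by simp
      with top[of f] show ?thesis by simp
    qed (use f in auto)
    moreover have "alternating_simplex L True f" using f by auto
    ultimately show "f \<in> {f \<in> ?F. alternating_simplex L True f \<and> ?bnd f}"
      by (intro CollectI conjI) auto
  qed
  have reflB: "grid_reflect p (Suc n) ` f \<in> ?R" if f: "f \<in> ?B" for f
  proof -
    obtain s a where s: "ksimplex p (Suc n) s" "a \<in> s" "f = s - {a}"
      using f by auto
    have fz: "\<forall>x\<in>f. x n = 0" using f by simp
    note co = ksimplex_coords[OF s(1)]
    have "grid_reflect p (Suc n) ` f = grid_reflect p (Suc n) ` s - {grid_reflect p (Suc n) a}"
      unfolding s(3) using inj_on_image_set_diff[OF inj_on_grid_reflect[OF s(1)], of s "{a}"] s(2) by auto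
    moreover have "\<forall>x\<in>grid_reflect p (Suc n) ` f. x n = p"
      using fz by (auto simp: grid_reflect_def)
    ultimately have "ksimplex p n (grid_reflect p (Suc n) ` f)"
      using top[of "grid_reflect p (Suc n) ` f"] ksimplex_reflect[OF s(1)] s(2) by blast
    moreover have L: "L (grid_reflect p (Suc n) x) = - L x" if "x \<in> f" for x
    proof (rule Suc.prems(4))
      show "x n = 0" using fz that by simp
      show "x \<in> grid p (Suc n)" using that s(3) ksimplex_subset_grid[OF s(1) order_refl] by auto
    qed simp
    then have "L ` grid_reflect p (Suc n) ` f = uminus ` L ` f"
      unfolding image_image by (rule image_cong[OF refl])
    moreover have "inj_on L (grid_reflect p (Suc n) ` f)"
      using f L by (auto simp: alternating_simplex_def inj_on_def)
    ultimately show ?thesis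
      using f by (auto simp: alternating_simplex_def alternating_uminus_iff)
  qed
  have reflR: "grid_reflect p (Suc n) ` f \<in> ?B" "grid_reflect p (Suc n) ` grid_reflect p (Suc n) ` f = f"
    if f: "f \<in> ?R" for f
  proof -
    have *: "f \<in> ?F" "\<forall>x\<in>f. x n = p" using f top[of f] by auto
    then obtain s a where s: "ksimplex p (Suc n) s" "a \<in> s" "f = s - {a}"
      by auto
    note co = ksimplex_coords[OF s(1)]
    have "grid_reflect p (Suc n) ` f = grid_reflect p (Suc n) ` s - {grid_reflect p (Suc n) a}"
      unfolding s(3) using inj_on_image_set_diff[OF inj_on_grid_reflect[OF s(1)], of s "{a}"] s(2) by auto
    then have F: "grid_reflect p (Suc n) ` f \<in> ?F"
      using ksimplex_reflect[OF s(1)] s(2) by blast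
    have zero: "\<forall>x\<in>grid_reflect p (Suc n) ` f. x n = 0"
      using *(2) by (auto simp: grid_reflect_def)
    have rr: "grid_reflect p (Suc n) (grid_reflect p (Suc n) x) = x" if "x \<in> f" for x
      using grid_reflect_reflect[OF s(1)] that s(3) by blast
    have L: "L (grid_reflect p (Suc n) x) = - L x" if "x \<in> f" for x
    proof -
      have "L (grid_reflect p (Suc n) (grid_reflect p (Suc n) x)) = - L (grid_reflect p (Suc n) x)"
        using that zero by (intro Suc.prems(4)) (auto simp: grid_reflect_def grid_def)
      then show ?thesis using rr[OF that] by simp
    qed
    then have "L ` grid_reflect p (Suc n) ` f = uminus ` L ` f"
      unfolding image_image by (rule image_cong[OF refl])
    moreover have "inj_on L (grid_reflect p (Suc n) ` f)"
      using f L by (auto simp: alternating_simplex_def inj_on_def)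
    ultimately show "grid_reflect p (Suc n) ` f \<in> ?B"
      using f F zero by (simp add: alternating_simplex_def alternating_uminus_iff)
    show "grid_reflect p (Suc n) ` grid_reflect p (Suc n) ` f = f"
      unfolding image_image using rr by simp
  qed
  have BB: "grid_reflect p (Suc n) ` grid_reflect p (Suc n) ` f = f" if f: "f \<in> ?B" for f
  proof -
    obtain s a where s: "ksimplex p (Suc n) s" "f = s - {a}"
      using f by blast
    show ?thesis
      unfolding image_image using grid_reflect_reflect[OF s(1)] s(2) by simp
  qed
  have "bij_betw (\<lambda>f. grid_reflect p (Suc n) ` f) ?B ?R"
  proof (rule bij_betw_byWitness[where f' = "\<lambda>f. grid_reflect p (Suc n) ` f"])
    show "\<forall>f\<in>?B. grid_reflect p (Suc n) ` grid_reflect p (Suc n) ` f = f"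
      using BB by (rule ballI)
    show "\<forall>f\<in>?R. grid_reflect p (Suc n) ` grid_reflect p (Suc n) ` f = f"
      using reflR(2) by (rule ballI)
    show "(\<lambda>f. grid_reflect p (Suc n) ` f) ` ?B \<subseteq> ?R"
      by (rule image_subsetI) (rule reflB)
    show "(\<lambda>f. grid_reflect p (Suc n) ` f) ` ?R \<subseteq> ?B"
      by (rule image_subsetI) (rule reflR(1))
  qed
  then have cardB: "card ?B = card ?R"
    by (rule bij_betw_same_card)
  have finF: "finite ?F"
    by (rule finite_subset[of _ "\<Union>s\<in>?S. Pow s"]) (use finite_ksimplexes fin in auto)
  have fin_ks: "finite {f. ksimplex p n f \<and> P f}" for P
    by (rule finite_subset[OF _ finite_ksimplexes[of p n]]) auto
  have IH: "odd (card {s. ksimplex p n s \<and> (alternating_simplex L True s \<or> alternating_simplex L False s)})"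
  proof (rule Suc.IH)
    have sub: "grid p n \<subseteq> grid p (Suc n)"
      by (auto simp: grid_def)
    fix x assume x: "x \<in> grid p n"
    with sub Suc.prems(1) show "L x \<noteq> 0" by blast
    fix y assume y: "y \<in> grid p n"
    show "L x \<noteq> - L y" if "\<forall>j. x j \<le> Suc (y j)" "\<forall>j. y j \<le> Suc (x j)"
      by (rule Suc.prems(2)) (use x y sub that in auto)
    show "L x = L y" if "i < j" "x i = 0 \<or> x i = p" "\<forall>l. l \<noteq> j \<longrightarrow> x l = y l" for i j
      by (rule Suc.prems(3)[OF _ _ that]) (use x y sub in auto)
  next
    fix m x assume "m < n" "x \<in> grid p (Suc m)" "x m = 0"
    then show "L (grid_reflect p (Suc m) x) = - L x" using Suc.prems(4)[of m x] by simp
  qed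
  \<comment> \<open>Reflected, the bottom doors become the negative alternating simplices
    \<open>?R\<close> of the top face; this turns the sum into the count of the induction
    hypothesis.\<close>
  have "card (?T \<union> ?B) = card ?T + card ?B"
  proof (rule card_Un_disjoint)
    show "?T \<inter> ?B = {}"
    proof (rule ccontr)
      assume "?T \<inter> ?B \<noteq> {}"
      then obtain f where f: "f \<in> ?T" "f \<in> ?B" by auto
      then obtain x where "x \<in> f" using fne[of f] by auto
      then have "x n = 0" using f(2) by blast
      moreover have "x n = p" using f(1) \<open>x \<in> f\<close> top[of f] by blast
      ultimately show False using \<open>p > 0\<close> by simp
    qed
  qed (use fin_ks finF in auto)
  also have "\<dots> = card (?T \<union> ?R)"
    unfolding cardB
  proof (rule card_Un_disjoint[symmetric])
    show "?T \<inter> ?R = {}"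
    proof (rule ccontr)
      assume "?T \<inter> ?R \<noteq> {}"
      then obtain f where f: "f \<in> ?T" "f \<in> ?R" by auto
      then have "f \<noteq> {}" using ksimplex_card[of p n f] by auto
      then show False
        using f not_alternating_both[of True "L ` f"] by (auto simp: alternating_simplex_def)
    qed
  qed (use fin_ks in auto)
  also have "?T \<union> ?R = {s. ksimplex p n s \<and> (alternating_simplex L True s \<or> alternating_simplex L False s)}"
    by auto
  finally have odd_bnd: "odd (card {f \<in> ?F. alternating_simplex L True f \<and> ?bnd f})"
    unfolding bnd using IH by simp
  have facets: "card {f \<in> ?F. ?face f s \<and> alternating_simplex L True f} =
      card {a \<in> s. inj_on L (s - {a}) \<and> alternating True (L ` (s - {a}))}" if s: "s \<in> ?S" for s
  proof -
    have "{f \<in> ?F. ?face f s \<and> alternating_simplex L True f} =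
        (\<lambda>a. s - {a}) ` {a \<in> s. inj_on L (s - {a}) \<and> alternating True (L ` (s - {a}))}"
      using s by (auto simp: alternating_simplex_def)
    moreover have "inj_on (\<lambda>a. s - {a}) {a \<in> s. inj_on L (s - {a}) \<and> alternating True (L ` (s - {a}))}"
    proof (rule inj_onI)
      fix a c assume "a \<in> {a \<in> s. inj_on L (s - {a}) \<and> alternating True (L ` (s - {a}))}"
        "c \<in> {a \<in> s. inj_on L (s - {a}) \<and> alternating True (L ` (s - {a}))}" "s - {a} = s - {c}"
      then have "a \<in> s" "c \<in> s" "a \<notin> s - {c}" by auto
      then show "a = c" by simp
    qed
    ultimately show ?thesis
      by (simp add: card_image)
  qed
  have count: "(inj_on L s \<and> (alternating True (L ` s) \<or> alternating (\<not> True) (L ` s)) \<longrightarrow>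
        card {f \<in> ?F. ?face f s \<and> alternating_simplex L True f} = 1) \<and>
      (\<not> (inj_on L s \<and> (alternating True (L ` s) \<or> alternating (\<not> True) (L ` s))) \<longrightarrow>
        card {f \<in> ?F. ?face f s \<and> alternating_simplex L True f} = 0 \<or>
        card {f \<in> ?F. ?face f s \<and> alternating_simplex L True f} = 2)" if s: "s \<in> ?S" for s
    unfolding facets[OF s]
  proof (rule card_alternating_facets)
    have sub: "s \<subseteq> grid p (Suc n)"
      using s by (intro ksimplex_subset_grid) auto
    show "L x \<noteq> 0" if "x \<in> s" for x
      using sub that Suc.prems(1) by blast
    show "L x \<noteq> - L y" if "x \<in> s" "y \<in> s" for x y
      using sub that s ksimplex_adjacent[of p "Suc n" s] by (intro Suc.prems(2)) auto
  qed (use fin[OF s] ne[OF s] in auto)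
  have "odd (card {s \<in> ?S. alternating_simplex L True s \<or> alternating_simplex L False s})"
  proof (rule kuhn_counting_lemma[where F = ?F and face = ?face and bnd = ?bnd
        and compo' = "alternating_simplex L True"])
    show "finite ?F" by (rule finF)
    show "finite ?S" by (rule finite_ksimplexes)
    fix f assume f: "f \<in> ?F"
    then obtain s a where s: "ksimplex p (Suc n) s" "a \<in> s" "f = s - {a}" by auto
    have eq: "{s \<in> ?S. ?face f s} = {s'. ksimplex p (Suc n) s' \<and> (\<exists>b\<in>s'. s' - {b} = s - {a})}"
      unfolding s(3) by (auto simp: eq_commute)
    show "card {s \<in> ?S. ?face f s} = 1" if "?bnd f"
      unfolding eq using that ksimplex_replace_0[OF s(1,2)] ksimplex_replace_1[OF s(1,2)]
      by (auto simp: s(3) less_Suc_eq_le)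
    show "card {s \<in> ?S. ?face f s} = 2" if "\<not> ?bnd f"
      unfolding eq using that by (intro ksimplex_replace_2[OF s(1,2)]) (auto simp: s(3) less_Suc_eq_le)
  next
    show "odd (card {f \<in> ?F. alternating_simplex L True f \<and> ?bnd f})" by (rule odd_bnd)
  next
    fix s assume "s \<in> ?S" "alternating_simplex L True s \<or> alternating_simplex L False s"
    then show "card {f \<in> ?F. ?face f s \<and> alternating_simplex L True f} = 1"
      using count[of s] by (auto simp: alternating_simplex_def)
  next
    fix s assume "s \<in> ?S" "\<not> (alternating_simplex L True s \<or> alternating_simplex L False s)"
    then show "card {f \<in> ?F. ?face f s \<and> alternating_simplex L True f} = 0 \<or>
        card {f \<in> ?F. ?face f s \<and> alternating_simplex L True f} = 2"
      using count[of s] by (auto simp: alternating_simplex_def)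
  qed
  then show ?case by simp
qed


corollary ky_fan_distinct_labels:
  fixes L :: "(nat \<Rightarrow> nat) \<Rightarrow> int"
  assumes "p > 0"
    and "\<And>x. x \<in> grid p n \<Longrightarrow> L x \<noteq> 0"
    and "\<And>x y. x \<in> grid p n \<Longrightarrow> y \<in> grid p n \<Longrightarrow> (\<forall>j. x j \<le> Suc (y j)) \<Longrightarrow>
      (\<forall>j. y j \<le> Suc (x j)) \<Longrightarrow> L x \<noteq> - L y"
    and "\<And>x y i j. x \<in> grid p n \<Longrightarrow> y \<in> grid p n \<Longrightarrow> i < j \<Longrightarrow> x i = 0 \<or> x i = p \<Longrightarrow>
      \<forall>l. l \<noteq> j \<longrightarrow> x l = y l \<Longrightarrow> L x = L y"
    and "\<And>m x. m < n \<Longrightarrow> x \<in> grid p (Suc m) \<Longrightarrow> x m = 0 \<Longrightarrow>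
      L (grid_reflect p (Suc m) x) = - L x"
  obtains s where "s \<subseteq> grid p n" "card (L ` s) = Suc n"
proof -
  have "odd (card {s. ksimplex p n s \<and> (alternating_simplex L True s \<or> alternating_simplex L False s)})"
    by (rule ky_fan_grid[OF assms])
  from odd_card_imp_not_empty[OF this] obtain s where s: "ksimplex p n s" "inj_on L s"
    by (auto simp: alternating_simplex_def)
  show thesis
  proof
    show "s \<subseteq> grid p n" using s by (intro ksimplex_subset_grid) auto
    show "card (L ` s) = Suc n" using s ksimplex_card by (simp add: card_image)
  qed
qed

section \<open>Critical points of even functionals\<close>

lemma compact_positive_lower_bound:
  fixes f :: "'a::topological_space \<Rightarrow> real"
  assumes "compact C" "continuous_on C f" "\<And>x. x \<in> C \<Longrightarrow> 0 < f x"
  obtains e where "e > 0" "\<And>x. x \<in> C \<Longrightarrow> e \<le> f x"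
proof (cases "C = {}")
  case True
  then show ?thesis using that[of 1] by simp
next
  case False
  then obtain x where "x \<in> C" "\<forall>y\<in>C. f x \<le> f y"
    using continuous_attains_inf assms by blast
  then show ?thesis using that[of "f x"] assms(3) by auto
qed

lemma compact_Collect_le:
  fixes f g :: "'a::t2_space \<Rightarrow> real"
  assumes "compact C" "continuous_on C f" "continuous_on C g"
  shows "compact {x \<in> C. f x \<le> g x}"
proof -
  have "closed {x \<in> C. f x \<le> g x}"
    using assms compact_imp_closed by (intro continuous_on_closed_Collect_le) auto
  then have "compact (C \<inter> {x \<in> C. f x \<le> g x})"
    using assms(1) by (rule compact_Int_closed[rotated])
  then show ?thesis by (simp add: Int_def cong: conj_cong)
qed

text \<open>With \<open>k\<close> a distance between two arguments this is uniform continuity.\<close>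

lemma compact_modulus:
  fixes f k :: "'a::t2_space \<Rightarrow> real"
  assumes "compact C" "continuous_on C f" "continuous_on C k"
    and nonneg: "\<And>x. x \<in> C \<Longrightarrow> 0 \<le> k x"
    and zero: "\<And>x. x \<in> C \<Longrightarrow> k x = 0 \<Longrightarrow> f x \<le> 0"
    and "e > 0"
  obtains d where "d > 0" "\<And>x. x \<in> C \<Longrightarrow> k x < d \<Longrightarrow> f x < e"
proof -
  have 1: "compact {x \<in> C. e \<le> f x}"
    using assms by (intro compact_Collect_le continuous_intros)
  have 2: "continuous_on {x \<in> C. e \<le> f x} k"
    using assms(3) by (rule continuous_on_subset) auto
  have 3: "0 < k x" if "x \<in> {x \<in> C. e \<le> f x}" for x
    using nonneg[of x] zero[of x] that \<open>e > 0\<close> by force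
  obtain d where "d > 0" and d: "\<And>x. x \<in> {x \<in> C. e \<le> f x} \<Longrightarrow> d \<le> k x"
    using compact_positive_lower_bound[OF 1 2 3] by auto
  show ?thesis
  proof (rule that)
    show "d > 0" by fact
    fix x assume "x \<in> C" "k x < d"
    then show "f x < e" using d[of x] by (cases "e \<le> f x") auto
  qed
qed

text \<open>Euclidean space whose dimension is a value and not a type: sequences vanishing from
  \<open>N\<close> on. The product topology of \<open>nat \<Rightarrow> real\<close> induces the
  Euclidean one on it.\<close>

definition coord_space :: "nat \<Rightarrow> (nat \<Rightarrow> real) set" where
  "coord_space N = {x. \<forall>i\<ge>N. x i = 0}"

definition enorm :: "nat \<Rightarrow> (nat \<Rightarrow> real) \<Rightarrow> real" where
  "enorm N x = L2_set x {..<N}"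

lemma enorm_nonneg [simp]: "0 \<le> enorm N x"
  by (simp add: enorm_def L2_set_nonneg)

lemma enorm_cong: "(\<And>i. i < N \<Longrightarrow> x i = y i) \<Longrightarrow> enorm N x = enorm N y"
  unfolding enorm_def by (rule L2_set_cong) auto

lemma continuous_on_coordinate:
  fixes f :: "'a::topological_space \<Rightarrow> nat \<Rightarrow> real"
  shows "continuous_on S f \<Longrightarrow> continuous_on S (\<lambda>x. f x i)"
  by (rule continuous_on_product_then_coordinatewise)

lemma continuous_on_enorm [continuous_intros]:
  fixes f :: "'a::topological_space \<Rightarrow> nat \<Rightarrow> real"
  assumes "\<And>i. i < N \<Longrightarrow> continuous_on S (\<lambda>x. f x i)"
  shows "continuous_on S (\<lambda>x. enorm N (f x))"
  unfolding enorm_def L2_set_def using assms by (intro continuous_intros) auto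

lemma enorm_zero_iff: "enorm N x = 0 \<longleftrightarrow> (\<forall>i<N. x i = 0)"
  by (auto simp: enorm_def L2_set_eq_0_iff)

lemma enorm_triangle: "enorm N (\<lambda>i. x i + y i) \<le> enorm N x + enorm N y"
  by (simp add: enorm_def L2_set_triangle_ineq)

lemma enorm_scale: "enorm N (\<lambda>i. c * x i) = \<bar>c\<bar> * enorm N x"
proof -
  have "(\<Sum>i<N. (c * x i)\<^sup>2) = c\<^sup>2 * (\<Sum>i<N. (x i)\<^sup>2)"
    by (simp add: power_mult_distrib sum_distrib_left)
  then show ?thesis by (simp add: enorm_def L2_set_def real_sqrt_mult)
qed

lemma abs_sum_mult_le_enorm: "\<bar>\<Sum>i<N. x i * y i\<bar> \<le> enorm N x * enorm N y"
proof -
  have "\<bar>\<Sum>i<N. x i * y i\<bar> \<le> (\<Sum>i<N. \<bar>x i\<bar> * \<bar>y i\<bar>)"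
    by (rule order_trans[OF sum_abs]) (simp add: abs_mult)
  also have "\<dots> \<le> enorm N x * enorm N y"
    unfolding enorm_def by (rule L2_set_mult_ineq)
  finally show ?thesis .
qed

lemma sum_square_eq_enorm: "(\<Sum>i<N. x i * x i) = enorm N x * enorm N x"
  by (simp add: enorm_def L2_set_def power2_eq_square[symmetric] sum_nonneg)

definition edist :: "nat \<Rightarrow> (nat \<Rightarrow> real) \<Rightarrow> (nat \<Rightarrow> real) \<Rightarrow> real" where
  "edist N x y = enorm N (\<lambda>i. x i - y i)"

lemma edist_nonneg [simp]: "0 \<le> edist N x y"
  by (simp add: edist_def)

lemma edist_refl [simp]: "edist N x x = 0"
  by (simp add: edist_def enorm_zero_iff)

lemma edist_zero_iff:
  "x \<in> coord_space N \<Longrightarrow> y \<in> coord_space N \<Longrightarrow> edist N x y = 0 \<longleftrightarrow> x = y"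
  unfolding edist_def enorm_zero_iff coord_space_def fun_eq_iff
  by (metis (mono_tags) eq_iff_diff_eq_0 linorder_not_less mem_Collect_eq)

lemma edist_sym: "edist N x y = edist N y x"
  by (simp add: edist_def enorm_def L2_set_def power2_commute)

lemma edist_triangle: "edist N x z \<le> edist N x y + edist N y z"
  using enorm_triangle[of N "\<lambda>i. x i - y i" "\<lambda>i. y i - z i"] by (simp add: edist_def)

lemma edist_uminus: "edist N (\<lambda>i. - x i) (\<lambda>i. - y i) = edist N x y"
  by (simp add: edist_def enorm_def L2_set_def power2_commute)

lemma continuous_on_edist [continuous_intros]:
  fixes f g :: "'a::topological_space \<Rightarrow> nat \<Rightarrow> real"
  assumes "continuous_on S f" "continuous_on S g"
  shows "continuous_on S (\<lambda>x. edist N (f x) (g x))"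
  unfolding edist_def
  using assms[THEN continuous_on_coordinate] by (intro continuous_on_enorm continuous_on_diff)

text \<open>Tychonoff's theorem. The bounds depend on the coordinate so that some coordinates can be
  frozen by \<open>a i = b i\<close>.\<close>

lemma compact_coord_box: "compact {x :: nat \<Rightarrow> real. \<forall>i. a i \<le> x i \<and> x i \<le> b i}"
proof -
  have "compactin euclidean {a i..b i}" for i
    by (simp add: compactin_euclidean_iff)
  then have "compactin (product_topology (\<lambda>i. euclidean) UNIV) (PiE UNIV (\<lambda>i. {a i..b i}))"
    unfolding compactin_PiE by simp
  moreover have "PiE UNIV (\<lambda>i. {a i..b i}) = {x. \<forall>i. a i \<le> x i \<and> x i \<le> b i}"
    by (auto simp: PiE_def Pi_def)
  ultimately show ?thesis
    by (simp add: euclidean_product_topology compactin_euclidean_iff)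
qed

lemma compact_coord_sublevel:
  assumes J: "continuous_on (coord_space N) J"
    and bnd: "\<And>x. x \<in> coord_space N \<Longrightarrow> J x \<le> c \<Longrightarrow> enorm N x \<le> R"
  shows "compact {x \<in> coord_space N. J x \<le> (c::real)}"
proof -
  let ?a = "\<lambda>i. if i < N then - \<bar>R\<bar> else 0" and ?b = "\<lambda>i. if i < N then \<bar>R\<bar> else 0"
  let ?B = "{x :: nat \<Rightarrow> real. \<forall>i. ?a i \<le> x i \<and> x i \<le> ?b i}"
  have sub: "?B \<subseteq> coord_space N"
  proof
    fix x assume "x \<in> ?B"
    then have "\<forall>i. ?a i \<le> x i \<and> x i \<le> ?b i" by (rule CollectD)
    then have "x i = 0" if "N \<le> i" for i
      using that by (metis leD order_antisym)
    then show "x \<in> coord_space N" by (simp add: coord_space_def)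
  qed
  have "compact {x \<in> ?B. J x \<le> c}"
    using J sub by (intro compact_Collect_le compact_coord_box continuous_intros) (rule continuous_on_subset)
  moreover have "{x \<in> ?B. J x \<le> c} = {x \<in> coord_space N. J x \<le> c}"
  proof (intro equalityI subsetI)
    fix x assume x: "x \<in> {x \<in> coord_space N. J x \<le> c}"
    have "\<bar>x i\<bar> \<le> \<bar>R\<bar>" if "i < N" for i
      using member_le_L2_set[of "{..<N}" i "\<lambda>i. \<bar>x i\<bar>"] bnd[of x] x that
      by (simp add: enorm_def L2_set_def)
    then have "\<And>i. i < N \<Longrightarrow> - \<bar>R\<bar> \<le> x i \<and> x i \<le> \<bar>R\<bar>" by (simp add: abs_le_iff minus_le_iff)
    then have "x \<in> ?B" using x by (simp add: coord_space_def)
    then show "x \<in> {x \<in> ?B. J x \<le> c}" using x by simp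
  qed (use sub in auto)
  ultimately show ?thesis by simp
qed

text \<open>An injective numbering \<open>e\<close> codes the pair of \<open>u\<close> and
  \<open>f u\<close> by the smaller of its two numbers; \<open>f\<close> exchanges the members and
  so changes the sign. The successor keeps 0 from being a label.\<close>

lemma odd_labelling:
  assumes "finite K" "\<And>u. u \<in> K \<Longrightarrow> f u \<in> K" "\<And>u. u \<in> K \<Longrightarrow> f (f u) = u"
    "\<And>u. u \<in> K \<Longrightarrow> f u \<noteq> u"
  obtains \<phi> :: "'a \<Rightarrow> int" where "inj_on \<phi> K" "\<And>u. u \<in> K \<Longrightarrow> \<phi> (f u) = - \<phi> u"
    "\<And>u. u \<in> K \<Longrightarrow> \<phi> u \<noteq> 0"
proof -
  obtain e :: "'a \<Rightarrow> nat" where e: "inj_on e K"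
    using finite_imp_inj_to_nat_seg[OF \<open>finite K\<close>] by (elim exE conjE)
  define \<phi> where "\<phi> u = (if e u < e (f u) then int (Suc (e u)) else - int (Suc (e (f u))))" for u
  have ne: "e u \<noteq> e (f u)" if "u \<in> K" for u
    using inj_onD[OF e _ that assms(2)[OF that]] assms(4)[OF that] by auto
  show thesis
  proof
    show "\<phi> (f u) = - \<phi> u" if "u \<in> K" for u
      using ne[OF that] assms(3)[OF that] by (auto simp: \<phi>_def)
    show "\<phi> u \<noteq> 0" for u by (simp add: \<phi>_def)
    show "inj_on \<phi> K"
    proof (rule inj_onI)
      fix u v assume uv: "u \<in> K" "v \<in> K" "\<phi> u = \<phi> v"
      then consider "e u = e v" | "e (f u) = e (f v)"
        by (auto simp: \<phi>_def split: if_splits)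
      then show "u = v"
      proof cases
        case 1
        then show ?thesis using inj_onD[OF e] uv by blast
      next
        case 2
        then have "f u = f v" using inj_onD[OF e] uv assms(2) by blast
        then show ?thesis using assms(3) uv by metis
      qed
    qed
  qed
qed

lemma continuous_on_axpy:
  fixes f h :: "'a::topological_space \<Rightarrow> nat \<Rightarrow> real"
  assumes "continuous_on S a" "continuous_on S f" "continuous_on S h"
  shows "continuous_on S (\<lambda>z. (\<lambda>i. f z i + a z * h z i))"
proof (rule continuous_on_coordinatewise_then_product)
  fix i
  show "continuous_on S (\<lambda>z. f z i + a z * h z i)"
    using continuous_on_coordinate[OF assms(2), of i] continuous_on_coordinate[OF assms(3), of i] assms(1)
    by (intro continuous_on_add continuous_on_mult)
qed

lemma enorm_0 [simp]: "enorm N (\<lambda>_. 0) = 0"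
  by (simp add: enorm_zero_iff)

text \<open>The level \<open>M\<close> separates the sphere from the origin: the sublevel set
  contains the sphere but not the fixed point of the antipodal map. Derivatives are required only
  along lines, which is all that the mean value theorem in a descent step uses.\<close>

locale even_functional =
  fixes N :: nat and J :: "(nat \<Rightarrow> real) \<Rightarrow> real" and g :: "(nat \<Rightarrow> real) \<Rightarrow> nat \<Rightarrow> real"
    and \<rho> M :: real
  assumes J_cont: "continuous_on (coord_space N) J"
    and g_cont: "\<And>i. i < N \<Longrightarrow> continuous_on (coord_space N) (\<lambda>x. g x i)"
    and J_deriv: "\<And>x w s. x \<in> coord_space N \<Longrightarrow> w \<in> coord_space N \<Longrightarrow>
      ((\<lambda>s. J (\<lambda>i. x i + s * w i)) has_real_derivative
        (\<Sum>i<N. g (\<lambda>i. x i + s * w i) i * w i)) (at s)"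
    and J_even: "\<And>x. J (\<lambda>i. - x i) = J x"
    and g_odd: "\<And>x i. g (\<lambda>i. - x i) i = - g x i"
    and sublevel_bounded: "\<exists>R. \<forall>x\<in>coord_space N. J x \<le> M \<longrightarrow> enorm N x \<le> R"
    and \<rho>: "\<rho> > 0"
    and sphere: "\<And>x. x \<in> coord_space N \<Longrightarrow> enorm N x = \<rho> \<Longrightarrow> J x \<le> M"
    and J_0: "M < J (\<lambda>_. 0)"
begin

definition X where "X = {x \<in> coord_space N. J x \<le> M}"

definition K where "K = {x \<in> coord_space N. x \<noteq> (\<lambda>_. 0) \<and> (\<forall>i<N. g x i = 0)}"

definition G where "G x = enorm N (g x)"

text \<open>The gradient shortened by \<eta> in length, and 0 where it is shorter than \<eta>: still
  continuous and odd, with no singularity at critical points.\<close>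

definition w where "w \<eta> x = (\<lambda>i. if i < N then (max \<eta> (G x) - \<eta>) / max \<eta> (G x) * g x i else 0)"

definition T where "T \<eta> \<tau> x = (\<lambda>i. x i + (- \<tau>) * w \<eta> x i)"

lemma X_subset: "X \<subseteq> coord_space N"
  by (auto simp: X_def)

lemma compact_X: "compact X"
  unfolding X_def using sublevel_bounded J_cont compact_coord_sublevel by blast

lemma X_nonzero: "x \<in> X \<Longrightarrow> x \<noteq> (\<lambda>_. 0)"
  using J_0 by (auto simp: X_def)

lemma coord_uminus: "x \<in> coord_space N \<Longrightarrow> (\<lambda>i. - x i) \<in> coord_space N"
  by (simp add: coord_space_def)

lemma K_uminus: "x \<in> K \<Longrightarrow> (\<lambda>i. - x i) \<in> K"
  by (auto simp: K_def coord_uminus g_odd fun_eq_iff)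

lemma G_nonneg [simp]: "0 \<le> G x"
  by (simp add: G_def)

lemma G_uminus: "G (\<lambda>i. - x i) = G x"
  using enorm_scale[of N "-1" "g x"] by (simp add: G_def g_odd cong: enorm_cong)

lemma G_cont: "continuous_on (coord_space N) G"
  unfolding G_def by (intro continuous_on_enorm g_cont)

lemma G_zero: "x \<in> X \<Longrightarrow> G x = 0 \<longleftrightarrow> x \<in> K"
  using X_nonzero X_subset by (auto simp: G_def enorm_zero_iff K_def)

lemma w_coord [simp]: "w \<eta> x \<in> coord_space N"
  by (simp add: w_def coord_space_def)

lemma T_coord: "x \<in> coord_space N \<Longrightarrow> T \<eta> \<tau> x \<in> coord_space N"
  by (simp add: w_def T_def coord_space_def)

lemma T_uminus: "T \<eta> \<tau> (\<lambda>i. - x i) = (\<lambda>i. - T \<eta> \<tau> x i)"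
  by (rule ext) (simp add: T_def w_def G_uminus g_odd)

lemma w_cont:
  assumes "\<eta> > 0" shows "continuous_on (coord_space N) (w \<eta>)"
proof (rule continuous_on_coordinatewise_then_product)
  fix i
  have "max \<eta> (G x) \<noteq> 0" for x
    using assms by (simp add: max_def)
  then show "continuous_on (coord_space N) (\<lambda>x. w \<eta> x i)"
    unfolding w_def using g_cont[of i] by (cases "i < N") (auto intro!: continuous_intros G_cont)
qed

lemma T_cont:
  assumes "\<eta> > 0" shows "continuous_on (coord_space N) (T \<eta> \<tau>)"
  unfolding T_def by (rule continuous_on_axpy[OF continuous_on_const continuous_on_id w_cont[OF assms]])

lemma enorm_w:
  assumes "\<eta> > 0"
  shows "enorm N (w \<eta> x) = max \<eta> (G x) - \<eta>"
proof -
  have "enorm N (w \<eta> x) = enorm N (\<lambda>i. (max \<eta> (G x) - \<eta>) / max \<eta> (G x) * g x i)"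
    by (rule enorm_cong) (simp add: w_def)
  also have "\<dots> = (max \<eta> (G x) - \<eta>) / max \<eta> (G x) * G x"
    using assms by (subst enorm_scale) (simp add: G_def)
  also have "\<dots> = max \<eta> (G x) - \<eta>"
    using assms by (cases "\<eta> \<le> G x") (auto simp: max_def field_simps)
  finally show ?thesis .
qed

text \<open>\<open>w\<close> is a nonnegative multiple of \<open>g\<close>, so the Cauchy-Schwarz
  inequality is an equality.\<close>

lemma g_dot_w:
  assumes "\<eta> > 0"
  shows "(\<Sum>i<N. g x i * w \<eta> x i) = G x * enorm N (w \<eta> x)"
proof -
  have "(\<Sum>i<N. g x i * w \<eta> x i) = (max \<eta> (G x) - \<eta>) / max \<eta> (G x) * (\<Sum>i<N. g x i * g x i)"
    by (simp add: w_def sum_distrib_left sum_divide_distrib mult_ac)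
  also have "\<dots> = (max \<eta> (G x) - \<eta>) / max \<eta> (G x) * G x * G x"
    by (simp add: sum_square_eq_enorm G_def)
  also have "(max \<eta> (G x) - \<eta>) / max \<eta> (G x) * G x = max \<eta> (G x) - \<eta>"
    using assms by (cases "\<eta> \<le> G x") (auto simp: max_def field_simps)
  finally show ?thesis
    by (simp add: enorm_w[OF assms])
qed

lemma edist_T: "\<tau> \<ge> 0 \<Longrightarrow> edist N (T \<eta> \<tau> x) x = \<tau> * enorm N (w \<eta> x)"
  using enorm_scale[of N "- \<tau>" "w \<eta> x"] by (simp add: edist_def T_def)

text \<open>Since \<open>w\<close> vanishes where \<open>G \<le> \<eta>\<close>, a merely continuous gradient suffices for a step size that
  is uniform on the sublevel set.\<close>

lemma descent_step:
  assumes "\<eta> > 0" "W > 0"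
  obtains \<tau> where "\<tau> > 0" "\<And>x. x \<in> X \<Longrightarrow> T \<eta> \<tau> x \<in> X"
    "\<And>x. x \<in> X \<Longrightarrow> G x * edist N (T \<eta> \<tau> x) x \<le> 2 * (J x - J (T \<eta> \<tau> x))"
    "\<And>x. x \<in> X \<Longrightarrow> edist N (T \<eta> \<tau> x) x < W"
proof -
  let ?C = "{0..1::real} \<times> X"
  have C: "compact ?C"
    using compact_X by (intro compact_Times) auto
  have line: "(\<lambda>z. (\<lambda>i. snd z i + (- fst z) * w \<eta> (snd z) i)) ` ?C \<subseteq> coord_space N"
    using X_subset w_coord by (force simp: coord_space_def)
  have cw: "continuous_on ?C (\<lambda>z. w \<eta> (snd z))"
    using X_subset by (intro continuous_on_compose2[OF w_cont[OF assms(1)]] continuous_intros) auto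
  have cline: "continuous_on ?C (\<lambda>z. (\<lambda>i. snd z i + (- fst z) * w \<eta> (snd z) i))"
    using continuous_on_axpy[OF continuous_on_minus[OF continuous_on_fst[OF continuous_on_id]]
        continuous_on_snd[OF continuous_on_id] cw] .
  have cg: "continuous_on ?C (\<lambda>z. enorm N (\<lambda>i. g (\<lambda>i. snd z i + (- fst z) * w \<eta> (snd z) i) i - g (snd z) i))"
  proof (intro continuous_on_enorm continuous_on_diff)
    fix i assume i: "i < N"
    show "continuous_on ?C (\<lambda>z. g (\<lambda>i. snd z i + (- fst z) * w \<eta> (snd z) i) i)"
      using continuous_on_compose2[OF g_cont[OF i] cline line] .
    show "continuous_on ?C (\<lambda>z. g (snd z) i)"
      using X_subset by (intro continuous_on_compose2[OF g_cont[OF i]] continuous_intros) auto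
  qed
  \<comment> \<open>The pair \<open>z\<close> consists of a step length and a base point, and the
    difference of gradients vanishes at step length 0. Compactness gives one length for all of
    \<open>X\<close> along which the gradient moves by less than \<open>\<eta> / 2\<close>.\<close>
  obtain d1 where d1: "d1 > 0" "\<And>z. z \<in> ?C \<Longrightarrow> fst z < d1 \<Longrightarrow>
      enorm N (\<lambda>i. g (\<lambda>i. snd z i + (- fst z) * w \<eta> (snd z) i) i - g (snd z) i) < \<eta> / 2"
    by (rule compact_modulus[OF C cg, of fst "\<eta> / 2"])
      (use assms in \<open>auto intro!: continuous_on_fst\<close>)
  have "continuous_on ?C (\<lambda>z. fst z * enorm N (w \<eta> (snd z)))"
    using continuous_on_coordinate[OF cw]
    by (intro continuous_on_mult continuous_on_fst[OF continuous_on_id] continuous_on_enorm)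
  then obtain d2 where
    d2: "d2 > 0" "\<And>z. z \<in> ?C \<Longrightarrow> fst z < d2 \<Longrightarrow> fst z * enorm N (w \<eta> (snd z)) < W"
    by (rule compact_modulus[OF C, of _ fst W]) (use assms in \<open>auto intro!: continuous_on_fst\<close>)
  define \<tau> where "\<tau> = min 1 (min d1 d2) / 2"
  have \<tau>: "\<tau> > 0" "\<tau> < d1" "\<tau> < d2" "\<tau> \<le> 1"
    using d1 d2 by (auto simp: \<tau>_def min_def)
  have desc: "G x * edist N (T \<eta> \<tau> x) x \<le> 2 * (J x - J (T \<eta> \<tau> x))" if x: "x \<in> X" for x
  proof (cases "\<eta> \<le> G x")
    case False
    then have "enorm N (w \<eta> x) = 0"
      by (simp add: enorm_w[OF assms(1)])
    then have "T \<eta> \<tau> x = x"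
      by (auto simp: enorm_zero_iff T_def w_def fun_eq_iff)
    then show ?thesis by simp
  next
    case True
    let ?y = "\<lambda>s i. x i + s * - w \<eta> x i"
    have "(\<lambda>i. - w \<eta> x i) \<in> coord_space N"
      by (rule coord_uminus) simp
    then have "((\<lambda>s. J (?y s)) has_real_derivative (\<Sum>i<N. g (?y s) i * - w \<eta> x i)) (at s)" for s
      using x X_subset by (intro J_deriv) auto
    then obtain s where s: "0 < s" "s < \<tau>"
      "J (?y \<tau>) - J (?y 0) = (\<tau> - 0) * (\<Sum>i<N. g (?y s) i * - w \<eta> x i)"
      using MVT2[of 0 \<tau> "\<lambda>s. J (?y s)" "\<lambda>s. \<Sum>i<N. g (?y s) i * - w \<eta> x i"] \<tau> by blast
    have y: "?y s = (\<lambda>i. x i + (- s) * w \<eta> x i)" "?y \<tau> = T \<eta> \<tau> x" "?y 0 = x"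
      by (auto simp: T_def)
    have close: "enorm N (\<lambda>i. g (?y s) i - g x i) < \<eta> / 2"
      unfolding y using d1(2)[of "(s, x)"] x s \<tau> by simp
    have "(\<Sum>i<N. g (?y s) i * w \<eta> x i) =
        (\<Sum>i<N. g x i * w \<eta> x i) + (\<Sum>i<N. (g (?y s) i - g x i) * w \<eta> x i)"
      by (simp add: sum.distrib[symmetric] algebra_simps)
    moreover have "(\<Sum>i<N. (g (?y s) i - g x i) * w \<eta> x i) \<ge> - (\<eta> / 2 * enorm N (w \<eta> x))"
    proof -
      have "\<bar>\<Sum>i<N. (g (?y s) i - g x i) * w \<eta> x i\<bar> \<le> enorm N (\<lambda>i. g (?y s) i - g x i) * enorm N (w \<eta> x)"
        by (rule abs_sum_mult_le_enorm)
      also have "\<dots> \<le> \<eta> / 2 * enorm N (w \<eta> x)"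
        using close by (intro mult_right_mono) auto
      finally show ?thesis by linarith
    qed
    \<comment> \<open>Where \<open>w\<close> may be nonzero, \<eta> is at most the gradient length,
      so the error is at most half of the main term; this is the origin of the factor 2 in the
      descent estimate.\<close>
    moreover have "\<eta> / 2 * enorm N (w \<eta> x) \<le> G x / 2 * enorm N (w \<eta> x)"
      using True by (intro mult_right_mono) auto
    ultimately have "(\<Sum>i<N. g (?y s) i * w \<eta> x i) \<ge> G x * enorm N (w \<eta> x) / 2"
      unfolding g_dot_w[OF assms(1)] by simp
    then have "\<tau> * (G x * enorm N (w \<eta> x) / 2) \<le> \<tau> * (\<Sum>i<N. g (?y s) i * w \<eta> x i)"
      using \<tau> by (intro mult_left_mono) auto
    also have "\<dots> = J x - J (T \<eta> \<tau> x)"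
      using s(3) unfolding y by (simp add: sum_negf)
    finally show ?thesis
      using \<tau> by (simp add: edist_T mult_ac)
  qed
  show thesis
  proof (rule that[OF \<tau>(1)])
    fix x assume x: "x \<in> X"
    show "G x * edist N (T \<eta> \<tau> x) x \<le> 2 * (J x - J (T \<eta> \<tau> x))"
      by (rule desc[OF x])
    then have "J (T \<eta> \<tau> x) \<le> J x"
      by (smt (verit) G_nonneg edist_nonneg mult_nonneg_nonneg)
    then show "T \<eta> \<tau> x \<in> X"
      using x T_coord by (auto simp: X_def)
    show "edist N (T \<eta> \<tau> x) x < W"
      using d2(2)[of "(\<tau>, x)"] x \<tau> by (simp add: edist_T)
  qed
qed

end

section \<open>Orbits of the descent and critical points\<close>

context even_functional
begin

text \<open>This replaces the Palais-Smale condition: the points of \<open>X\<close> at distance at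
  least \<open>r\<close> from \<open>K\<close> form a compact set without zeros of \<open>G\<close>,
  where \<open>G\<close> is bounded below.\<close>

lemma small_gradient_near_critical:
  assumes "r > 0"
  obtains d where "d > 0" "\<And>x. x \<in> X \<Longrightarrow> G x < d \<Longrightarrow> \<exists>u\<in>K. edist N x u < r"
proof -
  let ?C = "X \<inter> (\<Inter>u\<in>K. {x \<in> X. r \<le> edist N x u})"
  have "compact {x \<in> X. r \<le> edist N x u}" for u
    by (intro compact_Collect_le compact_X continuous_on_edist continuous_on_const continuous_on_id)
  then have "closed {x \<in> X. r \<le> edist N x u}" for u
    by (rule compact_imp_closed)
  then have C: "compact ?C"
    by (intro compact_Int_closed compact_X closed_INT) auto
  have cont: "continuous_on ?C G"
    using X_subset by (intro continuous_on_subset[OF G_cont]) auto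
  have pos: "0 < G x" if "x \<in> ?C" for x
  proof -
    have "G x \<noteq> 0"
    proof
      assume "G x = 0"
      then have "x \<in> K" using G_zero that by blast
      then have "r \<le> edist N x x" using that by blast
      with assms show False by simp
    qed
    then show ?thesis using G_nonneg[of x] by linarith
  qed
  obtain d where d: "d > 0" "\<And>x. x \<in> ?C \<Longrightarrow> d \<le> G x"
    using compact_positive_lower_bound[OF C cont pos] by blast
  show thesis
  proof (rule that[OF d(1)])
    fix x assume x: "x \<in> X" "G x < d"
    then have "x \<notin> ?C" using d(2)[of x] by auto
    then show "\<exists>u\<in>K. edist N x u < r" using x(1) by (auto simp: not_le)
  qed
qed

text \<open>The factor 5 leaves room for the radii in \<open>descent_map\<close>: no point lies
  within \<open>3 * R\<close> of one critical point and \<open>R / 2\<close> of another.\<close>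

lemma K_separated:
  assumes "finite K"
  obtains R where "R > 0" "\<And>u v. u \<in> K \<Longrightarrow> v \<in> K \<Longrightarrow> u \<noteq> v \<Longrightarrow> 5 * R < edist N u v"
proof -
  let ?D = "(\<lambda>(u, v). edist N u v) ` {(u, v) \<in> K \<times> K. u \<noteq> v}"
  have fin: "finite ?D"
    using assms by (intro finite_imageI finite_subset[of "{(u, v) \<in> K \<times> K. u \<noteq> v}" "K \<times> K"]) auto
  have pos: "0 < edist N u v" if "u \<in> K" "v \<in> K" "u \<noteq> v" for u v
  proof -
    have "edist N u v \<noteq> 0" using that edist_zero_iff[of u N v] by (simp add: K_def)
    then show ?thesis using edist_nonneg[of N u v] by linarith
  qed
  \<comment> \<open>The inserted 1 keeps the minimum meaningful when there are no two distinct
    critical points; dividing by 6 makes the bound \<open>5 * R\<close> strict.\<close>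
  define R where "R = Min (insert 1 ?D) / 6"
  have "0 < Min (insert 1 ?D)"
    using fin pos by (subst Min_gr_iff) auto
  then have "R > 0" by (simp add: R_def)
  moreover have "5 * R < edist N u v" if "u \<in> K" "v \<in> K" "u \<noteq> v" for u v
  proof -
    have "Min (insert 1 ?D) \<le> edist N u v"
      using fin that by (intro Min_le) force+
    then show ?thesis using \<open>R > 0\<close> by (simp add: R_def)
  qed
  ultimately show thesis by (rule that)
qed

text \<open>The potential \<open>\<Phi> u\<close> never increases along orbits, so passing from
  distance \<open>R\<close> to distance \<open>2 * R\<close> from \<open>u\<close> costs at least
  \<open>e * R / 2\<close> of J. A visit near \<open>u\<close> followed by one near
  \<open>-u\<close> would have to pay this, although J takes equal values at the two points and
  deviates from them by less than \<open>e * R / 4\<close> at each visit.\<close>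

lemma descent_map:
  assumes fin: "finite K"
  obtains S n \<delta> where "\<delta> > 0" "continuous_on X S" "S ` X \<subseteq> X" "\<And>x. S (\<lambda>i. - x i) = (\<lambda>i. - S x i)"
    "\<And>x. x \<in> X \<Longrightarrow> \<exists>k\<le>n. \<exists>u\<in>K. edist N ((S ^^ k) x) u < \<delta>"
    "\<And>x u k l. x \<in> X \<Longrightarrow> u \<in> K \<Longrightarrow> edist N ((S ^^ k) x) u < 2 * \<delta> \<Longrightarrow>
      2 * \<delta> \<le> edist N ((S ^^ l) x) (\<lambda>i. - u i)"
proof -
  obtain R where R: "R > 0" "\<And>u v. u \<in> K \<Longrightarrow> v \<in> K \<Longrightarrow> u \<noteq> v \<Longrightarrow> 5 * R < edist N u v"
    using K_separated[OF fin] by metis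
  obtain e where e: "e > 0" "\<And>x. x \<in> X \<Longrightarrow> G x < e \<Longrightarrow> \<exists>u\<in>K. edist N x u < R / 2"
    using small_gradient_near_critical[of "R / 2"] R(1) by (metis half_gt_zero)
  \<comment> \<open>A smaller gradient would put \<open>x\<close> within \<open>R / 2\<close> of a
    critical point other than \<open>u\<close>, hence bring two critical points closer than
    \<open>5 * R\<close>.\<close>
  have annulus: "e \<le> G x" if "x \<in> X" "u \<in> K" "R / 2 \<le> edist N x u" "edist N x u \<le> 3 * R" for x u
  proof (rule ccontr)
    assume "\<not> e \<le> G x"
    then obtain v where v: "v \<in> K" "edist N x v < R / 2"
      using e(2) \<open>x \<in> X\<close> by force
    then have "u \<noteq> v" using that by auto
    then have "5 * R < edist N u v" using R that v by blast
    also have "\<dots> \<le> edist N x u + edist N x v"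
      using edist_triangle[of N u v x] edist_sym[of N u x] by simp
    finally show False using v that R(1) by linarith
  qed
  have "compact (X \<times> K)"
    using compact_X finite_imp_compact[OF fin] by (rule compact_Times)
  moreover have "continuous_on (X \<times> K) (\<lambda>z. \<bar>J (fst z) - J (snd z)\<bar>)"
    using X_subset
    by (intro continuous_on_rabs continuous_on_diff continuous_on_compose2[OF J_cont]
        continuous_on_fst continuous_on_snd continuous_on_id) (auto simp: K_def)
  moreover have "continuous_on (X \<times> K) (\<lambda>z. edist N (fst z) (snd z))"
    by (intro continuous_on_edist continuous_on_fst continuous_on_snd continuous_on_id)
  ultimately obtain \<delta>' where \<delta>': "\<delta>' > 0" "\<And>z. z \<in> X \<times> K \<Longrightarrow> edist N (fst z) (snd z) < \<delta>' \<Longrightarrow>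
      \<bar>J (fst z) - J (snd z)\<bar> < e * R / 4"
  proof (rule compact_modulus)
    show "\<bar>J (fst z) - J (snd z)\<bar> \<le> 0" if "z \<in> X \<times> K" "edist N (fst z) (snd z) = 0" for z
      using that X_subset edist_zero_iff[of "fst z" N "snd z"] by (auto simp: K_def)
    show "0 < e * R / 4" using e R by simp
  qed auto
  define \<delta> where "\<delta> = min R \<delta>' / 2"
  have \<delta>: "\<delta> > 0" "2 * \<delta> \<le> R" "2 * \<delta> \<le> \<delta>'"
    using R \<delta>' by (auto simp: \<delta>_def)
  obtain d where d: "d > 0" "\<And>x. x \<in> X \<Longrightarrow> G x < d \<Longrightarrow> \<exists>u\<in>K. edist N x u < \<delta>"
    using small_gradient_near_critical[OF \<delta>(1)] by metis
  \<comment> \<open>Farther than \<delta> from \<open>K\<close> the gradient is at least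
    \<open>d = 2 * \<eta>\<close>. There the cut-off leaves \<open>w\<close> a length of at least
    \<eta>, and J drops by at least \<open>\<tau> * \<eta> * \<eta>\<close> per step.\<close>
  define \<eta> where "\<eta> = d / 2"
  have \<eta>: "\<eta> > 0" using d by (simp add: \<eta>_def)
  obtain \<tau> where \<tau>: "\<tau> > 0" "\<And>x. x \<in> X \<Longrightarrow> T \<eta> \<tau> x \<in> X"
    "\<And>x. x \<in> X \<Longrightarrow> G x * edist N (T \<eta> \<tau> x) x \<le> 2 * (J x - J (T \<eta> \<tau> x))"
    "\<And>x. x \<in> X \<Longrightarrow> edist N (T \<eta> \<tau> x) x < R / 2"
    using descent_step[OF \<eta>, of "R / 2"] R(1) by (metis half_gt_zero)
  define S where "S = T \<eta> \<tau>"
  have SX: "(S ^^ k) x \<in> X" if "x \<in> X" for x k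
    by (induction k) (use \<tau>(2) that in \<open>auto simp: S_def\<close>)
  have decr: "J (S x) \<le> J x" if "x \<in> X" for x
  proof -
    have "0 \<le> G x * edist N (T \<eta> \<tau> x) x" by simp
    from order_trans[OF this \<tau>(3)[OF that]] show ?thesis by (simp add: S_def)
  qed
  \<comment> \<open>The distance to \<open>u\<close>, truncated to the range from \<open>R\<close>
    to \<open>2 * R\<close>, plus a multiple of J. A step starting between distances
    \<open>R / 2\<close> and \<open>3 * R\<close> pays for its length by the drop of J; elsewhere a
    step shorter than \<open>R / 2\<close> leaves the truncated distance unchanged.\<close>
  define \<Phi> where "\<Phi> u x = min (2 * R) (max R (edist N x u)) + 2 / e * J x" for u x
  have \<Phi>_step: "\<Phi> u (S x) \<le> \<Phi> u x" if x: "x \<in> X" and u: "u \<in> K" for u x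
  proof -
    have tri: "edist N (S x) u \<le> edist N (S x) x + edist N x u"
      "edist N x u \<le> edist N (S x) x + edist N (S x) u"
      using edist_triangle[of N "S x" u x] edist_triangle[of N x u "S x"] edist_sym[of N x "S x"] by auto
    have len: "edist N (S x) x < R / 2" using \<tau>(4)[OF x] by (simp add: S_def)
    show ?thesis
    proof (cases "R / 2 \<le> edist N x u \<and> edist N x u \<le> 3 * R")
      case True
      have "e * edist N (S x) x \<le> G x * edist N (S x) x"
        using annulus[OF x u] True by (intro mult_right_mono) auto
      also have "\<dots> \<le> 2 * (J x - J (S x))"
        using \<tau>(3)[OF x] by (simp add: S_def)
      finally have "edist N (S x) x \<le> 2 / e * J x - 2 / e * J (S x)"
        using e(1) by (simp add: field_simps)
      then show ?thesis
        using tri unfolding \<Phi>_def min_def max_def by auto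
    next
      case False
      then have "min (2 * R) (max R (edist N (S x) u)) = min (2 * R) (max R (edist N x u))"
        using tri len R(1) by auto
      moreover have "2 / e * J (S x) \<le> 2 / e * J x"
        using decr[OF x] e(1) by (intro mult_left_mono) auto
      ultimately show ?thesis by (simp add: \<Phi>_def)
    qed
  qed
  have \<Phi>_mono: "\<Phi> u ((S ^^ l) x) \<le> \<Phi> u ((S ^^ k) x)" if "x \<in> X" "u \<in> K" "k \<le> l" for u x k l
    using that(3)
  proof (induction rule: dec_induct)
    case (step m)
    have "\<Phi> u ((S ^^ Suc m) x) \<le> \<Phi> u ((S ^^ m) x)"
      using \<Phi>_step[OF SX[OF that(1)] that(2)] by simp
    with step.IH show ?case by linarith
  qed simp
  have sep: False if x: "x \<in> X" and u: "u \<in> K" and kl: "k \<le> l" and k: "edist N ((S ^^ k) x) u < 2 * \<delta>"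
    and l: "edist N ((S ^^ l) x) (\<lambda>i. - u i) < 2 * \<delta>" for x u k l
  proof -
    let ?y = "(S ^^ k) x" and ?z = "(S ^^ l) x" and ?v = "\<lambda>i. - u i"
    have v: "?v \<in> K" by (rule K_uminus[OF u])
    have "u \<noteq> ?v" using u by (auto simp: K_def fun_eq_iff)
    then have "5 * R < edist N u ?v" using R(2) u v by blast
    also have "\<dots> \<le> edist N ?z u + edist N ?z ?v"
      using edist_triangle[of N u ?v ?z] edist_sym[of N u ?z] by simp
    finally have "2 * R < edist N ?z u" using l \<delta> R(1) by linarith
    moreover have "edist N ?y u < R" using k \<delta> by linarith
    ultimately have "R + 2 / e * J ?z \<le> 2 / e * J ?y"
      using \<Phi>_mono[OF x u kl] R(1) by (simp add: \<Phi>_def min_def max_def)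
    from mult_left_mono[OF this, of e] have "R * e \<le> 2 * (J ?y - J ?z)"
      using e(1) by (simp add: distrib_left mult.commute)
    moreover have "\<bar>J ?y - J u\<bar> < e * R / 4"
      using \<delta>'(2)[of "(?y, u)"] SX[OF x] u k \<delta> by simp
    then have "J ?y - J u < e * R / 4" by (rule abs_less_iff[THEN iffD1, THEN conjunct1])
    moreover have "\<bar>J ?z - J ?v\<bar> < e * R / 4"
      using \<delta>'(2)[of "(?z, ?v)"] SX[OF x] v l \<delta> by simp
    then have "- (J ?z - J ?v) < e * R / 4" by (rule abs_less_iff[THEN iffD1, THEN conjunct2])
    moreover have "J ?v = J u" by (rule J_even)
    moreover have False if "c \<le> 2 * (a - b)" "a - j < c / 4" "- (b - j') < c / 4" "j' = j"
      for a b c j j' :: real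
      using that by argo
    ultimately show False unfolding mult.commute[of e R] by blast
  qed
  obtain m where m: "\<And>x. x \<in> X \<Longrightarrow> m \<le> J x"
  proof (cases "X = {}")
    case False
    have "continuous_on X J" using J_cont X_subset by (rule continuous_on_subset)
    then show ?thesis using continuous_attains_inf[OF compact_X False] that by blast
  qed (use that in auto)
  \<comment> \<open>J varies by at most \<open>M - m\<close> on \<open>X\<close>, so
    \<open>n\<close> consecutive steps away from \<open>K\<close> would use up more than is
    available.\<close>
  obtain n where n: "M - m < real n * (\<tau> * \<eta> * \<eta>)"
    using reals_Archimedean3[of "\<tau> * \<eta> * \<eta>"] \<tau>(1) \<eta> by auto
  show thesis
  proof (rule that[OF \<delta>(1), of S n])
    show "continuous_on X S"
      unfolding S_def using T_cont[OF \<eta>] X_subset by (rule continuous_on_subset)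
    show "S ` X \<subseteq> X" using \<tau>(2) by (auto simp: S_def)
    show "S (\<lambda>i. - x i) = (\<lambda>i. - S x i)" for x by (simp add: S_def T_uminus)
  next
    fix x assume x: "x \<in> X"
    show "\<exists>k\<le>n. \<exists>u\<in>K. edist N ((S ^^ k) x) u < \<delta>"
    proof (rule ccontr)
      assume far: "\<not> ?thesis"
      have "J ((S ^^ k) x) \<le> J x - real k * (\<tau> * \<eta> * \<eta>)" if "k \<le> n" for k
        using that
      proof (induction k)
        case (Suc k)
        let ?y = "(S ^^ k) x"
        have y: "?y \<in> X" by (rule SX[OF x])
        have "d \<le> G ?y"
          using d(2)[OF y] far Suc.prems by (meson Suc_leD linorder_not_le)
        then have G: "2 * \<eta> \<le> G ?y" by (simp add: \<eta>_def)
        have "edist N (S ?y) ?y = \<tau> * (max \<eta> (G ?y) - \<eta>)"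
          using \<tau>(1) enorm_w[OF \<eta>] by (simp add: S_def edist_T)
        then have "\<tau> * \<eta> \<le> edist N (S ?y) ?y"
          using \<tau>(1) G \<eta> by (simp add: mult_left_mono)
        then have "2 * \<eta> * (\<tau> * \<eta>) \<le> G ?y * edist N (S ?y) ?y"
          using G \<eta> \<tau>(1) by (intro mult_mono) auto
        also have "\<dots> \<le> 2 * (J ?y - J (S ?y))"
          using \<tau>(3)[OF y] by (simp add: S_def)
        finally have "J (S ?y) \<le> J ?y - \<tau> * \<eta> * \<eta>" by (simp add: mult_ac)
        then show ?case using Suc by (simp add: algebra_simps)
      qed simp
      from this[of n] n m[OF SX[OF x, of n]] x show False
        by (auto simp: X_def)
    qed
    fix u k l assume u: "u \<in> K" and k: "edist N ((S ^^ k) x) u < 2 * \<delta>"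
    show "2 * \<delta> \<le> edist N ((S ^^ l) x) (\<lambda>i. - u i)"
    proof (rule ccontr)
      assume l: "\<not> ?thesis"
      show False
      proof (cases "k \<le> l")
        case True
        then show ?thesis using sep[OF x u True k] l by simp
      next
        \<comment> \<open>If \<open>-u\<close> is approached first, \<open>sep\<close> applies to
          \<open>-u\<close>, whose antipode is \<open>u\<close>.\<close>
        case False
        then show ?thesis
          using sep[OF x K_uminus[OF u], of l k] k l by simp
      qed
    qed
  qed
qed

end

text \<open>Spherical coordinates on a cube. The Kuhn grid pads missing coordinates with the maximal value,
  here \<open>t i = 1\<close>, which truncates the point to a sphere of lower dimension; opposite faces in the
  last direction are then the two hemispheres of the next sphere, exchanged by the antipodal map.\<close>

definition sphere_point :: "nat \<Rightarrow> real \<Rightarrow> (nat \<Rightarrow> real) \<Rightarrow> nat \<Rightarrow> real" where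
  "sphere_point N \<rho> t = (\<lambda>j. if j < N then \<rho> * (\<Prod>i<j. sin (pi * t i)) * cos (pi * t j) else 0)"

lemma sphere_point_coord [simp]: "sphere_point N \<rho> t \<in> coord_space N"
  by (simp add: sphere_point_def coord_space_def)

text \<open>The product of sines times \<rho> is the radius left over after \<open>n\<close>
  coordinates; the next coordinate takes its cosine share and passes the sine share on.\<close>

lemma sphere_point_partial_norm:
  "n \<le> N \<Longrightarrow> (\<Sum>j<n. (sphere_point N \<rho> t j)\<^sup>2) + \<rho>\<^sup>2 * (\<Prod>i<n. sin (pi * t i))\<^sup>2 = \<rho>\<^sup>2"
proof (induction n)
  case (Suc n)
  define P where "P = (\<Prod>i<n. sin (pi * t i))"
  have "sphere_point N \<rho> t n = \<rho> * P * cos (pi * t n)"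
    using Suc.prems by (simp add: sphere_point_def P_def)
  moreover have "(\<rho> * P * c)\<^sup>2 + \<rho>\<^sup>2 * (P * s)\<^sup>2 = \<rho>\<^sup>2 * P\<^sup>2 * (c\<^sup>2 + s\<^sup>2)" for c s
    by algebra
  ultimately have "(sphere_point N \<rho> t n)\<^sup>2 + \<rho>\<^sup>2 * (P * sin (pi * t n))\<^sup>2 = \<rho>\<^sup>2 * P\<^sup>2"
    by simp
  then show ?case using Suc by (simp add: P_def[symmetric])
qed simp

lemma enorm_sphere_point:
  assumes "\<rho> > 0" "m < N" "t m = 1"
  shows "enorm N (sphere_point N \<rho> t) = \<rho>"
proof -
  have P0: "(\<Prod>i<N. sin (pi * t i)) = 0"
    using assms by (intro prod_zero) (auto intro: bexI[of _ m])
  then have "(\<Sum>j<N. (sphere_point N \<rho> t j)\<^sup>2) = \<rho>\<^sup>2"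
    using sphere_point_partial_norm[of N N \<rho> t] unfolding P0 by simp
  then show ?thesis using assms by (simp add: enorm_def L2_set_def)
qed

lemma sphere_point_cong:
  "(\<And>i. i < N \<Longrightarrow> t i = t' i) \<Longrightarrow> sphere_point N \<rho> t = sphere_point N \<rho> t'"
  by (auto simp: sphere_point_def fun_eq_iff intro!: prod.cong)

text \<open>The angle \<open>t j\<close> enters only coordinates from \<open>j\<close> on, and these
  all contain the vanishing factor \<open>sin (pi * t i)\<close>.\<close>

lemma sphere_point_degenerate:
  assumes "sin (pi * t i) = 0" "i < j" "\<forall>l. l \<noteq> j \<longrightarrow> t l = t' l"
  shows "sphere_point N \<rho> t = sphere_point N \<rho> t'"
proof
  fix l
  show "sphere_point N \<rho> t l = sphere_point N \<rho> t' l"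
  proof (cases "j \<le> l")
    case True
    have "t' i = t i" using assms by auto
    then have P0: "(\<Prod>i<l. sin (pi * t i)) = 0" "(\<Prod>i<l. sin (pi * t' i)) = 0"
      using assms True by (auto intro!: prod_zero bexI[of _ i])
    show ?thesis unfolding sphere_point_def P0 by simp
  next
    case False
    then have "t l = t' l" "(\<Prod>i<l. sin (pi * t i)) = (\<Prod>i<l. sin (pi * t' i))"
      using assms by (auto intro!: prod.cong)
    then show ?thesis by (simp add: sphere_point_def)
  qed
qed

text \<open>Replacing an angle by its supplement keeps the sine and negates the cosine, which
  changes the sign of the coordinates up to \<open>m\<close>; all later ones vanish on both sides
  because \<open>sin (pi * t m) = 0\<close>.\<close>

lemma sphere_point_antipodal:
  assumes "t m = 0" "\<And>i. m < i \<Longrightarrow> t i = 1" "\<And>i. i \<le> m \<Longrightarrow> t' i = 1 - t i" "\<And>i. m < i \<Longrightarrow> t' i = 1"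
  shows "sphere_point N \<rho> t' = (\<lambda>j. - sphere_point N \<rho> t j)"
proof
  fix j
  have s: "sin (pi * t' i) = sin (pi * t i)" and c: "cos (pi * t' i) = - cos (pi * t i)" if "i \<le> m" for i
    unfolding assms(3)[OF that] right_diff_distrib by (simp_all add: sin_diff cos_diff)
  show "sphere_point N \<rho> t' j = - sphere_point N \<rho> t j"
  proof (cases "j \<le> m")
    case True
    then have "(\<Prod>i<j. sin (pi * t' i)) = (\<Prod>i<j. sin (pi * t i))"
      using s by (intro prod.cong) auto
    then show ?thesis using c[OF True] by (simp add: sphere_point_def)
  next
    case False
    have "t' m = 1" using assms(1,3) by simp
    then have P0: "(\<Prod>i<j. sin (pi * t i)) = 0" "(\<Prod>i<j. sin (pi * t' i)) = 0"
      using assms False by (auto intro!: prod_zero bexI[of _ m])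
    show ?thesis unfolding sphere_point_def P0 by simp
  qed
qed

lemma continuous_on_sphere_point: "continuous_on S (sphere_point N \<rho>)"
proof (rule continuous_on_coordinatewise_then_product)
  fix j
  have "continuous_on S (\<lambda>t. t i)" for i
    by (rule continuous_on_coordinate[OF continuous_on_id])
  then show "continuous_on S (\<lambda>t. sphere_point N \<rho> t j)"
    by (cases "j < N") (auto simp: sphere_point_def intro!: continuous_intros)
qed

section \<open>Labelling the grid by visited critical points\<close>

context even_functional
begin

lemma X_sphere_point: "m < N \<Longrightarrow> t m = 1 \<Longrightarrow> sphere_point N \<rho> t \<in> X"
  using sphere[of "sphere_point N \<rho> t"] enorm_sphere_point[OF \<rho>, of m N t] by (simp add: X_def)

text \<open>Neighbouring grid points cannot carry opposite labels: up to iterate \<open>b\<close>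
  their orbits stay \<delta>-close, so a \<delta>-visit of \<open>v\<close> by one orbit is a
  2\<delta>-approach by the other, and \<open>descent_map\<close> forbids the latter to approach
  both \<open>v\<close> and its antipode. The two radii exist for this comparison.\<close>

lemma grid_labelling:
  assumes "finite K" "N = Suc n"
  obtains p and L :: "(nat \<Rightarrow> nat) \<Rightarrow> int" and \<phi> :: "(nat \<Rightarrow> real) \<Rightarrow> int" where "p > 0"
    "\<And>x. x \<in> grid p n \<Longrightarrow> L x \<noteq> 0"
    "\<And>x y. x \<in> grid p n \<Longrightarrow> y \<in> grid p n \<Longrightarrow> (\<forall>j. x j \<le> Suc (y j)) \<Longrightarrow>
      (\<forall>j. y j \<le> Suc (x j)) \<Longrightarrow> L x \<noteq> - L y"
    "\<And>x y i j. x \<in> grid p n \<Longrightarrow> y \<in> grid p n \<Longrightarrow> i < j \<Longrightarrow> x i = 0 \<or> x i = p \<Longrightarrow>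
      \<forall>l. l \<noteq> j \<longrightarrow> x l = y l \<Longrightarrow> L x = L y"
    "\<And>m x. m < n \<Longrightarrow> x \<in> grid p (Suc m) \<Longrightarrow> x m = 0 \<Longrightarrow>
      L (grid_reflect p (Suc m) x) = - L x"
    "L ` grid p n \<subseteq> \<phi> ` K"
proof -
  have "(\<lambda>i. - u i) \<noteq> u" if "u \<in> K" for u
    using that by (auto simp: K_def fun_eq_iff)
  then obtain \<phi> :: "(nat \<Rightarrow> real) \<Rightarrow> int" where \<phi>: "inj_on \<phi> K"
    "\<And>u. u \<in> K \<Longrightarrow> \<phi> (\<lambda>i. - u i) = - \<phi> u" "\<And>u. u \<in> K \<Longrightarrow> \<phi> u \<noteq> 0"
    using odd_labelling[OF assms(1), of "\<lambda>u i. - u i"] K_uminus by auto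
  obtain S b \<delta> where S: "\<delta> > 0" "continuous_on X S" "S ` X \<subseteq> X" "\<And>x. S (\<lambda>i. - x i) = (\<lambda>i. - S x i)"
    "\<And>x. x \<in> X \<Longrightarrow> \<exists>k\<le>b. \<exists>u\<in>K. edist N ((S ^^ k) x) u < \<delta>"
    "\<And>x u k l. x \<in> X \<Longrightarrow> u \<in> K \<Longrightarrow> edist N ((S ^^ k) x) u < 2 * \<delta> \<Longrightarrow>
      2 * \<delta> \<le> edist N ((S ^^ l) x) (\<lambda>i. - u i)"
    by (rule descent_map[OF assms(1)]) (rule that)
  define visits where "visits x i \<longleftrightarrow> (\<exists>u\<in>K. \<phi> u = i \<and> (\<exists>k\<le>b. edist N ((S ^^ k) x) u < \<delta>))" for x i
  \<comment> \<open>The visited label of least absolute value. The minimum is common to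
    \<open>x\<close> and \<open>-x\<close>, and \<open>not_both\<close> makes its sign unambiguous,
    so that \<open>lab\<close> is odd.\<close>
  define lab where "lab x = (let i = LEAST i. visits x (int i) \<or> visits x (- int i)
      in if visits x (int i) then int i else - int i)" for x
  have S_pow: "(S ^^ k) (\<lambda>i. - x i) = (\<lambda>i. - (S ^^ k) x i)" for k x
    by (induction k) (simp_all add: S(4))
  have S_pow_X: "(S ^^ k) x \<in> X" if "x \<in> X" for k x
    by (induction k) (use that S(3) in auto)
  have S_pow_cont: "continuous_on X (S ^^ k)" for k
  proof (induction k)
    case (Suc k)
    then show ?case
      using continuous_on_compose2[OF S(2) Suc] S_pow_X by (simp add: comp_def image_subset_iff)
  qed (simp add: continuous_on_id)
  have visits_uminus: "visits (\<lambda>i. - x i) j \<longleftrightarrow> visits x (- j)" for x j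
  proof -
    have *: "visits (\<lambda>i. - x i) j" if v: "visits x (- j)" for x j
    proof -
      obtain u k where u: "u \<in> K" "\<phi> u = - j" "k \<le> b" "edist N ((S ^^ k) x) u < \<delta>"
        using v by (auto simp: visits_def)
      then have "\<phi> (\<lambda>i. - u i) = j" "edist N ((S ^^ k) (\<lambda>i. - x i)) (\<lambda>i. - u i) < \<delta>"
        using \<phi>(2) by (auto simp: S_pow edist_uminus)
      then show ?thesis using K_uminus[OF u(1)] u(3) unfolding visits_def by blast
    qed
    show ?thesis using *[of x j] *[of "\<lambda>i. - x i" "- j"] by auto
  qed
  have visits_lab: "visits x (lab x)" if "x \<in> X" for x
  proof -
    obtain u k where u: "k \<le> b" "u \<in> K" "edist N ((S ^^ k) x) u < \<delta>"
      using S(5)[OF \<open>x \<in> X\<close>] by blast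
    then have v: "visits x (\<phi> u)" by (auto simp: visits_def)
    have "\<exists>i. visits x (int i) \<or> visits x (- int i)"
    proof (cases "0 \<le> \<phi> u")
      case True
      then show ?thesis using v by (intro exI[of _ "nat (\<phi> u)"]) simp
    next
      case False
      then show ?thesis using v by (intro exI[of _ "nat (- \<phi> u)"]) simp
    qed
    then have "visits x (int (LEAST i. visits x (int i) \<or> visits x (- int i))) \<or>
        visits x (- int (LEAST i. visits x (int i) \<or> visits x (- int i)))"
      by (rule LeastI_ex)
    then show ?thesis by (auto simp: lab_def Let_def)
  qed
  have separated: "\<phi> u = - \<phi> v \<Longrightarrow> False"
    if "x \<in> X" "u \<in> K" "v \<in> K" "edist N ((S ^^ k) x) u < 2 * \<delta>" "edist N ((S ^^ l) x) v < 2 * \<delta>" for x u v k l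
  proof -
    assume "\<phi> u = - \<phi> v"
    then have "\<phi> v = \<phi> (\<lambda>i. - u i)" using \<phi>(2)[OF that(2)] by simp
    then have "v = (\<lambda>i. - u i)" using inj_onD[OF \<phi>(1)] that K_uminus by blast
    then show False using S(6)[OF that(1,2,4), of l] that(5) by simp
  qed
  have not_both: "\<not> visits x (- j)" if x: "x \<in> X" and j: "visits x j" for x j
  proof
    assume "visits x (- j)"
    then obtain u v k l where uv: "u \<in> K" "v \<in> K" "\<phi> u = - \<phi> v"
      "edist N ((S ^^ k) x) u < \<delta>" "edist N ((S ^^ l) x) v < \<delta>"
      using j unfolding visits_def by (metis minus_minus)
    have "\<delta> < 2 * \<delta>" using S(1) by simp
    then show False
      using separated[OF x uv(1,2) order.strict_trans[OF uv(4)] order.strict_trans[OF uv(5)] uv(3)]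
      by blast
  qed
  have lab_uminus: "lab (\<lambda>i. - x i) = - lab x" if x: "x \<in> X" for x
  proof -
    define m where "m = (LEAST i. visits x (int i) \<or> visits x (- int i))"
    have m': "(LEAST i. visits (\<lambda>i. - x i) (int i) \<or> visits (\<lambda>i. - x i) (- int i)) = m"
      unfolding m_def by (simp add: visits_uminus disj_commute)
    have "visits x (int m) \<or> visits x (- int m)"
      using visits_lab[OF x] unfolding lab_def m_def[symmetric] Let_def by (auto split: if_splits)
    then show ?thesis
      unfolding lab_def m' m_def[symmetric] Let_def
      using not_both[OF x, of "int m"] by (auto simp: visits_uminus)
  qed
  have lab_K: "lab x \<in> \<phi> ` K" if x: "x \<in> X" for x
  proof -
    obtain u where "u \<in> K" "\<phi> u = lab x" using visits_lab[OF x] unfolding visits_def by blast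
    then show ?thesis by (metis imageI)
  qed
  let ?\<sigma> = "sphere_point N \<rho>"
  \<comment> \<open>Freezing \<open>t n = 1\<close> puts the point on the sphere, with nonpositive
    last coordinate: the remaining angles sweep a closed hemisphere.\<close>
  define Q where "Q = {t :: nat \<Rightarrow> real. \<forall>i. (if i = n then 1 else 0) \<le> t i \<and> t i \<le> 1}"
  have \<sigma>X: "?\<sigma> t \<in> X" if "t \<in> Q" for t
  proof (rule X_sphere_point)
    show "n < N" using assms by simp
    have "(if n = n then 1 else 0) \<le> t n \<and> t n \<le> 1" using that unfolding Q_def by blast
    then show "t n = 1" by simp
  qed
  have Q: "compact (Q \<times> Q)"
    unfolding Q_def by (intro compact_Times compact_coord_box)
  \<comment> \<open>The sum over \<open>k\<close> lets a single modulus of continuity control all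
    iterates up to \<open>b\<close>.\<close>
  have f_cont: "continuous_on (Q \<times> Q) (\<lambda>z. \<Sum>k\<le>b. edist N ((S ^^ k) (?\<sigma> (fst z))) ((S ^^ k) (?\<sigma> (snd z))))"
  proof (intro continuous_on_sum continuous_on_edist)
    fix k
    have c: "continuous_on Q (\<lambda>t. (S ^^ k) (?\<sigma> t))"
      by (rule continuous_on_compose2[OF S_pow_cont continuous_on_sphere_point]) (use \<sigma>X in auto)
    show "continuous_on (Q \<times> Q) (\<lambda>z. (S ^^ k) (?\<sigma> (fst z)))"
      by (rule continuous_on_compose2[OF c continuous_on_fst[OF continuous_on_id]]) auto
    show "continuous_on (Q \<times> Q) (\<lambda>z. (S ^^ k) (?\<sigma> (snd z)))"
      by (rule continuous_on_compose2[OF c continuous_on_snd[OF continuous_on_id]]) auto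
  qed
  have k_cont: "continuous_on (Q \<times> Q) (\<lambda>z. edist N (fst z) (snd z))"
    by (intro continuous_on_edist continuous_on_fst continuous_on_snd continuous_on_id)
  obtain d where d: "d > 0" "\<And>z. z \<in> Q \<times> Q \<Longrightarrow> edist N (fst z) (snd z) < d \<Longrightarrow>
      (\<Sum>k\<le>b. edist N ((S ^^ k) (?\<sigma> (fst z))) ((S ^^ k) (?\<sigma> (snd z)))) < \<delta>"
  proof (rule compact_modulus[OF Q f_cont k_cont _ _ S(1)])
    fix z assume "edist N (fst z) (snd z) = 0"
    \<comment> \<open>Zero distance only means agreement below \<open>N\<close>, which is all that
      \<open>sphere_point N\<close> depends on.\<close>
    then have "?\<sigma> (fst z) = ?\<sigma> (snd z)"
      by (intro sphere_point_cong) (simp add: edist_def enorm_zero_iff)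
    then show "(\<Sum>k\<le>b. edist N ((S ^^ k) (?\<sigma> (fst z))) ((S ^^ k) (?\<sigma> (snd z)))) \<le> 0"
      by simp
  qed auto
  \<comment> \<open>Neighbouring grid points differ by at most \<open>1 / p\<close> in each of the
    \<open>N\<close> coordinates, so this mesh brings them within \<open>d\<close>.\<close>
  obtain p where p: "real N / d < real p" "p > 0"
    using reals_Archimedean2[of "real N / d"] by (metis gr0I of_nat_0 of_nat_0_le_iff d(1) divide_nonneg_pos linorder_not_less)
  define \<theta> where "\<theta> x = (\<lambda>i. real (x i) / real p)" for x :: "nat \<Rightarrow> nat"
  define L where "L x = lab (?\<sigma> (\<theta> x))" for x
  have \<theta>Q: "\<theta> x \<in> Q" if "x \<in> grid p n" for x
    using that p(2) by (auto simp: Q_def \<theta>_def grid_def)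
  have inX: "?\<sigma> (\<theta> x) \<in> X" if "x \<in> grid p n" for x
    using \<sigma>X \<theta>Q that by blast
  show thesis
  proof (rule that[of p L \<phi>])
    show "p > 0" by (rule p)
    show sub: "L ` grid p n \<subseteq> \<phi> ` K"
      using inX lab_K by (auto simp: L_def)
    show "L x \<noteq> 0" if "x \<in> grid p n" for x
      using sub \<phi>(3) that by force
    show "L x = L y" if "x \<in> grid p n" "y \<in> grid p n" "i < j" "x i = 0 \<or> x i = p" "\<forall>l. l \<noteq> j \<longrightarrow> x l = y l"
      for x y i j
    proof -
      have "sin (pi * \<theta> x i) = 0" using that(4) p(2) by (auto simp: \<theta>_def)
      then have "?\<sigma> (\<theta> x) = ?\<sigma> (\<theta> y)"
        by (rule sphere_point_degenerate[OF _ that(3)]) (use that(5) in \<open>simp add: \<theta>_def\<close>)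
      then show ?thesis by (simp add: L_def)
    qed
    show "L (grid_reflect p (Suc m) x) = - L x" if "m < n" "x \<in> grid p (Suc m)" "x m = 0" for m x
    proof -
      have "?\<sigma> (\<theta> (grid_reflect p (Suc m) x)) = (\<lambda>j. - ?\<sigma> (\<theta> x) j)"
        by (rule sphere_point_antipodal[where m = m])
          (use that p(2) in \<open>auto simp: \<theta>_def grid_reflect_def grid_def diff_divide_distrib of_nat_diff\<close>)
      moreover have "x \<in> grid p n" using that by (auto simp: grid_def)
      ultimately show ?thesis using lab_uminus inX by (simp add: L_def)
    qed
    show "L x \<noteq> - L y" if xy: "x \<in> grid p n" "y \<in> grid p n" "\<forall>j. x j \<le> Suc (y j)" "\<forall>j. y j \<le> Suc (x j)" for x y
    proof
      assume eq: "L x = - L y"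
      obtain u k where u: "u \<in> K" "\<phi> u = L x" "k \<le> b" "edist N ((S ^^ k) (?\<sigma> (\<theta> x))) u < \<delta>"
        using visits_lab[OF inX[OF xy(1)]] by (auto simp: visits_def L_def)
      obtain v l where v: "v \<in> K" "\<phi> v = L y" "l \<le> b" "edist N ((S ^^ l) (?\<sigma> (\<theta> y))) v < \<delta>"
        using visits_lab[OF inX[OF xy(2)]] by (auto simp: visits_def L_def)
      have "edist N (\<theta> x) (\<theta> y) \<le> (\<Sum>i<N. \<bar>\<theta> x i - \<theta> y i\<bar>)"
        unfolding edist_def enorm_def by (rule L2_set_le_sum_abs)
      also have "\<dots> \<le> (\<Sum>i<N. 1 / real p)"
      proof (rule sum_mono)
        fix i
        have "x i \<le> Suc (y i)" "y i \<le> Suc (x i)" using xy by auto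
        then have "\<bar>real (x i) - real (y i)\<bar> \<le> 1" by linarith
        then show "\<bar>\<theta> x i - \<theta> y i\<bar> \<le> 1 / real p"
          using p(2) by (simp add: \<theta>_def diff_divide_distrib[symmetric] abs_divide divide_right_mono)
      qed
      also have "\<dots> < d"
        using p d(1) by (simp add: field_simps)
      finally have "(\<Sum>k\<le>b. edist N ((S ^^ k) (?\<sigma> (\<theta> x))) ((S ^^ k) (?\<sigma> (\<theta> y)))) < \<delta>"
        using d(2)[of "(\<theta> x, \<theta> y)"] \<theta>Q xy by simp
      moreover have "edist N ((S ^^ l) (?\<sigma> (\<theta> x))) ((S ^^ l) (?\<sigma> (\<theta> y))) \<le>
          (\<Sum>k\<le>b. edist N ((S ^^ k) (?\<sigma> (\<theta> x))) ((S ^^ k) (?\<sigma> (\<theta> y))))"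
        using v(3) by (intro member_le_sum) auto
      ultimately have "edist N ((S ^^ l) (?\<sigma> (\<theta> x))) v < 2 * \<delta>"
        using edist_triangle[of N "(S ^^ l) (?\<sigma> (\<theta> x))" v "(S ^^ l) (?\<sigma> (\<theta> y))"] v(4) by linarith
      moreover have "edist N ((S ^^ k) (?\<sigma> (\<theta> x))) u < 2 * \<delta>"
        using u(4) S(1) by linarith
      ultimately show False
        using separated[OF inX[OF xy(1)] u(1) v(1)] u(2) v(2) eq by metis
    qed
  qed
qed

theorem many_critical_points: "infinite K \<or> N \<le> card K"
proof (cases "finite K \<and> N \<noteq> 0")
  case True
  then obtain n where n: "N = Suc n" by (cases N) auto
  obtain p and L :: "(nat \<Rightarrow> nat) \<Rightarrow> int" and \<phi> :: "(nat \<Rightarrow> real) \<Rightarrow> int" where L: "p > 0"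
    "\<And>x. x \<in> grid p n \<Longrightarrow> L x \<noteq> 0"
    "\<And>x y. x \<in> grid p n \<Longrightarrow> y \<in> grid p n \<Longrightarrow> (\<forall>j. x j \<le> Suc (y j)) \<Longrightarrow>
      (\<forall>j. y j \<le> Suc (x j)) \<Longrightarrow> L x \<noteq> - L y"
    "\<And>x y i j. x \<in> grid p n \<Longrightarrow> y \<in> grid p n \<Longrightarrow> i < j \<Longrightarrow> x i = 0 \<or> x i = p \<Longrightarrow>
      \<forall>l. l \<noteq> j \<longrightarrow> x l = y l \<Longrightarrow> L x = L y"
    "\<And>m x. m < n \<Longrightarrow> x \<in> grid p (Suc m) \<Longrightarrow> x m = 0 \<Longrightarrow>
      L (grid_reflect p (Suc m) x) = - L x"
    "L ` grid p n \<subseteq> \<phi> ` K"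
    by (rule grid_labelling[OF conjunct1[OF True] n]) (rule that)
  obtain s where s: "s \<subseteq> grid p n" "card (L ` s) = Suc n"
    by (rule ky_fan_distinct_labels[OF L(1-5)])
  have "L ` s \<subseteq> \<phi> ` K" using s L(6) by blast
  then have "Suc n \<le> card (\<phi> ` K)"
    using True s(2) card_mono[of "\<phi> ` K" "L ` s"] by simp
  also have "\<dots> \<le> card K" using True by (intro card_image_le) simp
  finally show ?thesis using n by simp
qed auto

end

section \<open>The energy on the graph\<close>

lemma has_derivative_abs_powr:
  assumes "c > 1"
  shows "((\<lambda>t. \<bar>t\<bar> powr c) has_real_derivative c * signed_power c t) (at t)"
proof -
  consider "t > 0" | "t < 0" | "t = 0" by linarith
  then show ?thesis
  proof cases
    case 1
    have "((\<lambda>t. t powr c) has_real_derivative c * t powr (c - 1)) (at t)"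
      by (rule has_real_derivative_powr[OF 1])
    then have "((\<lambda>t. \<bar>t\<bar> powr c) has_real_derivative c * t powr (c - 1)) (at t)"
    proof (rule has_field_derivative_transform_within_open[where S = "{0<..}"])
    qed (use 1 in auto)
    moreover have "t powr (c - 1) = signed_power c t"
      using 1 powr_add[of t "c - 2" 1] by (simp add: signed_power_def)
    ultimately show ?thesis by simp
  next
    case 2
    have "((\<lambda>t. (- t) powr c) has_real_derivative - (c * (- t) powr (c - 1))) (at t)"
      using 2 by (auto intro!: derivative_eq_intros simp: powr_diff)
    then have "((\<lambda>t. \<bar>t\<bar> powr c) has_real_derivative - (c * (- t) powr (c - 1))) (at t)"
    proof (rule has_field_derivative_transform_within_open[where S = "{..<0}"])
    qed (use 2 in auto)
    moreover have "(- t) powr (c - 1) = - signed_power c t"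
      using 2 powr_add[of "- t" "c - 2" 1] by (simp add: signed_power_def)
    ultimately show ?thesis by simp
  next
    \<comment> \<open>At 0 the difference quotient is bounded by
      \<open>\<bar>h\<bar> powr (c - 1)\<close>, which tends to 0 = \<open>signed_power c 0\<close>
      since \<open>c > 1\<close>.\<close>
    case 3
    have "((\<lambda>h. \<bar>h\<bar> powr c / h) \<longlongrightarrow> 0) (at 0)"
    proof (rule Lim_null_comparison)
      show "\<forall>\<^sub>F h in at 0. norm (\<bar>h\<bar> powr c / h) \<le> \<bar>h\<bar> powr (c - 1)"
        by (auto simp: eventually_at_filter powr_diff)
      have "((\<lambda>h::real. \<bar>h\<bar>) \<longlongrightarrow> 0) (at 0)"
        using tendsto_rabs[OF tendsto_ident_at[of "0::real" UNIV]] by simp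
      then show "((\<lambda>h. \<bar>h\<bar> powr (c - 1)) \<longlongrightarrow> 0) (at (0::real))"
        using assms by (intro tendsto_zero_powrI[where b = "c - 1"]) auto
    qed
    then show ?thesis using assms 3 by (simp add: DERIV_def signed_power_def)
  qed
qed

text \<open>The case in question is \<open>Q s = 0\<close>. Then every
  \<open>\<alpha> y + s * \<beta> y\<close> vanishes, so \<open>Q t\<close> is a constant times the
  square of \<open>t - s\<close>; its power \<open>p / 2\<close> is of order \<open>p > 1\<close>
  and has derivative 0. The formula also gives 0 there, through the vanishing sum.\<close>

lemma has_derivative_quadratic_powr:
  fixes \<alpha> \<beta> \<omega> :: "'a \<Rightarrow> real"
  assumes "finite A" and \<omega>: "\<And>y. y \<in> A \<Longrightarrow> 0 < \<omega> y" and "p > 1"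
  defines "Q \<equiv> \<lambda>s. \<Sum>y\<in>A. \<omega> y * (\<alpha> y + s * \<beta> y)\<^sup>2"
  shows "((\<lambda>s. Q s powr (p / 2)) has_real_derivative
    p * Q s powr (p / 2 - 1) * (\<Sum>y\<in>A. \<omega> y * (\<alpha> y + s * \<beta> y) * \<beta> y)) (at s)"
proof (cases "Q s = 0")
  case False
  have "0 \<le> Q s"
    unfolding Q_def using \<omega> by (intro sum_nonneg) (simp add: less_imp_le)
  with False have pos: "Q s > 0" by simp
  have "(Q has_real_derivative (\<Sum>y\<in>A. \<omega> y * (2 * (\<alpha> y + s * \<beta> y) * \<beta> y))) (at s)"
    unfolding Q_def by (auto intro!: derivative_eq_intros sum.cong simp: algebra_simps power2_eq_square)
  from DERIV_chain2[OF has_real_derivative_powr[OF pos] this, of "p / 2"] show ?thesis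
  proof (rule DERIV_cong)
    have "(\<Sum>y\<in>A. \<omega> y * (2 * (\<alpha> y + s * \<beta> y) * \<beta> y)) = 2 * (\<Sum>y\<in>A. \<omega> y * (\<alpha> y + s * \<beta> y) * \<beta> y)"
      unfolding sum_distrib_left by (rule sum.cong) auto
    then show "p / 2 * Q s powr (p / 2 - 1) * (\<Sum>y\<in>A. \<omega> y * (2 * (\<alpha> y + s * \<beta> y) * \<beta> y)) =
        p * Q s powr (p / 2 - 1) * (\<Sum>y\<in>A. \<omega> y * (\<alpha> y + s * \<beta> y) * \<beta> y)"
      by simp
  qed
next
  case True
  have Q0: "\<alpha> y + s * \<beta> y = 0" if "y \<in> A" for y
  proof -
    have "\<omega> y * (\<alpha> y + s * \<beta> y)\<^sup>2 = 0"
      using True assms(1) \<omega> that unfolding Q_def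
      by (subst (asm) sum_nonneg_eq_0_iff) (auto simp: less_imp_le)
    then show ?thesis using \<omega>[OF that] by simp
  qed
  define C where "C = (\<Sum>y\<in>A. \<omega> y * (\<beta> y)\<^sup>2)"
  have "C \<ge> 0" unfolding C_def using \<omega> by (intro sum_nonneg) (simp add: less_imp_le)
  have Q: "Q t = \<bar>t - s\<bar>\<^sup>2 * C" for t
    unfolding Q_def C_def sum_distrib_left
  proof (rule sum.cong[OF refl])
    fix y assume "y \<in> A"
    then have "\<alpha> y = - s * \<beta> y" using Q0 by force
    then show "\<omega> y * (\<alpha> y + t * \<beta> y)\<^sup>2 = \<bar>t - s\<bar>\<^sup>2 * (\<omega> y * (\<beta> y)\<^sup>2)"
      by (simp add: power2_eq_square algebra_simps)
  qed
  have "(\<bar>t - s\<bar>\<^sup>2 * C) powr (p / 2) = \<bar>t - s\<bar> powr p * C powr (p / 2)" for t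
  proof -
    have "(\<bar>t - s\<bar>\<^sup>2) powr (p / 2) = \<bar>t - s\<bar> powr p"
      by (cases "t = s") (simp_all add: powr_powr flip: powr_numeral del: power2_abs)
    then show ?thesis using \<open>C \<ge> 0\<close> by (simp add: powr_mult)
  qed
  moreover have "((\<lambda>t. \<bar>t - s\<bar> powr p * C powr (p / 2)) has_real_derivative
      p * signed_power p (s - s) * 1 * C powr (p / 2)) (at s)"
    by (intro DERIV_cmult_right DERIV_chain2[OF has_derivative_abs_powr[OF \<open>p > 1\<close>]])
      (auto intro!: derivative_eq_intros)
  ultimately have "((\<lambda>t. Q t powr (p / 2)) has_real_derivative 0) (at s)"
    unfolding Q by (simp add: signed_power_def)
  moreover have "(\<Sum>y\<in>A. \<omega> y * (\<alpha> y + s * \<beta> y) * \<beta> y) = 0"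
    using Q0 by (intro sum.neutral) auto
  ultimately show ?thesis by simp
qed

text \<open>For \<open>p < 2\<close> the first factor blows up at the zeros of \<open>n\<close>.\<close>

lemma continuous_on_powr_mult:
  fixes f n :: "'a::topological_space \<Rightarrow> real"
  assumes n: "continuous_on S n" and f: "continuous_on S f" and "p > 1"
    and nonneg: "\<And>x. x \<in> S \<Longrightarrow> 0 \<le> n x" and bound: "\<And>x. x \<in> S \<Longrightarrow> \<bar>f x\<bar> \<le> C * n x"
  shows "continuous_on S (\<lambda>x. n x powr (p - 2) * f x)"
  unfolding continuous_on_def
proof
  fix x assume x: "x \<in> S"
  have nx: "(n \<longlongrightarrow> n x) (at x within S)" and fx: "(f \<longlongrightarrow> f x) (at x within S)"
    using n f x by (auto simp: continuous_on_def)
  show "((\<lambda>x. n x powr (p - 2) * f x) \<longlongrightarrow> n x powr (p - 2) * f x) (at x within S)"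
  proof (cases "n x = 0")
    case False
    then show ?thesis by (intro tendsto_mult tendsto_powr nx fx tendsto_const)
  next
    case True
    have "((\<lambda>y. n y powr (p - 2) * f y) \<longlongrightarrow> 0) (at x within S)"
    proof (rule Lim_null_comparison)
      have "norm (n y powr (p - 2) * f y) \<le> C * n y powr (p - 1)" if y: "y \<in> S" for y
      proof -
        have "\<bar>n y powr (p - 2) * f y\<bar> \<le> n y powr (p - 2) * (C * n y)"
          using bound[OF y] by (simp add: abs_mult mult_left_mono)
        also have "\<dots> = C * n y powr (p - 1)"
          using nonneg[OF y] powr_add[of "n y" "p - 2" 1] by (cases "n y = 0") auto
        finally show ?thesis by simp
      qed
      then show "\<forall>\<^sub>F y in at x within S. norm (n y powr (p - 2) * f y) \<le> C * n y powr (p - 1)"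
        by (simp add: eventually_at_filter)
      have "\<forall>\<^sub>F y in at x within S. 0 \<le> n y"
        using nonneg by (auto simp: eventually_at_filter)
      then have "((\<lambda>y. n y powr (p - 1)) \<longlongrightarrow> 0) (at x within S)"
        using nx True \<open>p > 1\<close> by (intro tendsto_zero_powrI[where b = "p - 1"]) auto
      then show "((\<lambda>y. C * n y powr (p - 1)) \<longlongrightarrow> 0) (at x within S)"
        by (rule tendsto_mult_right_zero)
    qed
    moreover have "f x = 0" using bound[OF x] True by simp
    ultimately show ?thesis by simp
  qed
qed

section \<open>The p-energy and Green's formula\<close>

locale dirichlet_domain = connected_measured_graph G for G :: "'v measured_graph" (structure) +
  fixes \<Omega> :: "'v set"
  assumes domain_finite: "finite \<Omega>" and boundary_nonempty: "vboundary G \<Omega> \<noteq> {}"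
begin

definition B where "B = \<Omega> \<union> vboundary G \<Omega>"

lemma finite_B: "finite B"
proof -
  have "vboundary G \<Omega> \<subseteq> (\<Union>x\<in>\<Omega>. {y. adj G x y})"
    by (auto simp: vboundary_def)
  then have "finite (vboundary G \<Omega>)"
    by (rule finite_subset) (use domain_finite locally_finite in auto)
  then show ?thesis using domain_finite by (simp add: B_def)
qed

lemma vmeas_pos: "0 < vmeas G x"
  using vmeas_lower_bound by (metis less_le_trans)

lemma neighbour_in_B: "x \<in> \<Omega> \<Longrightarrow> adj G x y \<Longrightarrow> y \<in> B"
  by (auto simp: B_def vboundary_def)

lemma grad_form_square:
  "grad_form G u u x = (\<Sum>y | adj G x y. weight G x y / (2 * vmeas G x) * (u y - u x)\<^sup>2)"
  unfolding grad_form_def sum_distrib_left by (intro sum.cong) (auto simp: power2_eq_square)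

lemma grad_form_nonneg: "0 \<le> grad_form G u u x"
  unfolding grad_form_square using vmeas_pos[of x] weight_pos
  by (intro sum_nonneg) (auto simp: less_imp_le)

lemma grad_norm_nonneg [simp]: "0 \<le> grad_norm G u x"
  by (simp add: grad_norm_def grad_form_nonneg)

lemma grad_norm_powr: "grad_norm G u x powr c = grad_form G u u x powr (c / 2)"
  using grad_form_nonneg[of u x] by (simp add: grad_norm_def powr_half_sqrt[symmetric] powr_powr)

text \<open>One edge contributes a single nonnegative term to the gradient form. This is the bound
  that \<open>continuous_on_powr_mult\<close> needs to tame negative powers of the gradient.\<close>

lemma difference_le_grad_norm:
  assumes "adj G x y"
  shows "\<bar>u y - u x\<bar> \<le> sqrt (2 * vmeas G x / weight G x y) * grad_norm G u x"
proof -
  have w: "0 < weight G x y" using weight_pos assms by blast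
  have "weight G x y / (2 * vmeas G x) * (u y - u x)\<^sup>2 \<le> grad_form G u u x"
    unfolding grad_form_square using assms vmeas_pos[of x] weight_pos
    by (intro member_le_sum locally_finite) (auto simp: less_imp_le)
  then have "(u y - u x)\<^sup>2 \<le> 2 * vmeas G x / weight G x y * grad_form G u u x"
    using w vmeas_pos[of x] by (simp add: field_simps)
  then have "sqrt ((u y - u x)\<^sup>2) \<le> sqrt (2 * vmeas G x / weight G x y * grad_form G u u x)"
    by (rule real_sqrt_le_mono)
  then show ?thesis by (simp only: real_sqrt_abs real_sqrt_mult grad_norm_def)
qed

lemma continuous_on_grad_form: "continuous_on UNIV (\<lambda>u. grad_form G u u x)"
  unfolding grad_form_def by (intro continuous_intros) auto

lemma continuous_on_grad_norm: "continuous_on UNIV (\<lambda>u. grad_norm G u x)"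
  unfolding grad_norm_def by (intro continuous_on_real_sqrt continuous_on_grad_form)

definition energy where "energy p u = (\<Sum>x\<in>B. vmeas G x * grad_norm G u x powr p)"

lemma energy_nonneg [simp]: "0 \<le> energy p u"
  unfolding energy_def using vmeas_pos by (intro sum_nonneg) (simp add: less_imp_le)

lemma W0_norm_powr: "p > 1 \<Longrightarrow> W0_norm G p \<Omega> u powr p = energy p u"
  using energy_nonneg[of p u] by (simp add: W0_norm_def vintegral_def energy_def B_def powr_powr)

lemma continuous_on_energy: "p > 1 \<Longrightarrow> continuous_on UNIV (energy p)"
  unfolding energy_def
  by (intro continuous_intros continuous_on_powr' continuous_on_grad_norm) auto

lemma energy_scale:
  assumes "p > 1" shows "energy p (\<lambda>x. t * u x) = \<bar>t\<bar> powr p * energy p u"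
proof -
  have "grad_form G (\<lambda>x. t * u x) (\<lambda>x. t * u x) x = t\<^sup>2 * grad_form G u u x" for x
    unfolding grad_form_square sum_distrib_left right_diff_distrib[symmetric]
    by (simp add: power_mult_distrib mult_ac)
  then have "grad_norm G (\<lambda>x. t * u x) x = \<bar>t\<bar> * grad_norm G u x" for x
    by (simp add: grad_norm_def real_sqrt_mult)
  then show ?thesis
    by (simp add: energy_def powr_mult sum_distrib_left mult_ac)
qed

text \<open>Zero energy makes \<open>u\<close> constant across every edge starting in
  \<open>B\<close>. From a vertex with \<open>u x0 \<noteq> 0\<close>, a path to a boundary vertex
  keeps this value, hence stays in \<Omega> throughout, although \<open>u\<close> vanishes at its
  end.\<close>

lemma energy_pos:
  assumes "u \<in> C_c \<Omega>" "u \<noteq> (\<lambda>_. 0)"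
  shows "0 < energy p u"
proof (rule ccontr)
  assume "\<not> 0 < energy p u"
  then have "energy p u = 0" using energy_nonneg[of p u] by simp
  then have "\<forall>x\<in>B. vmeas G x * grad_norm G u x powr p = 0"
    using vmeas_pos finite_B unfolding energy_def
    by (subst (asm) sum_nonneg_eq_0_iff) (auto simp: less_imp_le)
  then have "grad_norm G u x = 0" if "x \<in> B" for x
    using that vmeas_pos[of x] by force
  then have const: "u y = u x" if "x \<in> B" "adj G x y" for x y
    using difference_le_grad_norm[OF that(2), of u] that(1) by simp
  obtain x0 where x0: "u x0 \<noteq> 0" using assms(2) by auto
  obtain z where z: "z \<in> vboundary G \<Omega>" using boundary_nonempty by auto
  have "u y = u x0" if "(adj G)\<^sup>*\<^sup>* x0 y" for y
    using that
  proof (induction rule: rtranclp_induct)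
    case (step y y')
    then have "y \<in> B" using x0 assms(1) by (auto simp: C_c_def B_def)
    then show ?case using const step by simp
  qed simp
  then have "u z = u x0" using connected by blast
  moreover have "u z = 0" using z assms(1) by (simp add: C_c_def vboundary_def)
  ultimately show False using x0 by simp
qed

text \<open>Each of the two gradient powers is paired separately with the edge difference, which the
  gradient at either endpoint bounds; the products remain continuous where a power blows up.\<close>

lemma continuous_on_laplacian:
  assumes "p > 1" shows "continuous_on UNIV (\<lambda>u. graph_laplacian G p u x)"
proof -
  have term1: "continuous_on UNIV (\<lambda>u. grad_norm G u x powr (p - 2) * (u y - u x))" if "adj G x y" for y
    by (rule continuous_on_powr_mult[OF continuous_on_grad_norm _ assms])
      (use difference_le_grad_norm[OF that] in \<open>auto intro!: continuous_intros\<close>)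
  have term2: "continuous_on UNIV (\<lambda>u. grad_norm G u y powr (p - 2) * (u y - u x))" if "adj G x y" for y
    by (rule continuous_on_powr_mult[OF continuous_on_grad_norm _ assms])
      (use difference_le_grad_norm[OF adj_sym[OF that]] in \<open>auto intro!: continuous_intros simp: abs_minus_commute\<close>)
  have eq: "graph_laplacian G p u x = 1 / (2 * vmeas G x) * (\<Sum>y | adj G x y. weight G x y *
      (grad_norm G u y powr (p - 2) * (u y - u x) + grad_norm G u x powr (p - 2) * (u y - u x)))" for u
    unfolding graph_laplacian_def by (simp add: algebra_simps)
  show ?thesis
    unfolding eq by (intro continuous_on_mult continuous_on_const continuous_on_sum continuous_on_add term1 term2) auto
qed

lemma grad_norm_powr_has_derivative:
  assumes "p > 1"
  shows "((\<lambda>s. grad_norm G (\<lambda>x. u x + s * \<phi> x) x powr p) has_real_derivative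
    p * grad_norm G (\<lambda>x. u x + s * \<phi> x) x powr (p - 2) * grad_form G (\<lambda>x. u x + s * \<phi> x) \<phi> x) (at s)"
proof -
  let ?w = "\<lambda>y. weight G x y / (2 * vmeas G x)"
  let ?Q = "\<lambda>s. \<Sum>y | adj G x y. ?w y * ((u y - u x) + s * (\<phi> y - \<phi> x))\<^sup>2"
  have Q: "grad_form G (\<lambda>x. u x + s * \<phi> x) (\<lambda>x. u x + s * \<phi> x) x = ?Q s" for s
    unfolding grad_form_square by (intro sum.cong) (auto simp: algebra_simps)
  have diff: "u y + s * \<phi> y - (u x + s * \<phi> x) = (u y - u x) + s * (\<phi> y - \<phi> x)" for y
    by (simp add: algebra_simps)
  have "grad_form G (\<lambda>x. u x + s * \<phi> x) \<phi> x =
      (\<Sum>y | adj G x y. ?w y * ((u y - u x) + s * (\<phi> y - \<phi> x)) * (\<phi> y - \<phi> x))"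
    unfolding grad_form_def sum_distrib_left diff by simp
  moreover have "((\<lambda>s. ?Q s powr (p / 2)) has_real_derivative
      p * ?Q s powr (p / 2 - 1) * (\<Sum>y | adj G x y. ?w y * ((u y - u x) + s * (\<phi> y - \<phi> x)) * (\<phi> y - \<phi> x))) (at s)"
    using vmeas_pos weight_pos by (intro has_derivative_quadratic_powr locally_finite assms) auto
  ultimately show ?thesis
    by (simp add: grad_norm_powr Q diff_divide_distrib)
qed

text \<open>Summation by parts with the antisymmetric flux \<open>k\<close>. Exchanging
  \<open>x\<close> and \<open>y\<close> in the half containing \<open>\<phi> y\<close> moves the
  test function to \<open>x\<close> and turns the weight \<open>?a x\<close> into
  \<open>?a y\<close>, which yields the two-sided weight of \<open>graph_laplacian\<close>; the
  exponent is \<open>c + 2\<close> because the definition subtracts 2.\<close>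

lemma green_formula:
  assumes "\<phi> \<in> C_c \<Omega>"
  shows "(\<Sum>x\<in>B. vmeas G x * grad_norm G u x powr c * grad_form G u \<phi> x) =
    - (\<Sum>z\<in>\<Omega>. vmeas G z * graph_laplacian G (c + 2) u z * \<phi> z)"
proof -
  define k where "k x y = (if adj G x y then weight G x y * (u y - u x) else 0)" for x y
  let ?a = "\<lambda>x. grad_norm G u x powr c"
  have outside: "\<phi> x = 0" if "x \<notin> \<Omega>" for x
    using assms that by (simp add: C_c_def)
  \<comment> \<open>Lets all neighbour sums run over \<open>B\<close>, so that the double sum can be
    exchanged. An edge to a vertex outside \<open>B\<close> starts outside \<Omega>, and \<phi>
    vanishes at both of its ends.\<close>
  have restrict: "(\<Sum>y | adj G x y. f y) = (\<Sum>y\<in>B. if adj G x y then f y else 0)"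
    if "\<And>y. adj G x y \<Longrightarrow> y \<notin> B \<Longrightarrow> f y = 0" for x and f :: "'v \<Rightarrow> real"
  proof -
    have "(\<Sum>y | adj G x y. f y) = (\<Sum>y\<in>{y. adj G x y} \<inter> B. f y)"
      using that locally_finite by (intro sum.mono_neutral_right) auto
    also have "\<dots> = (\<Sum>y\<in>B. if adj G x y then f y else 0)"
      using sum.inter_restrict[OF finite_B, of f "{y. adj G x y}"] by (simp add: Int_commute)
    finally show ?thesis .
  qed
  have "(\<Sum>x\<in>B. vmeas G x * ?a x * grad_form G u \<phi> x) = (\<Sum>x\<in>B. \<Sum>y\<in>B. ?a x * k x y * (\<phi> y - \<phi> x) / 2)"
  proof (rule sum.cong[OF refl])
    fix x assume "x \<in> B"
    have "(\<Sum>y | adj G x y. weight G x y * (u y - u x) * (\<phi> y - \<phi> x)) =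
        (\<Sum>y\<in>B. if adj G x y then weight G x y * (u y - u x) * (\<phi> y - \<phi> x) else 0)"
    proof (rule restrict)
      fix y assume y: "adj G x y" "y \<notin> B"
      then have "x \<notin> \<Omega>" "y \<notin> \<Omega>" using neighbour_in_B by (auto simp: B_def)
      then show "weight G x y * (u y - u x) * (\<phi> y - \<phi> x) = 0" using outside by simp
    qed
    then have "vmeas G x * ?a x * grad_form G u \<phi> x =
        ?a x / 2 * (\<Sum>y\<in>B. if adj G x y then weight G x y * (u y - u x) * (\<phi> y - \<phi> x) else 0)"
      using vmeas_pos[of x] by (simp add: grad_form_def)
    also have "\<dots> = (\<Sum>y\<in>B. ?a x * k x y * (\<phi> y - \<phi> x) / 2)"
      unfolding sum_distrib_left by (intro sum.cong) (auto simp: k_def)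
    finally show "vmeas G x * ?a x * grad_form G u \<phi> x = (\<Sum>y\<in>B. ?a x * k x y * (\<phi> y - \<phi> x) / 2)" .
  qed
  also have "\<dots> = (\<Sum>x\<in>B. \<Sum>y\<in>B. ?a x * k x y * \<phi> y / 2) - (\<Sum>x\<in>B. \<Sum>y\<in>B. ?a x * k x y * \<phi> x / 2)"
    by (simp add: sum_subtractf[symmetric] right_diff_distrib diff_divide_distrib)
  also have "(\<Sum>x\<in>B. \<Sum>y\<in>B. ?a x * k x y * \<phi> y / 2) = (\<Sum>x\<in>B. \<Sum>y\<in>B. ?a y * k y x * \<phi> x / 2)"
    by (rule sum.swap)
  also have "\<dots> = - (\<Sum>x\<in>B. \<Sum>y\<in>B. ?a y * k x y * \<phi> x / 2)"
  proof -
    have "k y x = - k x y" for x y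
      using adj_sym weight_sym by (auto simp: k_def algebra_simps)
    then have "?a y * k y x * \<phi> x / 2 = - (?a y * k x y * \<phi> x / 2)" for x y
      by (metis minus_divide_left mult_minus_left mult_minus_right)
    then show ?thesis by (simp only: sum_negf)
  qed
  also have "- (\<Sum>x\<in>B. \<Sum>y\<in>B. ?a y * k x y * \<phi> x / 2) - (\<Sum>x\<in>B. \<Sum>y\<in>B. ?a x * k x y * \<phi> x / 2) =
      - (\<Sum>x\<in>B. \<Sum>y\<in>B. (?a y + ?a x) * k x y * \<phi> x / 2)"
    by (simp add: sum.distrib distrib_right add_divide_distrib)
  also have "(\<Sum>x\<in>B. \<Sum>y\<in>B. (?a y + ?a x) * k x y * \<phi> x / 2) =
      (\<Sum>x\<in>\<Omega>. \<Sum>y\<in>B. (?a y + ?a x) * k x y * \<phi> x / 2)"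
    using finite_B outside by (intro sum.mono_neutral_right) (auto simp: B_def)
  also have "\<dots> = (\<Sum>z\<in>\<Omega>. vmeas G z * graph_laplacian G (c + 2) u z * \<phi> z)"
  proof (rule sum.cong[OF refl])
    fix x assume x: "x \<in> \<Omega>"
    have "(\<Sum>y | adj G x y. (?a y + ?a x) * weight G x y * (u y - u x)) =
        (\<Sum>y\<in>B. if adj G x y then (?a y + ?a x) * weight G x y * (u y - u x) else 0)"
      using neighbour_in_B[OF x] by (intro restrict) auto
    also have "\<dots> = (\<Sum>y\<in>B. (?a y + ?a x) * k x y)"
      by (intro sum.cong) (auto simp: k_def)
    finally have "vmeas G x * graph_laplacian G (c + 2) u x = (\<Sum>y\<in>B. (?a y + ?a x) * k x y) / 2"
      using vmeas_pos[of x] by (simp add: graph_laplacian_def)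
    then show "(\<Sum>y\<in>B. (?a y + ?a x) * k x y * \<phi> x / 2) = vmeas G x * graph_laplacian G (c + 2) u x * \<phi> x"
      by (simp add: sum_distrib_right sum_divide_distrib)
  qed
  finally show ?thesis .
qed

lemma energy_has_derivative:
  assumes "p > 1" "\<phi> \<in> C_c \<Omega>"
  shows "((\<lambda>s. energy p (\<lambda>x. u x + s * \<phi> x)) has_real_derivative
    - p * (\<Sum>z\<in>\<Omega>. vmeas G z * graph_laplacian G p (\<lambda>x. u x + s * \<phi> x) z * \<phi> z)) (at s)"
proof -
  let ?u = "\<lambda>x. u x + s * \<phi> x"
  have "((\<lambda>s. energy p (\<lambda>x. u x + s * \<phi> x)) has_real_derivative
      (\<Sum>x\<in>B. vmeas G x * (p * grad_norm G ?u x powr (p - 2) * grad_form G ?u \<phi> x))) (at s)"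
    unfolding energy_def
    by (intro DERIV_sum DERIV_cmult grad_norm_powr_has_derivative assms)
  moreover have "(\<Sum>x\<in>B. vmeas G x * (p * grad_norm G ?u x powr (p - 2) * grad_form G ?u \<phi> x)) =
      p * (\<Sum>x\<in>B. vmeas G x * grad_norm G ?u x powr (p - 2) * grad_form G ?u \<phi> x)"
    by (simp add: sum_distrib_left mult_ac)
  ultimately show ?thesis
    using green_formula[OF assms(2), of ?u "p - 2"] by simp
qed

end

text \<open>Local finiteness makes the set of ends of paths of a given length finite, by induction
  on the length; connectedness makes \<open>graph_dist\<close> an attained length.\<close>

lemma bounded_domain_finite:
  assumes "connected_measured_graph G" "bounded_domain G \<Omega>"
  shows "finite \<Omega>"
proof (cases "\<Omega> = {}")
  case False
  interpret connected_measured_graph G by fact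
  obtain x0 where x0: "x0 \<in> \<Omega>" using False by auto
  obtain D where D: "\<And>y. y \<in> \<Omega> \<Longrightarrow> graph_dist G x0 y \<le> D"
    using assms(2) x0 unfolding bounded_domain_def by blast
  have fin: "finite {y. (adj G ^^ n) x0 y}" for n
  proof (induction n)
    case (Suc n)
    have "{y. (adj G ^^ Suc n) x0 y} = (\<Union>z\<in>{z. (adj G ^^ n) x0 z}. {y. adj G z y})"
      by auto
    then show ?case using Suc locally_finite by simp
  qed simp
  have "(adj G ^^ graph_dist G x0 y) x0 y" for y
  proof -
    have "\<exists>n. (adj G ^^ n) x0 y" using connected by (simp add: rtranclp_power)
    then show ?thesis unfolding graph_dist_def by (rule LeastI_ex)
  qed
  then have "\<Omega> \<subseteq> (\<Union>n\<le>D. {y. (adj G ^^ n) x0 y})" using D by blast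
  then show ?thesis by (rule finite_subset) (use fin in auto)
qed simp

section \<open>Growth of homogeneous functions\<close>

lemma compact_coord_sphere: "compact {x \<in> coord_space N. enorm N x = 1}"
proof -
  have c: "continuous_on S (\<lambda>x. enorm N x)" for S
    by (intro continuous_on_enorm continuous_on_coordinate[OF continuous_on_id])
  have "compact {x \<in> coord_space N. enorm N x \<le> 1}"
    by (rule compact_coord_sublevel[OF c, where R = 1])
  then have "compact {x \<in> {x \<in> coord_space N. enorm N x \<le> 1}. 1 \<le> enorm N x}"
    by (rule compact_Collect_le) (intro continuous_on_const c)+
  moreover have "{x \<in> {x \<in> coord_space N. enorm N x \<le> 1}. 1 \<le> enorm N x} = {x \<in> coord_space N. enorm N x = 1}"
    by auto
  ultimately show ?thesis by simp
qed

text \<open>Reduces estimates of a homogeneous function to the unit sphere, where compactness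
  applies; the origin is the separate first case.\<close>

lemma homogeneous_on_rays:
  assumes hom: "\<And>t x. 0 \<le> t \<Longrightarrow> F (\<lambda>i. t * x i) = t powr q * (F x :: real)"
    and x: "x \<in> coord_space N"
  obtains "x = (\<lambda>_. 0)" "enorm N x = 0" "F x = 0"
  | y where "y \<in> coord_space N" "enorm N y = 1" "F x = enorm N x powr q * F y"
proof (cases "enorm N x = 0")
  case True
  then have "x = (\<lambda>_. 0)"
    using x by (auto simp: enorm_zero_iff coord_space_def fun_eq_iff) (metis not_le)
  \<comment> \<open>Homogeneity with factor 0 forces this, because \<open>0 powr q = 0\<close> for
    every \<open>q\<close>.\<close>
  moreover from this have "F x = 0" using hom[of 0 x] by simp
  ultimately show ?thesis using that(1) True by blast
next
  case False
  then have pos: "0 < enorm N x" using enorm_nonneg[of N x] by linarith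
  let ?y = "\<lambda>i. (1 / enorm N x) * x i"
  have "enorm N ?y = 1" unfolding enorm_scale using pos by simp
  moreover have "?y \<in> coord_space N" using x by (simp add: coord_space_def)
  moreover have "F x = enorm N x powr q * F ?y"
    using hom[of "enorm N x" ?y] pos by simp
  ultimately show ?thesis using that(2) by blast
qed

lemma homogeneous_upper_bound:
  assumes cont: "continuous_on (coord_space N) F"
    and hom: "\<And>t x. 0 \<le> t \<Longrightarrow> F (\<lambda>i. t * x i) = t powr q * (F x :: real)"
  obtains C where "0 \<le> C" "\<And>x. x \<in> coord_space N \<Longrightarrow> \<bar>F x\<bar> \<le> C * enorm N x powr q"
proof -
  let ?S = "{x \<in> coord_space N. enorm N x = 1}"
  have "compact (F ` ?S)"
    by (rule compact_continuous_image[OF continuous_on_subset[OF cont] compact_coord_sphere]) auto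
  then obtain C where C: "\<And>x. x \<in> ?S \<Longrightarrow> \<bar>F x\<bar> \<le> C"
    using compact_imp_bounded[of "F ` ?S"] by (auto simp: bounded_iff)
  show thesis
  proof (rule that[of "\<bar>C\<bar>"])
    fix x :: "nat \<Rightarrow> real" assume x: "x \<in> coord_space N"
    from hom x show "\<bar>F x\<bar> \<le> \<bar>C\<bar> * enorm N x powr q"
    proof (rule homogeneous_on_rays)
      fix y assume y: "y \<in> coord_space N" "enorm N y = 1" "F x = enorm N x powr q * F y"
      have "\<bar>F y\<bar> \<le> \<bar>C\<bar>" using C[of y] y by force
      then show ?thesis
        unfolding y(3) by (simp add: abs_mult mult.commute[of "enorm N x powr q"] mult_right_mono)
    next
      assume "F x = 0"
      then show ?thesis by simp
    qed
  qed simp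
qed

lemma homogeneous_lower_bound:
  assumes cont: "continuous_on (coord_space N) F"
    and hom: "\<And>t x. 0 \<le> t \<Longrightarrow> F (\<lambda>i. t * x i) = t powr q * (F x :: real)"
    and pos: "\<And>x. x \<in> coord_space N \<Longrightarrow> x \<noteq> (\<lambda>_. 0) \<Longrightarrow> 0 < F x"
  obtains c where "0 < c" "\<And>x. x \<in> coord_space N \<Longrightarrow> c * enorm N x powr q \<le> F x"
proof -
  let ?S = "{x \<in> coord_space N. enorm N x = 1}"
  have "continuous_on ?S F" using cont by (rule continuous_on_subset) auto
  moreover have "0 < F x" if "x \<in> ?S" for x
    using that by (intro pos) auto
  ultimately obtain c where c: "c > 0" "\<And>x. x \<in> ?S \<Longrightarrow> c \<le> F x"
    using compact_positive_lower_bound[OF compact_coord_sphere[of N], of F] by blast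
  show thesis
  proof (rule that[OF c(1)])
    fix x :: "nat \<Rightarrow> real" assume x: "x \<in> coord_space N"
    from hom x show "c * enorm N x powr q \<le> F x"
    proof (rule homogeneous_on_rays)
      fix y assume y: "y \<in> coord_space N" "enorm N y = 1" "F x = enorm N x powr q * F y"
      then show ?thesis
        using c(2)[of y] by (simp add: mult.commute[of "enorm N x powr q"] mult_right_mono)
    next
      assume "enorm N x = 0" "F x = 0"
      then show ?thesis by simp
    qed
  qed
qed

lemma dominant_power_bound:
  fixes A C1 C2 c p r :: real
  assumes "A > 0" "C1 \<ge> 0" "C2 \<ge> 0" "1 < r" "r < p"
  obtains R where "\<And>n. 0 \<le> n \<Longrightarrow> A * n powr p - C1 * n powr r - C2 * n powr 1 \<le> c \<Longrightarrow> n \<le> R"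
proof -
  define q where "q = 2 * (C1 + C2) / A"
  \<comment> \<open>Beyond 1 higher powers dominate lower ones; beyond the second bound the terms
    with \<open>C1\<close> and \<open>C2\<close> take at most half of \<open>A * n powr p\<close>;
    beyond the third the other half exceeds \<open>\<bar>c\<bar>\<close>.\<close>
  define R where "R = max 1 (max (q powr (1 / (p - r))) (2 * \<bar>c\<bar> / A))"
  show thesis
  proof (rule that[of R])
    fix n :: real assume n: "0 \<le> n" and le: "A * n powr p - C1 * n powr r - C2 * n powr 1 \<le> c"
    show "n \<le> R"
    proof (rule ccontr)
      assume "\<not> n \<le> R"
      then have nR: "1 < n" "q powr (1 / (p - r)) < n" "2 * \<bar>c\<bar> / A < n"
        by (auto simp: R_def)
      have q: "0 \<le> q" using assms by (simp add: q_def)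
      have "(q powr (1 / (p - r))) powr (p - r) \<le> n powr (p - r)"
        using nR assms by (intro powr_mono2) auto
      then have "q \<le> n powr (p - r)"
        using q assms by (simp add: powr_powr)
      then have "q * n powr r \<le> n powr (p - r) * n powr r"
        by (intro mult_right_mono) auto
      then have "q * n powr r \<le> n powr p"
        by (simp add: powr_add[symmetric])
      then have 1: "(C1 + C2) * n powr r \<le> A / 2 * n powr p"
        using assms(1) by (simp add: q_def field_simps)
      have "n powr 1 \<le> n powr r" "n powr 1 \<le> n powr p"
        using nR assms powr_mono[of 1 r n] powr_mono[of 1 p n] by simp_all
      then have 2: "C2 * n powr 1 \<le> C2 * n powr r" and 3: "A / 2 * n \<le> A / 2 * n powr p"
        using assms nR by (auto intro!: mult_left_mono)
      have 4: "\<bar>c\<bar> < A / 2 * n" using nR(3) assms(1) by (simp add: field_simps)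
      have contra: False if "c1 + c2' \<le> m" "c2 \<le> c2'" "m' \<le> m" "\<bar>c\<bar> < m'" "2 * m - c1 - c2 \<le> c"
        for c1 c2 c2' m m' :: real
        using that by linarith
      show False
        by (rule contra[OF _ 2 3 4]) (use 1 le in \<open>simp_all add: distrib_right\<close>)
    qed
  qed
qed

text \<open>An antiderivative of \<open>kirchhoff a b k\<close> on the half-line; the absolute value
  extends it so that it has a two-sided derivative at 0, the energy of the zero function.\<close>

definition kirchhoff_primitive :: "real \<Rightarrow> real \<Rightarrow> real \<Rightarrow> real \<Rightarrow> real" where
  "kirchhoff_primitive a b k t = (if k = 0 then (a + b) * t else a * t + b / (k + 1) * \<bar>t\<bar> powr (k + 1))"

lemma kirchhoff_primitive_has_derivative:
  assumes "k \<ge> 0" "t \<ge> 0"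
  shows "(kirchhoff_primitive a b k has_real_derivative kirchhoff a b k t) (at t)"
proof (cases "k = 0")
  case True
  then show ?thesis
    unfolding kirchhoff_primitive_def[abs_def] kirchhoff_def by (auto intro!: derivative_eq_intros)
next
  case False
  have "signed_power (k + 1) t = t powr k"
    using assms powr_add[of t "k - 1" 1] by (cases "t = 0") (auto simp: signed_power_def)
  moreover have "((\<lambda>t. a * t + b / (k + 1) * \<bar>t\<bar> powr (k + 1)) has_real_derivative
      a * 1 + b / (k + 1) * ((k + 1) * signed_power (k + 1) t)) (at t)"
    using False assms by (intro DERIV_add DERIV_cmult DERIV_ident has_derivative_abs_powr) auto
  ultimately show ?thesis
    using False assms unfolding kirchhoff_primitive_def[abs_def] kirchhoff_def by simp
qed

lemma continuous_on_kirchhoff_primitive: "k \<ge> 0 \<Longrightarrow> continuous_on S (kirchhoff_primitive a b k)"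
  unfolding kirchhoff_primitive_def[abs_def]
  by (cases "k = 0") (auto intro!: continuous_intros continuous_on_powr')

lemma continuous_on_kirchhoff: "k \<ge> 0 \<Longrightarrow> continuous_on {0..} (kirchhoff a b k)"
  unfolding kirchhoff_def[abs_def]
  by (cases "k = 0") (auto intro!: continuous_intros continuous_on_powr')

lemma kirchhoff_primitive_ge: "k \<ge> 0 \<Longrightarrow> b \<ge> 0 \<Longrightarrow> t \<ge> 0 \<Longrightarrow> a * t \<le> kirchhoff_primitive a b k t"
  by (simp add: kirchhoff_primitive_def distrib_right)

text \<open>At bounded energy the primitive is at most linear, so the Kirchhoff term is of order
  \<open>p\<close> in small \<open>u\<close> and loses against the power \<open>r < p\<close>. The
  added 1 covers \<open>k = 0\<close> and \<open>C = 0\<close>, where \<open>C powr k\<close> is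
  0.\<close>

lemma kirchhoff_primitive_le:
  assumes "k \<ge> 0" "b \<ge> 0" "0 \<le> t" "t \<le> C"
  shows "kirchhoff_primitive a b k t \<le> (a + b * (C powr k + 1)) * t"
proof (cases "k = 0")
  case True
  have "0 \<le> b * C powr 0 * t" using assms by simp
  then show ?thesis using True by (simp add: kirchhoff_primitive_def algebra_simps)
next
  case False
  have "t powr (k + 1) = t powr k * t"
    using assms powr_add[of t k 1] by simp
  also have "\<dots> \<le> C powr k * t"
    using assms by (intro mult_right_mono powr_mono2) auto
  finally have "b / (k + 1) * t powr (k + 1) \<le> b / (k + 1) * (C powr k * t)"
    using assms by (intro mult_left_mono) auto
  also have "\<dots> \<le> b * (C powr k * t)"
    using assms by (intro mult_right_mono) (auto simp: field_simps)
  also have "\<dots> \<le> b * (C powr k + 1) * t"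
    using assms by (simp add: algebra_simps)
  finally show ?thesis using False assms by (simp add: kirchhoff_primitive_def algebra_simps)
qed

lemma continuous_on_signed_power:
  assumes "s > 1" shows "continuous_on S (signed_power s)"
  unfolding signed_power_def[abs_def]
  by (rule continuous_on_powr_mult[where C = 1]) (use assms in \<open>auto intro!: continuous_intros\<close>)

text \<open>The scalar problem that remains when one component of the system is zero; it serves both
  equations, with \<open>(p, h1, g1)\<close> and with \<open>(q, h3, g2)\<close>.\<close>

locale kirchhoff_problem = dirichlet_domain G \<Omega> for G :: "'v measured_graph" (structure) and \<Omega> +
  fixes p r k a b lam :: real and h f :: "'v \<Rightarrow> real" and e :: "nat \<Rightarrow> 'v"
  assumes r: "1 < r" "r < p" and k: "0 \<le> k" and ab: "0 < a" "0 < b" and lam: "0 < lam"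
    and h: "\<And>x. x \<in> \<Omega> \<Longrightarrow> 0 < h x"
    and e: "bij_betw e {..<card \<Omega>} \<Omega>"
begin

abbreviation N where "N \<equiv> card \<Omega>"

lemma p: "1 < p"
  using r by simp

text \<open>The gradient of \<open>J\<close> in the inner product weighted by
  \<open>vmeas G\<close>; its zeros on \<Omega> solve the scalar equation.\<close>

definition residual where
  "residual u z = - kirchhoff a b k (energy p u) * graph_laplacian G p u z
    - lam * h z * signed_power r (u z) - f z"

definition power_part where
  "power_part u = (\<Sum>z\<in>\<Omega>. vmeas G z * lam * h z * (\<bar>u z\<bar> powr r / r))"

definition linear_part where "linear_part u = (\<Sum>z\<in>\<Omega>. vmeas G z * f z * u z)"

definition J where
  "J u = kirchhoff_primitive a b k (energy p u) / p - power_part u - linear_part u"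

lemma J_has_derivative:
  assumes "\<phi> \<in> C_c \<Omega>"
  shows "((\<lambda>s. J (\<lambda>x. u x + s * \<phi> x)) has_real_derivative
    (\<Sum>z\<in>\<Omega>. vmeas G z * residual (\<lambda>x. u x + s * \<phi> x) z * \<phi> z)) (at s)"
proof -
  let ?u = "\<lambda>s x. u x + s * \<phi> x"
  let ?L = "\<Sum>z\<in>\<Omega>. vmeas G z * graph_laplacian G p (?u s) z * \<phi> z"
  have 1: "((\<lambda>s. kirchhoff_primitive a b k (energy p (?u s))) has_real_derivative
      kirchhoff a b k (energy p (?u s)) * (- p * ?L)) (at s)"
    by (rule DERIV_chain2[OF kirchhoff_primitive_has_derivative energy_has_derivative])
      (use k p assms in auto)
  have 2: "((\<lambda>s. power_part (?u s)) has_real_derivative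
      (\<Sum>z\<in>\<Omega>. vmeas G z * lam * h z * (r * signed_power r (?u s z) * \<phi> z / r))) (at s)"
    unfolding power_part_def
    by (intro DERIV_sum DERIV_cmult DERIV_cdivide DERIV_chain2[OF has_derivative_abs_powr])
      (use r in \<open>auto intro!: derivative_eq_intros\<close>)
  have 3: "((\<lambda>s. linear_part (?u s)) has_real_derivative (\<Sum>z\<in>\<Omega>. vmeas G z * f z * \<phi> z)) (at s)"
    unfolding linear_part_def by (auto intro!: derivative_eq_intros sum.cong simp: mult_ac)
  have "((\<lambda>s. J (?u s)) has_real_derivative kirchhoff a b k (energy p (?u s)) * (- p * ?L) / p
      - (\<Sum>z\<in>\<Omega>. vmeas G z * lam * h z * (r * signed_power r (?u s z) * \<phi> z / r))
      - (\<Sum>z\<in>\<Omega>. vmeas G z * f z * \<phi> z)) (at s)"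
    unfolding J_def by (intro DERIV_diff DERIV_cdivide 1 2 3)
  moreover have "kirchhoff a b k (energy p (?u s)) * (- p * ?L) / p
      - (\<Sum>z\<in>\<Omega>. vmeas G z * lam * h z * (r * signed_power r (?u s z) * \<phi> z / r))
      - (\<Sum>z\<in>\<Omega>. vmeas G z * f z * \<phi> z) = (\<Sum>z\<in>\<Omega>. vmeas G z * residual (?u s) z * \<phi> z)"
  proof -
    have "kirchhoff a b k (energy p (?u s)) * (- p * ?L) / p = - kirchhoff a b k (energy p (?u s)) * ?L"
      using p by simp
    also have "\<dots> = (\<Sum>z\<in>\<Omega>. - kirchhoff a b k (energy p (?u s)) * (vmeas G z * graph_laplacian G p (?u s) z * \<phi> z))"
      by (rule sum_distrib_left)
    finally have "kirchhoff a b k (energy p (?u s)) * (- p * ?L) / p = \<dots>" .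
    then show ?thesis
      using r unfolding residual_def
      by (simp only: sum_subtractf[symmetric]) (auto intro!: sum.cong simp: algebra_simps)
  qed
  ultimately show ?thesis by simp
qed

lemma continuous_on_vertex: "continuous_on S (\<lambda>u :: 'v \<Rightarrow> real. u z)"
  by (rule continuous_on_subset[OF continuous_on_product_coordinates]) simp

lemma continuous_on_power_part: "continuous_on UNIV power_part"
  unfolding power_part_def[abs_def] using r
  by (intro continuous_on_sum continuous_on_mult continuous_on_const continuous_on_divide
      continuous_on_powr' continuous_on_rabs continuous_on_vertex) auto

lemma continuous_on_linear_part: "continuous_on UNIV linear_part"
  unfolding linear_part_def[abs_def]
  by (intro continuous_on_sum continuous_on_mult continuous_on_const continuous_on_vertex)

lemma continuous_on_J: "continuous_on UNIV J"
proof -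
  have "continuous_on UNIV (\<lambda>u. kirchhoff_primitive a b k (energy p u))"
    by (rule continuous_on_compose2[OF continuous_on_kirchhoff_primitive[OF k, of UNIV] continuous_on_energy[OF p]]) auto
  then show ?thesis
    unfolding J_def[abs_def] using p
    by (intro continuous_on_diff continuous_on_divide continuous_on_const
        continuous_on_power_part continuous_on_linear_part) auto
qed

lemma continuous_on_residual: "continuous_on UNIV (\<lambda>u. residual u z)"
proof -
  have 1: "continuous_on UNIV (\<lambda>u. kirchhoff a b k (energy p u))"
    by (rule continuous_on_compose2[OF continuous_on_kirchhoff[OF k] continuous_on_energy[OF p]]) auto
  have 2: "continuous_on UNIV (\<lambda>u :: 'v \<Rightarrow> real. signed_power r (u z))"
    by (rule continuous_on_compose2[OF continuous_on_signed_power[OF r(1), of UNIV] continuous_on_vertex]) auto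
  show ?thesis
    unfolding residual_def
    by (intro continuous_on_diff continuous_on_mult continuous_on_minus continuous_on_const
        continuous_on_laplacian 1 2 p)
qed

definition emb :: "(nat \<Rightarrow> real) \<Rightarrow> 'v \<Rightarrow> real" where
  "emb x = (\<lambda>v. if v \<in> \<Omega> then x (inv_into {..<N} e v) else 0)"

lemma emb_C_c [simp]: "emb x \<in> C_c \<Omega>"
  by (simp add: emb_def C_c_def)

lemma emb_e: "i < N \<Longrightarrow> emb x (e i) = x i"
  using e by (auto simp: emb_def bij_betw_def)

lemma emb_add: "emb (\<lambda>i. x i + s * w i) = (\<lambda>v. emb x v + s * emb w v)"
  by (auto simp: emb_def)

lemma emb_scale: "emb (\<lambda>i. t * x i) = (\<lambda>v. t * emb x v)"
  by (auto simp: emb_def)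

lemma emb_uminus: "emb (\<lambda>i. - x i) = (\<lambda>v. - emb x v)"
  by (auto simp: emb_def)

lemma emb_0: "emb (\<lambda>_. 0) = (\<lambda>_. 0)"
  by (auto simp: emb_def)

lemma inj_on_emb: "inj_on emb (coord_space N)"
proof (rule inj_onI)
  fix x y assume xy: "x \<in> coord_space N" "y \<in> coord_space N" "emb x = emb y"
  show "x = y"
  proof
    fix i show "x i = y i"
      using xy emb_e[of i x] emb_e[of i y] by (cases "i < N") (auto simp: coord_space_def)
  qed
qed

lemma emb_nonzero: "x \<in> coord_space N \<Longrightarrow> x \<noteq> (\<lambda>_. 0) \<Longrightarrow> emb x \<noteq> (\<lambda>_. 0)"
  using inj_onD[OF inj_on_emb, of x "\<lambda>_. 0"] emb_0 by (auto simp: coord_space_def)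

lemma continuous_on_emb: "continuous_on S emb"
proof (rule continuous_on_coordinatewise_then_product)
  fix v
  show "continuous_on S (\<lambda>x. emb x v)"
    using continuous_on_coordinate[OF continuous_on_id, of S]
    by (cases "v \<in> \<Omega>") (simp_all add: emb_def)
qed

lemma continuous_on_emb_compose: "continuous_on UNIV F \<Longrightarrow> continuous_on S (\<lambda>x. F (emb x) :: real)"
  using continuous_on_compose2[OF _ continuous_on_emb] by blast

text \<open>The factor \<open>vmeas G (e i)\<close> converts the weighted gradient into the
  coordinate gradient; the value 0 from \<open>N\<close> on makes oddness hold for every
  index.\<close>

definition g :: "(nat \<Rightarrow> real) \<Rightarrow> nat \<Rightarrow> real" where
  "g x i = (if i < N then vmeas G (e i) * residual (emb x) (e i) else 0)"

lemma g_zero_iff: "(\<forall>i<N. g x i = 0) \<longleftrightarrow> (\<forall>z\<in>\<Omega>. residual (emb x) z = 0)"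
proof -
  have "\<Omega> = e ` {..<N}" using e by (simp add: bij_betw_def)
  then have "(\<forall>z\<in>\<Omega>. residual (emb x) z = 0) \<longleftrightarrow> (\<forall>i<N. residual (emb x) (e i) = 0)"
    by (metis (no_types, lifting) imageE imageI lessThan_iff)
  moreover have "g x i = 0 \<longleftrightarrow> residual (emb x) (e i) = 0" if "i < N" for i
    using vmeas_pos[of "e i"] that by (simp add: g_def)
  ultimately show ?thesis by simp
qed

lemma J_emb_has_derivative:
  "((\<lambda>s. J (emb (\<lambda>i. x i + s * w i))) has_real_derivative
    (\<Sum>i<N. g (\<lambda>i. x i + s * w i) i * w i)) (at s)"
proof -
  have "((\<lambda>s. J (\<lambda>v. emb x v + s * emb w v)) has_real_derivative
      (\<Sum>z\<in>\<Omega>. vmeas G z * residual (\<lambda>v. emb x v + s * emb w v) z * emb w z)) (at s)"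
    by (rule J_has_derivative) simp
  moreover have "(\<Sum>z\<in>\<Omega>. vmeas G z * residual (\<lambda>v. emb x v + s * emb w v) z * emb w z) =
      (\<Sum>i<N. g (\<lambda>i. x i + s * w i) i * w i)"
    unfolding sum.reindex_bij_betw[OF e, symmetric] by (rule sum.cong) (auto simp: g_def emb_add emb_e)
  ultimately show ?thesis by (simp add: emb_add)
qed

lemma energy_emb_scale: "0 \<le> t \<Longrightarrow> energy p (emb (\<lambda>i. t * x i)) = t powr p * energy p (emb x)"
  unfolding emb_scale by (subst energy_scale[OF p]) simp

lemma power_part_emb_scale: "0 \<le> t \<Longrightarrow> power_part (emb (\<lambda>i. t * x i)) = t powr r * power_part (emb x)"
  by (simp add: power_part_def emb_scale abs_mult powr_mult sum_distrib_left mult_ac)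

lemma linear_part_emb_scale: "0 \<le> t \<Longrightarrow> linear_part (emb (\<lambda>i. t * x i)) = t powr 1 * linear_part (emb x)"
  by (simp add: linear_part_def emb_scale sum_distrib_left mult_ac)

text \<open>The primitive is at least \<open>a\<close> times the energy, which is positive and
  homogeneous of degree \<open>p\<close>; the other two parts have degrees \<open>r < p\<close> and
  \<open>1 < p\<close>.\<close>

lemma coercive: "\<exists>R. \<forall>x\<in>coord_space N. J (emb x) \<le> c \<longrightarrow> enorm N x \<le> R"
proof -
  obtain A where A: "A > 0" "\<And>x. x \<in> coord_space N \<Longrightarrow> A * enorm N x powr p \<le> energy p (emb x)"
  proof (rule homogeneous_lower_bound)
    show "continuous_on (coord_space N) (\<lambda>x. energy p (emb x))"
      by (rule continuous_on_emb_compose[OF continuous_on_energy[OF p]])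
    show "0 < energy p (emb x)" if "x \<in> coord_space N" "x \<noteq> (\<lambda>_. 0)" for x
      by (rule energy_pos[OF emb_C_c emb_nonzero[OF that]])
  qed (auto intro: energy_emb_scale)
  obtain C1 where C1: "C1 \<ge> 0" "\<And>x. x \<in> coord_space N \<Longrightarrow> \<bar>power_part (emb x)\<bar> \<le> C1 * enorm N x powr r"
    by (rule homogeneous_upper_bound[where N = N, OF continuous_on_emb_compose[OF continuous_on_power_part]
          power_part_emb_scale]) (assumption, rule that)
  obtain C2 where C2: "C2 \<ge> 0" "\<And>x. x \<in> coord_space N \<Longrightarrow> \<bar>linear_part (emb x)\<bar> \<le> C2 * enorm N x powr 1"
    by (rule homogeneous_upper_bound[where N = N, OF continuous_on_emb_compose[OF continuous_on_linear_part]
          linear_part_emb_scale]) (assumption, rule that)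
  have "0 < a * A / p" using A(1) ab p by simp
  from dominant_power_bound[OF this C1(1) C2(1) r] obtain R where R:
    "\<And>n. 0 \<le> n \<Longrightarrow> a * A / p * n powr p - C1 * n powr r - C2 * n powr 1 \<le> c \<Longrightarrow> n \<le> R"
    by blast
  have "enorm N x \<le> R" if x: "x \<in> coord_space N" and le: "J (emb x) \<le> c" for x
  proof (rule R[OF enorm_nonneg])
    have "a * (A * enorm N x powr p) \<le> a * energy p (emb x)"
      using A(2)[OF x] ab by (intro mult_left_mono) auto
    also have "\<dots> \<le> kirchhoff_primitive a b k (energy p (emb x))"
      using k ab by (intro kirchhoff_primitive_ge) auto
    finally have "a * A / p * enorm N x powr p \<le> kirchhoff_primitive a b k (energy p (emb x)) / p"
      using p by (simp add: divide_right_mono mult_ac)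
    moreover have "power_part (emb x) \<le> C1 * enorm N x powr r" "linear_part (emb x) \<le> C2 * enorm N x powr 1"
      using order_trans[OF abs_ge_self C1(2)[OF x]] order_trans[OF abs_ge_self C2(2)[OF x]] by auto
    ultimately show "a * A / p * enorm N x powr p - C1 * enorm N x powr r - C2 * enorm N x powr 1 \<le> c"
      using le unfolding J_def by linarith
  qed
  then show ?thesis by blast
qed

lemma critical_point_exists: "\<exists>u\<in>C_c \<Omega>. \<forall>z\<in>\<Omega>. residual u z = 0"
proof -
  let ?S = "{x \<in> coord_space N. J (emb x) \<le> J (emb (\<lambda>_. 0))}"
  have cont: "continuous_on (coord_space N) (\<lambda>x. J (emb x))"
    by (rule continuous_on_emb_compose[OF continuous_on_J])
  obtain R where "\<And>x. x \<in> coord_space N \<Longrightarrow> J (emb x) \<le> J (emb (\<lambda>_. 0)) \<Longrightarrow> enorm N x \<le> R"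
    using coercive by blast
  then have "compact ?S"
    by (rule compact_coord_sublevel[OF cont])
  moreover have zero: "(\<lambda>_. 0) \<in> ?S" by (simp add: coord_space_def)
  moreover have "continuous_on ?S (\<lambda>x. J (emb x))"
    using cont by (rule continuous_on_subset) auto
  ultimately obtain x where x: "x \<in> ?S" "\<And>y. y \<in> ?S \<Longrightarrow> J (emb x) \<le> J (emb y)"
    using continuous_attains_inf[of ?S "\<lambda>x. J (emb x)"] by blast
  \<comment> \<open>Outside \<open>?S\<close> the functional exceeds its value at 0, so the minimum
    over the compact set is global.\<close>
  have min: "J (emb x) \<le> J (emb y)" if "y \<in> coord_space N" for y
    using x that by (cases "J (emb y) \<le> J (emb (\<lambda>_. 0))") auto
  have "g x i = 0" if "i < N" for i
  proof -
    let ?w = "\<lambda>j. if j = i then 1 else (0 :: real)"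
    have "((\<lambda>s. J (emb (\<lambda>j. x j + s * ?w j))) has_real_derivative
        (\<Sum>j<N. g (\<lambda>j. x j + 0 * ?w j) j * ?w j)) (at 0)"
      by (rule J_emb_has_derivative)
    moreover have "\<forall>s. \<bar>0 - s\<bar> < 1 \<longrightarrow> J (emb (\<lambda>j. x j + 0 * ?w j)) \<le> J (emb (\<lambda>j. x j + s * ?w j))"
      using x(1) that by (auto intro!: min simp: coord_space_def)
    ultimately have "(\<Sum>j<N. g (\<lambda>j. x j + 0 * ?w j) j * ?w j) = 0"
      using DERIV_local_min zero_less_one by blast
    moreover have "(\<Sum>j<N. g x j * ?w j) = (\<Sum>j<N. if j = i then g x j else 0)"
      by (rule sum.cong) auto
    ultimately show ?thesis using that by simp
  qed
  then show ?thesis using g_zero_iff[of x] by (intro bexI[of _ "emb x"]) auto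
qed

lemma many_critical_points:
  assumes f: "\<And>z. z \<in> \<Omega> \<Longrightarrow> f z = 0"
  obtains U where "finite U" "card U = N"
    "\<And>u. u \<in> U \<Longrightarrow> u \<in> C_c \<Omega> \<and> u \<noteq> (\<lambda>_. 0) \<and> (\<forall>z\<in>\<Omega>. residual u z = 0)"
proof -
  obtain C where C: "C \<ge> 0" "\<And>x. x \<in> coord_space N \<Longrightarrow> \<bar>energy p (emb x)\<bar> \<le> C * enorm N x powr p"
    by (rule homogeneous_upper_bound[where N = N, OF continuous_on_emb_compose[OF continuous_on_energy[OF p]]
          energy_emb_scale]) (assumption, rule that)
  obtain c where c: "c > 0" "\<And>x. x \<in> coord_space N \<Longrightarrow> c * enorm N x powr r \<le> power_part (emb x)"
  proof (rule homogeneous_lower_bound)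
    show "continuous_on (coord_space N) (\<lambda>x. power_part (emb x))"
      by (rule continuous_on_emb_compose[OF continuous_on_power_part])
    show "0 < power_part (emb x)" if x: "x \<in> coord_space N" "x \<noteq> (\<lambda>_. 0)" for x
    proof -
      obtain z where z: "emb x z \<noteq> 0" using emb_nonzero[OF x] by auto
      then have "z \<in> \<Omega>" by (auto simp: emb_def split: if_splits)
      then show ?thesis
        unfolding power_part_def using z r lam h vmeas_pos
        by (intro sum_pos2[OF domain_finite]) (auto simp: less_imp_le)
    qed
  qed (auto intro: power_part_emb_scale)
  have lin0: "linear_part u = 0" for u
    unfolding linear_part_def using f by simp
  \<comment> \<open>For radius \<rho> \<le> 1 the energy on the sphere stays below \<open>C\<close>;
    there \<open>kirchhoff_primitive_le\<close> bounds the Kirchhoff term by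
    \<open>D * \<rho> powr p\<close>.\<close>
  define D where "D = (a + b * (C powr k + 1)) * C / p"
  have "D \<ge> 0" using ab C(1) p by (simp add: D_def)
  \<comment> \<open>Chosen to give \<open>\<rho> powr (p - r) \<le> c / (2 * (D + 1))\<close>, hence
    \<open>D * \<rho> powr p < c * \<rho> powr r\<close>. The summand 1 keeps the quotient
    meaningful when \<open>D = 0\<close>.\<close>
  define \<rho> where "\<rho> = min 1 ((c / (2 * (D + 1))) powr (1 / (p - r)))"
  have \<rho>: "0 < \<rho>" "\<rho> \<le> 1" using c(1) \<open>D \<ge> 0\<close> by (auto simp: \<rho>_def)
  have "\<rho> powr (p - r) \<le> ((c / (2 * (D + 1))) powr (1 / (p - r))) powr (p - r)"
    using \<rho> r by (intro powr_mono2) (auto simp: \<rho>_def)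
  then have \<rho>': "\<rho> powr (p - r) \<le> c / (2 * (D + 1))"
    using r c(1) \<open>D \<ge> 0\<close> by (simp add: powr_powr)
  define M where "M = D * \<rho> powr p - c * \<rho> powr r"
  have "M < 0"
  proof -
    have "D * \<rho> powr (p - r) \<le> D * (c / (2 * (D + 1)))"
      using \<rho>' \<open>D \<ge> 0\<close> by (intro mult_left_mono) auto
    also have "\<dots> < c" using c(1) \<open>D \<ge> 0\<close> by (simp add: field_simps) (smt (verit) mult_nonneg_nonneg)
    finally have "D * \<rho> powr (p - r) * \<rho> powr r < c * \<rho> powr r"
      using \<rho> by (intro mult_strict_right_mono) auto
    then show ?thesis by (simp add: M_def mult.assoc powr_add[symmetric])
  qed
  interpret even_functional N "\<lambda>x. J (emb x)" g \<rho> M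
  proof
    show "continuous_on (coord_space N) (\<lambda>x. J (emb x))"
      by (rule continuous_on_emb_compose[OF continuous_on_J])
    show "continuous_on (coord_space N) (\<lambda>x. g x i)" if "i < N" for i
      using continuous_on_mult[OF continuous_on_const continuous_on_emb_compose[OF continuous_on_residual]] that
      by (simp add: g_def)
    show "((\<lambda>s. J (emb (\<lambda>i. x i + s * w i))) has_real_derivative
        (\<Sum>i<N. g (\<lambda>i. x i + s * w i) i * w i)) (at s)" for x w s
      by (rule J_emb_has_derivative)
    have energy_even: "energy p (\<lambda>v. - u v) = energy p u" for u
      using energy_scale[OF p, of "-1" u] by simp
    show "J (emb (\<lambda>i. - x i)) = J (emb x)" for x
      by (simp add: emb_uminus J_def energy_even lin0 power_part_def)
    have laplacian_odd: "graph_laplacian G p (\<lambda>v. - u v) z = - graph_laplacian G p u z" for u z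
    proof -
      have "grad_norm G (\<lambda>v. - u v) x = grad_norm G u x" for x
        by (simp add: grad_norm_def grad_form_square power2_commute)
      then have "graph_laplacian G p (\<lambda>v. - u v) z = 1 / (2 * vmeas G z) * (\<Sum>y | adj G z y.
          - ((grad_norm G u y powr (p - 2) + grad_norm G u z powr (p - 2)) * weight G z y * (u y - u z)))"
        unfolding graph_laplacian_def by (simp add: algebra_simps)
      then show ?thesis unfolding graph_laplacian_def sum_negf by simp
    qed
    have "residual (\<lambda>v. - u v) z = - residual u z" if "z \<in> \<Omega>" for u z
      using f[OF that] by (simp add: residual_def laplacian_odd energy_even signed_power_def)
    moreover have "e i \<in> \<Omega>" if "i < N" for i
      using e that by (auto simp: bij_betw_def)
    ultimately show "g (\<lambda>i. - x i) i = - g x i" for x i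
      by (simp add: g_def emb_uminus)
    show "\<exists>R. \<forall>x\<in>coord_space N. J (emb x) \<le> M \<longrightarrow> enorm N x \<le> R"
      by (rule coercive)
    show "0 < \<rho>" by (rule \<rho>)
    show "M < J (emb (\<lambda>_. 0))"
    proof -
      have "energy p (\<lambda>_. 0) = 0"
        using energy_scale[OF p, of 0 "\<lambda>_. 0"] by simp
      then have "J (\<lambda>_. 0) = 0"
        by (simp add: J_def lin0 power_part_def kirchhoff_primitive_def)
      then show ?thesis using \<open>M < 0\<close> by (simp add: emb_0)
    qed
    show "J (emb x) \<le> M" if x: "x \<in> coord_space N" "enorm N x = \<rho>" for x
    proof -
      have E: "energy p (emb x) \<le> C * \<rho> powr p"
        using C(2)[OF x(1)] x(2) energy_nonneg[of p "emb x"] by simp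
      also have "\<dots> \<le> C * 1"
        using \<rho> C(1) p powr_mono2[of p \<rho> 1] by (intro mult_left_mono) auto
      finally have EC: "energy p (emb x) \<le> C" by simp
      have "kirchhoff_primitive a b k (energy p (emb x)) \<le> (a + b * (C powr k + 1)) * energy p (emb x)"
        using k ab EC by (intro kirchhoff_primitive_le) auto
      also have "\<dots> \<le> (a + b * (C powr k + 1)) * (C * \<rho> powr p)"
        using E ab by (intro mult_left_mono) auto
      finally have "kirchhoff_primitive a b k (energy p (emb x)) / p \<le> D * \<rho> powr p"
        using p by (simp add: D_def divide_right_mono mult_ac)
      moreover have "c * \<rho> powr r \<le> power_part (emb x)" using c(2)[OF x(1)] x(2) by simp
      ultimately show ?thesis by (simp add: J_def lin0 M_def)
    qed
  qed
  \<comment> \<open>The critical set may be infinite; a subset with exactly \<open>N\<close>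
    elements is selected.\<close>
  have "\<exists>K'\<subseteq>K. finite K' \<and> card K' = N"
    using many_critical_points infinite_arbitrarily_large obtain_subset_with_card_n by metis
  then obtain K' where K': "K' \<subseteq> K" "finite K'" "card K' = N" by blast
  have sub: "K' \<subseteq> coord_space N" using K'(1) by (auto simp: K_def)
  show thesis
  proof (rule that[of "emb ` K'"])
    show "card (emb ` K') = N"
      using K'(3) card_image[OF inj_on_subset[OF inj_on_emb sub]] by simp
    fix u assume "u \<in> emb ` K'"
    then obtain x where x: "u = emb x" "x \<in> K" using K'(1) by blast
    then show "u \<in> C_c \<Omega> \<and> u \<noteq> (\<lambda>_. 0) \<and> (\<forall>z\<in>\<Omega>. residual u z = 0)"
      using emb_nonzero g_zero_iff[of x] by (auto simp: K_def)
  qed (use K' in simp)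
qed

end

section \<open>Semi-trivial solutions\<close>

context kirchhoff_problem
begin

lemma residual_eq_0_iff:
  "residual u z = 0 \<longleftrightarrow> - kirchhoff a b k (W0_norm G p \<Omega> u powr p) * graph_laplacian G p u z =
    lam * h z * signed_power r (u z) + f z"
  by (auto simp: residual_def W0_norm_powr[OF p])

lemma residual_0: "residual (\<lambda>_. 0) z = - f z"
  by (simp add: residual_def graph_laplacian_def signed_power_def)

lemma nonzero_critical_point:
  assumes "\<exists>x\<in>\<Omega>. f x \<noteq> 0"
  obtains u where "u \<in> C_c \<Omega>" "u \<noteq> (\<lambda>_. 0)" "\<forall>z\<in>\<Omega>. residual u z = 0"
proof -
  obtain u where "u \<in> C_c \<Omega>" and u: "\<forall>z\<in>\<Omega>. residual u z = 0"
    using critical_point_exists by blast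
  moreover have "u \<noteq> (\<lambda>_. 0)"
  proof
    assume "u = (\<lambda>_. 0)"
    with u assms residual_0 show False by force
  qed
  ultimately show thesis using that by blast
qed

lemma enumerated_critical_points:
  assumes "\<And>z. z \<in> \<Omega> \<Longrightarrow> f z = 0"
  obtains w :: "nat \<Rightarrow> 'v \<Rightarrow> real" where "inj_on w {1..card \<Omega>}"
    "\<And>j. j \<in> {1..card \<Omega>} \<Longrightarrow>
      w j \<in> C_c \<Omega> \<and> w j \<noteq> (\<lambda>_. 0) \<and> (\<forall>z\<in>\<Omega>. residual (w j) z = 0)"
proof -
  obtain U where U: "finite U" "card U = card \<Omega>"
    "\<And>u. u \<in> U \<Longrightarrow> u \<in> C_c \<Omega> \<and> u \<noteq> (\<lambda>_. 0) \<and> (\<forall>z\<in>\<Omega>. residual u z = 0)"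
    using many_critical_points[OF assms] by blast
  obtain w where w: "bij_betw w {1..card U} U"
    using ex_bij_betw_nat_finite_1[OF U(1)] by blast
  show thesis
  proof (rule that[of w])
    show "inj_on w {1..card \<Omega>}" using w U(2) by (simp add: bij_betw_def)
    fix j assume "j \<in> {1..card \<Omega>}"
    then have "w j \<in> U" using w U(2) by (auto simp: bij_betw_def)
    then show "w j \<in> C_c \<Omega> \<and> w j \<noteq> (\<lambda>_. 0) \<and> (\<forall>z\<in>\<Omega>. residual (w j) z = 0)" by (rule U(3))
  qed
qed

end

lemma graph_laplacian_0: "graph_laplacian G l (\<lambda>_. 0) x = 0"
  by (simp add: graph_laplacian_def)

text \<open>At \<open>v = 0\<close> both coupling terms vanish: the first equation becomes scalar
  and the second reads \<open>0 = g2 x\<close>.\<close>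

lemma semi_trivial_fst:
  assumes "u \<in> C_c \<Omega>" "u \<noteq> (\<lambda>_. 0)" "\<beta> > 0" "\<And>x. x \<in> \<Omega> \<Longrightarrow> g2 x = 0"
    and "\<And>x. x \<in> \<Omega> \<Longrightarrow> - M1 (W0_norm G p \<Omega> u powr p) * graph_laplacian G p u x =
      lam1 * h1 x * signed_power r (u x) + g1 x"
  shows "(u, \<lambda>_. 0) \<in> semi_trivial (solutions G \<Omega> p q r \<alpha> \<beta> M1 M2 h1 h2 h3 g1 g2 lam1 lam2)"
  using assms by (auto simp: semi_trivial_def solutions_def W0_def C_c_def graph_laplacian_0
      signed_power_def vboundary_def)

lemma semi_trivial_snd:
  assumes "v \<in> C_c \<Omega>" "v \<noteq> (\<lambda>_. 0)" "\<alpha> > 0" "\<And>x. x \<in> \<Omega> \<Longrightarrow> g1 x = 0"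
    and "\<And>x. x \<in> \<Omega> \<Longrightarrow> - M2 (W0_norm G q \<Omega> v powr q) * graph_laplacian G q v x =
      lam2 * h3 x * signed_power r (v x) + g2 x"
  shows "(\<lambda>_. 0, v) \<in> semi_trivial (solutions G \<Omega> p q r \<alpha> \<beta> M1 M2 h1 h2 h3 g1 g2 lam1 lam2)"
  using assms by (auto simp: semi_trivial_def solutions_def W0_def C_c_def graph_laplacian_0
      signed_power_def vboundary_def)

theorem theorem1p3:
  fixes G :: "'v measured_graph" and \<Omega> :: "'v set"
    and p q r k \<alpha> \<beta> lam1 lam2 a1 a2 b1 b2 :: real
    and M1 M2 :: "real \<Rightarrow> real"
    and h1 h2 h3 g1 g2 :: "'v \<Rightarrow> real"
  assumes "connected_measured_graph G"
    and "bounded_domain G \<Omega>" and "vinterior G \<Omega> \<noteq> {}" and "vboundary G \<Omega> \<noteq> {}"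
    and "p > 1" and "q > 1" and "r > 1"
    and "lam1 > 0" and "lam2 > 0" and "\<alpha> > 0" and "\<beta> > 0" and "k \<ge> 0"
    and "r < min p q" and "min p q \<le> (k + 1) * max p q" and "(k + 1) * max p q < \<alpha> + \<beta>"
    and "a1 > 0" and "b1 > 0" and "a2 > 0" and "b2 > 0"
    and "M1 = kirchhoff a1 b1 k" and "M2 = kirchhoff a2 b2 k"
    and "\<forall>x\<in>\<Omega>. h1 x > 0" and "\<forall>x\<in>\<Omega>. h2 x > 0" and "\<forall>x\<in>\<Omega>. h3 x > 0"
  shows
    "((\<exists>x\<in>\<Omega>. g1 x \<noteq> 0) \<and> (\<forall>x\<in>\<Omega>. g2 x = 0) \<longrightarrow>
       (\<exists>u0. (u0, \<lambda>_. 0) \<in>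
          semi_trivial (solutions G \<Omega> p q r \<alpha> \<beta> M1 M2 h1 h2 h3 g1 g2 lam1 lam2)))
     \<and>
     ((\<exists>x\<in>\<Omega>. g2 x \<noteq> 0) \<and> (\<forall>x\<in>\<Omega>. g1 x = 0) \<longrightarrow>
       (\<exists>v0. (\<lambda>_. 0, v0) \<in>
          semi_trivial (solutions G \<Omega> p q r \<alpha> \<beta> M1 M2 h1 h2 h3 g1 g2 lam1 lam2)))
     \<and>
     ((\<forall>x\<in>\<Omega>. g1 x = 0) \<and> (\<forall>x\<in>\<Omega>. g2 x = 0) \<longrightarrow>
       (\<forall>l1>0. \<exists>u0 :: nat \<Rightarrow> 'v \<Rightarrow> real. inj_on u0 {1..card \<Omega>} \<and>
          (\<forall>j\<in>{1..card \<Omega>}. (u0 j, \<lambda>_. 0) \<in>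
             semi_trivial (solutions G \<Omega> p q r \<alpha> \<beta> M1 M2 h1 h2 h3 g1 g2 l1 lam2))) \<and>
       (\<forall>l2>0. \<exists>v0 :: nat \<Rightarrow> 'v \<Rightarrow> real. inj_on v0 {1..card \<Omega>} \<and>
          (\<forall>j\<in>{1..card \<Omega>}. (\<lambda>_. 0, v0 j) \<in>
             semi_trivial (solutions G \<Omega> p q r \<alpha> \<beta> M1 M2 h1 h2 h3 g1 g2 lam1 l2))))"
proof -
  have fin: "finite \<Omega>"
    by (rule bounded_domain_finite[OF assms(1,2)])
  obtain e where e: "bij_betw e {..<card \<Omega>} \<Omega>"
    using ex_bij_betw_nat_finite[OF fin] by (auto simp: atLeast0LessThan)
  interpret dirichlet_domain G \<Omega>
    by (intro dirichlet_domain.intro dirichlet_domain_axioms.intro assms fin)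
  \<comment> \<open>The inhomogeneity is not an argument of the locale predicate, so one fact serves
    every \<open>g1\<close>; \<open>l\<close> is free because the multiplicity claim quantifies over
    the parameter.\<close>
  have P: "kirchhoff_problem G \<Omega> p r k a1 b1 l h1 e" if "l > 0" for l
    by unfold_locales (use assms e that in auto)
  have Q: "kirchhoff_problem G \<Omega> q r k a2 b2 l h3 e" if "l > 0" for l
    by unfold_locales (use assms e that in auto)
  have fst: "(u, \<lambda>_. 0) \<in> semi_trivial (solutions G \<Omega> p q r \<alpha> \<beta> M1 M2 h1 h2 h3 g1 g2 l lam2)"
    if "l > 0" "\<forall>x\<in>\<Omega>. g2 x = 0" "u \<in> C_c \<Omega>" "u \<noteq> (\<lambda>_. 0)"
      "\<forall>z\<in>\<Omega>. kirchhoff_problem.residual G \<Omega> p r k a1 b1 l h1 g1 u z = 0" for l u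
    using that assms(20) \<open>\<beta> > 0\<close> by (intro semi_trivial_fst) (auto simp: kirchhoff_problem.residual_eq_0_iff[OF P])
  have snd: "(\<lambda>_. 0, v) \<in> semi_trivial (solutions G \<Omega> p q r \<alpha> \<beta> M1 M2 h1 h2 h3 g1 g2 lam1 l)"
    if "l > 0" "\<forall>x\<in>\<Omega>. g1 x = 0" "v \<in> C_c \<Omega>" "v \<noteq> (\<lambda>_. 0)"
      "\<forall>z\<in>\<Omega>. kirchhoff_problem.residual G \<Omega> q r k a2 b2 l h3 g2 v z = 0" for l v
    using that assms(21) \<open>\<alpha> > 0\<close> by (intro semi_trivial_snd) (auto simp: kirchhoff_problem.residual_eq_0_iff[OF Q])
  show ?thesis
  proof (intro conjI impI allI)
    assume g: "(\<exists>x\<in>\<Omega>. g1 x \<noteq> 0) \<and> (\<forall>x\<in>\<Omega>. g2 x = 0)"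
    show "\<exists>u0. (u0, \<lambda>_. 0) \<in> semi_trivial (solutions G \<Omega> p q r \<alpha> \<beta> M1 M2 h1 h2 h3 g1 g2 lam1 lam2)"
      using kirchhoff_problem.nonzero_critical_point[OF P[OF \<open>lam1 > 0\<close>] conjunct1[OF g]] fst[OF \<open>lam1 > 0\<close>] g
      by metis
  next
    assume g: "(\<exists>x\<in>\<Omega>. g2 x \<noteq> 0) \<and> (\<forall>x\<in>\<Omega>. g1 x = 0)"
    show "\<exists>v0. (\<lambda>_. 0, v0) \<in> semi_trivial (solutions G \<Omega> p q r \<alpha> \<beta> M1 M2 h1 h2 h3 g1 g2 lam1 lam2)"
      using kirchhoff_problem.nonzero_critical_point[OF Q[OF \<open>lam2 > 0\<close>] conjunct1[OF g]] snd[OF \<open>lam2 > 0\<close>] g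
      by metis
  next
    fix l :: real
    assume g: "(\<forall>x\<in>\<Omega>. g1 x = 0) \<and> (\<forall>x\<in>\<Omega>. g2 x = 0)" and l: "0 < l"
    obtain w where "inj_on w {1..card \<Omega>}" "\<And>j. j \<in> {1..card \<Omega>} \<Longrightarrow>
        w j \<in> C_c \<Omega> \<and> w j \<noteq> (\<lambda>_. 0) \<and>
        (\<forall>z\<in>\<Omega>. kirchhoff_problem.residual G \<Omega> p r k a1 b1 l h1 g1 (w j) z = 0)"
      using kirchhoff_problem.enumerated_critical_points[OF P[OF l], of g1] g by metis
    then show "\<exists>u0 :: nat \<Rightarrow> 'v \<Rightarrow> real. inj_on u0 {1..card \<Omega>} \<and> (\<forall>j\<in>{1..card \<Omega>}. (u0 j, \<lambda>_. 0) \<in>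
        semi_trivial (solutions G \<Omega> p q r \<alpha> \<beta> M1 M2 h1 h2 h3 g1 g2 l lam2))"
      using fst[OF l] g by (intro exI[of _ w]) auto
  next
    fix l :: real
    assume g: "(\<forall>x\<in>\<Omega>. g1 x = 0) \<and> (\<forall>x\<in>\<Omega>. g2 x = 0)" and l: "0 < l"
    obtain w where "inj_on w {1..card \<Omega>}" "\<And>j. j \<in> {1..card \<Omega>} \<Longrightarrow>
        w j \<in> C_c \<Omega> \<and> w j \<noteq> (\<lambda>_. 0) \<and>
        (\<forall>z\<in>\<Omega>. kirchhoff_problem.residual G \<Omega> q r k a2 b2 l h3 g2 (w j) z = 0)"
      using kirchhoff_problem.enumerated_critical_points[OF Q[OF l], of g2] g by metis
    then show "\<exists>v0 :: nat \<Rightarrow> 'v \<Rightarrow> real. inj_on v0 {1..card \<Omega>} \<and> (\<forall>j\<in>{1..card \<Omega>}. (\<lambda>_. 0, v0 j) \<in>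
        semi_trivial (solutions G \<Omega> p q r \<alpha> \<beta> M1 M2 h1 h2 h3 g1 g2 lam1 l))"
      using snd[OF l] g by (intro exI[of _ w]) auto
  qed
qed

end
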